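(* Let $\gamma>1$, $\alpha>\frac12$, let $(\rho_\pm,u_\pm)$ with $\rho_\pm>0$ be end states connected by a 2-rarefaction wave, and let $q\ge2$. There is $\eta_0>0$, depending only on $\alpha,\gamma,q,\rho_\pm,u_\pm$, such that for $0<\eta\le\eta_0$ and the corresponding smooth 2-rarefaction wave $(\bar\rho,\bar u)$ (all defined in the context) the following holds. Let the initial data $(\rho_0,m_0)$, with $(\rho_0,m_0)(x)\to(\rho_\pm,\rho_\pm u_\pm)$ as $x\to\pm\infty$, satisfy $\rho_0\ge0$, $m_0=0$ a.e. on $\{\rho_0=0\}$, $(\rho_0^{\alpha-\frac12})_x\in L^2(\mathbb R)$, $\rho_0\Psi(\rho_0,\bar\rho_0)\in L^1(\mathbb R)$, $\rho_0(\frac{m_0}{\rho_0}-\bar u_0)^2\in L^1(\mathbb R)$ and $\rho_0(\frac{m_0}{\rho_0}-\bar u_0)^3\in L^1(\mathbb R)$. Let $(\rho,u)$ be any global weak solution (towards $(\bar\rho,\bar u)$, in the sense defined in the context) of the Cauchy problem $$\rho_t+(\rho u)_x=0,\qquad (\rho u)_t+(\rho u^2+\rho^\gamma)_x=(\rho^\alpha u_x)_x,\qquad (\rho,\rho u)(0,x)=(\rho_0,m_0)(x),$$ with $\rho\in C(\mathbb R\times[0,T])$ for every $T>0$, which contains vacuum states (i.e. $\rho=0$) at least at one point for some time, and for which there is a constant $C$ independent of $T$ such that for every $T>0$: $0\le\rho\le C$ on $\mathbb R\times[0,T]$ and $$\sup_{t\in[0,T]}\int_{\mathbb R}\Big(|\sqrt\rho(u-\bar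 u)|^2+[(\rho^{\alpha-\frac12})_x]^2+\frac1{\gamma-1}\big[\rho^\gamma-\bar\rho^\gamma-\gamma\bar\rho^{\gamma-1}(\rho-\bar\rho)\big]\Big)dx$$ $$+\int_0^T\int_{\mathbb R}\Big(\big[(\rho^{\frac{\gamma+\alpha-1}{2}}-\bar\rho^{\frac{\gamma+\alpha-1}{2}})_x\big]^2+\Lambda^2\Big)dx\,dt\le C,$$ where $\Lambda\in L^2(\mathbb R\times(0,T))$ satisfies, for all $\varphi\in C_0^\infty(\mathbb R\times(0,T))$, $$\int_0^T\!\!\int_{\mathbb R}\Lambda\varphi\,dxdt=-\int_0^T\!\!\int_{\mathbb R}\rho^{\alpha-\frac12}\sqrt\rho(u-\bar u)\varphi_x\,dxdt-\frac{2\alpha}{2\alpha-1}\int_0^T\!\!\int_{\mathbb R}(\rho^{\alpha-\frac12})_x\sqrt\rho(u-\bar u)\varphi\,dxdt.$$ Let $T_0>0$ be a time such that, for some $\rho_1$ with $0<\rho_1<\inf_{t,x}\bar\rho$, $$0<\rho_1\le\rho(t,x)\le C,\qquad (x,t)\in\mathbb R\times[T_0,\infty),$$ and let $T_1\in[0,T_0)$ be a time such that for some nonempty subset $\Omega^0\subset\mathbb R$, $$\rho(T_1,x)=0\ \ \forall x\in\Omega^0,\qquad \rho(T_1,x)>0\ \ \forall x\in\mathbb R\setminus\Omega^0,\qquad \rho(t,x)>0\ \ \forall(x,t)\in\mathbb R\times(T_1,T_0].$$ Then the solution blows up as vacuum states vanish in the following sense: for any $\sigma>0$, $$\lim_{t\to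 T_1^+}\int_t^{T_1+\sigma}\|u_x\|_{L^\infty(\mathbb R)}\,ds=\infty.$$ On the other hand, if there exists some $T_2\in(0,T_0)$ such that $$\|u-\bar u\|_{L^1(0,T_2;W^{1,\infty}(\mathbb R))}<\infty,$$ then there is a time $T_3\in[T_2,T_0)$ such that $$\lim_{t\to T_3^-}\int_0^t\|u_x\|_{L^\infty(\mathbb R)}\,ds=\infty.$$
   Context: Rarefaction wave. Let $p(\rho)=\rho^\gamma$, $\lambda_2(\rho,u)=u+\sqrt{p'(\rho)}$, $\Sigma_2(\rho,u)=u-\int_0^\rho\frac{\sqrt{p'(s)}}{s}ds$. The states $(\rho_\pm,u_\pm)$, $\rho_\pm>0$, are connected by a 2-rarefaction wave if $\Sigma_2(\rho_-,u_-)=\Sigma_2(\rho_+,u_+)$ and $w_-<w_+$, where $w_\pm:=\lambda_2(\rho_\pm,u_\pm)$. For $q\ge2$ and $\eta>0$ let $w(t,x)$ be the smooth solution of $$w_t+ww_x=0,\qquad w(0,x)=\frac{w_++w_-}{2}+\frac{w_+-w_-}{2}K_q\int_0^{\eta x}(1+y^2)^{-q}dy,\qquad K_q\int_0^\infty(1+y^2)^{-q}dy=1.$$ The smooth 2-rarefaction wave $(\bar\rho,\bar u)(t,x)$ is defined by $\lambda_2(\bar\rho,\bar u)(t,x)=w(1+t,x)$ and $\Sigma_2(\bar\rho,\bar u)(t,x)=\Sigma_2(\rho_\pm,u_\pm)$; it solves $\bar\rho_t+(\bar\rho\bar u)_x=0$, $(\bar\rho\bar u)_t+(\bar\rho\bar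 u^2+p(\bar\rho))_x=0$. Put $(\bar\rho_0,\bar u_0)=(\bar\rho,\bar u)(0,\cdot)$. Relative potential: $\rho\Psi(\rho,\bar\rho)=\frac1{\gamma-1}[\rho^\gamma-\bar\rho^\gamma-\gamma\bar\rho^{\gamma-1}(\rho-\bar\rho)]$. Expressions such as $\rho_0(\frac{m_0}{\rho_0}-\bar u_0)^k$ and $\sqrt\rho(u-\bar u)$ are taken to be $0$ where the density vanishes; $\rho u$ means $\sqrt\rho[\sqrt\rho(u-\bar u)]+\rho\bar u$. Weak solution towards $(\bar\rho,\bar u)$: a pair $(\rho,u)$ such that (1) $\rho\ge0$ a.e., $\rho(0,\cdot)=\rho_0$, and for every $T>0$: $\rho\in L^\infty(0,T;L^\infty(\mathbb R))$, $(\rho^{\alpha-\frac12})_x\in L^\infty(0,T;L^2(\mathbb R))$, $\sqrt\rho(u-\bar u)\in L^\infty(0,T;L^2(\mathbb R))$; moreover $\rho\in C([0,\infty);W^{1,\infty}(K)^* )$ for each compact interval $K\subset\mathbb R$ ($\rho$ acting by $\varphi\mapsto\int_K\rho\varphi\,dx$). (2) For all $t_2\ge t_1\ge0$ and $\zeta\in C_0^1(\mathbb R\times[t_1,t_2])$: $\int_{\mathbb R}(\rho-\bar\rho)\zeta\,dx\big|_{t_1}^{t_2}=\int_{t_1}^{t_2}\int_{\mathbb R}[(\rho-\bar\rho)\zeta_t+(\rho u-\bar\rho\bar u)\zeta_x]dxdt.$ (3) For all $T>0$ and $\psi\in C_0^\infty(\mathbb R\times[0,T))$: $$\int_{\mathbb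 R}(m_0-\bar\rho_0\bar u_0)\psi(0,x)dx+\int_0^T\!\!\int_{\mathbb R}\big\{\sqrt\rho[\sqrt\rho(u-\bar u)]+(\rho-\bar\rho)\bar u\big\}\psi_t\,dxdt$$ $$+\int_0^T\!\!\int_{\mathbb R}\big\{[\sqrt\rho(u-\bar u)]^2+2\sqrt\rho[\sqrt\rho(u-\bar u)]\bar u+(\rho-\bar\rho)\bar u^2+\rho^\gamma-\bar\rho^\gamma\big\}\psi_x\,dxdt$$ $$-\langle\rho^\alpha(u-\bar u)_x,\psi_x\rangle-\int_0^T\!\!\int_{\mathbb R}\rho^\alpha\bar u_x\psi_x\,dxdt=0,$$ where $\langle\rho^\alpha(u-\bar u)_x,\phi\rangle:=-\int_0^T\int_{\mathbb R}\rho^{\alpha-\frac12}\sqrt\rho(u-\bar u)\phi_x\,dxdt-\frac{2\alpha}{2\alpha-1}\int_0^T\int_{\mathbb R}(\rho^{\alpha-\frac12})_x\sqrt\rho(u-\bar u)\phi\,dxdt.$ *)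

theory Defs
  imports "HOL-Analysis.Analysis" "HOL-Probability.Essential_Supremum"
begin

text \<open>
  Space-time points are pairs \<open>(t, x)\<close>, time first. A velocity \<open>u\<close> is a total function; its
  values where the density vanishes are irrelevant in every expression carrying a factor
  \<open>\<rho>\<close> or \<open>sqrt \<rho>\<close>, because such an expression is then literally \<open>0\<close>. Note \<open>0 powr a = 0\<close> and
  \<open>a / 0 = 0\<close>.
\<close>

section \<open>Test functions and weak derivatives\<close>

text \<open>Derivatives are taken within \<open>S\<close>, hence one-sided on the part of the boundary of \<open>S\<close>
  that belongs to \<open>S\<close>.\<close>

primrec Ck_on :: "nat \<Rightarrow> 'a::euclidean_space set \<Rightarrow> ('a \<Rightarrow> real) \<Rightarrow> bool" where
  "Ck_on 0 S f \<longleftrightarrow> continuous_on S f"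
| "Ck_on (Suc k) S f \<longleftrightarrow>
     (\<exists>D. (\<forall>z\<in>S. (f has_derivative D z) (at z within S)) \<and> (\<forall>v. Ck_on k S (\<lambda>z. D z v)))"

definition smooth_on :: "'a::euclidean_space set \<Rightarrow> ('a \<Rightarrow> real) \<Rightarrow> bool" where
  "smooth_on S f \<longleftrightarrow> (\<forall>k. Ck_on k S f)"

definition compact_supp_in :: "'a::euclidean_space set \<Rightarrow> ('a \<Rightarrow> real) \<Rightarrow> bool" where
  "compact_supp_in S f \<longleftrightarrow> (\<exists>K. compact K \<and> K \<subseteq> S \<and> (\<forall>z\<in>S - K. f z = 0))"

definition test_Ck :: "nat \<Rightarrow> 'a::euclidean_space set \<Rightarrow> ('a \<Rightarrow> real) \<Rightarrow> bool" where
  "test_Ck k S f \<longleftrightarrow> Ck_on k S f \<and> compact_supp_in S f"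

definition test_smooth :: "'a::euclidean_space set \<Rightarrow> ('a \<Rightarrow> real) \<Rightarrow> bool" where
  "test_smooth S f \<longleftrightarrow> smooth_on S f \<and> compact_supp_in S f"

text \<open>Classical two-sided derivative. Below it is applied to test functions and to the rarefaction
  wave at interior points only: all space-time integrals are over open strips.\<close>

definition dir_deriv :: "'a::euclidean_space \<Rightarrow> ('a \<Rightarrow> real) \<Rightarrow> 'a \<Rightarrow> real" where
  "dir_deriv v f z = frechet_derivative f (at z) v"

abbreviation dt :: "(real \<times> real \<Rightarrow> real) \<Rightarrow> real \<times> real \<Rightarrow> real" where
  "dt \<equiv> dir_deriv (1, 0)"

abbreviation dx :: "(real \<times> real \<Rightarrow> real) \<Rightarrow> real \<times> real \<Rightarrow> real" where
  "dx \<equiv> dir_deriv (0, 1)"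

definition loc_integrable :: "'a::euclidean_space set \<Rightarrow> ('a \<Rightarrow> real) \<Rightarrow> bool" where
  "loc_integrable U f \<longleftrightarrow> (\<forall>K. compact K \<and> K \<subseteq> U \<longrightarrow> set_integrable lebesgue K f)"

definition is_weak_deriv ::
    "'a::euclidean_space \<Rightarrow> 'a set \<Rightarrow> ('a \<Rightarrow> real) \<Rightarrow> ('a \<Rightarrow> real) \<Rightarrow> bool" where
  "is_weak_deriv v U f g \<longleftrightarrow> loc_integrable U f \<and> loc_integrable U g \<and>
     (\<forall>\<phi>. test_smooth U \<phi> \<longrightarrow>
        (LINT z:U|lebesgue. f z * dir_deriv v \<phi> z) = - (LINT z:U|lebesgue. g z * \<phi> z))"

definition weakly_diff :: "'a::euclidean_space \<Rightarrow> 'a set \<Rightarrow> ('a \<Rightarrow> real) \<Rightarrow> bool" where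
  "weakly_diff v U f \<longleftrightarrow> (\<exists>g. is_weak_deriv v U f g)"

text \<open>A representative of the weak derivative, which is unique almost everywhere when it exists;
  meaningful only if \<open>weakly_diff v U f\<close>.\<close>

definition weak_deriv :: "'a::euclidean_space \<Rightarrow> 'a set \<Rightarrow> ('a \<Rightarrow> real) \<Rightarrow> 'a \<Rightarrow> real" where
  "weak_deriv v U f = (SOME g. is_weak_deriv v U f g)"

abbreviation half_plane :: "(real \<times> real) set" where
  "half_plane \<equiv> {0<..} \<times> UNIV"

abbreviation strip :: "real \<Rightarrow> (real \<times> real) set" where
  "strip T \<equiv> {0<..<T} \<times> UNIV"

abbreviation wdx :: "(real \<times> real \<Rightarrow> real) \<Rightarrow> real \<times> real \<Rightarrow> real" where
  "wdx \<equiv> weak_deriv (0, 1) half_plane"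

section \<open>Function spaces\<close>

text \<open>\<^const>\<open>esssup\<close> is \<open>\<infinity>\<close> for non-measurable functions, so finiteness includes measurability.\<close>

definition Linf_norm :: "'a::euclidean_space set \<Rightarrow> ('a \<Rightarrow> real) \<Rightarrow> ennreal" where
  "Linf_norm U f = esssup (lebesgue_on U) (\<lambda>z. ennreal \<bar>f z\<bar>)"

text \<open>The \<open>L\<^sup>\<infinity>(U)\<close> norm of the derivative of \<open>f\<close>, with value \<open>\<infinity>\<close> if the weak derivative is not
  an essentially bounded function (in particular if it is not a function).\<close>

definition Linf_norm_deriv :: "real set \<Rightarrow> (real \<Rightarrow> real) \<Rightarrow> ennreal" where
  "Linf_norm_deriv U f =
     (if weakly_diff 1 U f then Linf_norm U (weak_deriv 1 U f) else \<infinity>)"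

definition W1inf_norm :: "real set \<Rightarrow> (real \<Rightarrow> real) \<Rightarrow> ennreal" where
  "W1inf_norm U f = Linf_norm U f + Linf_norm_deriv U f"

definition L2_on :: "'a::euclidean_space set \<Rightarrow> ('a \<Rightarrow> real) \<Rightarrow> bool" where
  "L2_on S f \<longleftrightarrow> f \<in> borel_measurable (lebesgue_on S) \<and>
     (\<integral>\<^sup>+ z\<in>S. ennreal ((f z)\<^sup>2) \<partial>lebesgue) < \<infinity>"

definition Linf_Linf :: "real \<Rightarrow> (real \<times> real \<Rightarrow> real) \<Rightarrow> bool" where
  "Linf_Linf T f \<longleftrightarrow> Linf_norm (strip T) f < \<infinity>"

definition Linf_L2 :: "real \<Rightarrow> (real \<times> real \<Rightarrow> real) \<Rightarrow> bool" where
  "Linf_L2 T f \<longleftrightarrow> f \<in> borel_measurable (lebesgue_on (strip T)) \<and>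
     esssup (lebesgue_on {0<..<T}) (\<lambda>t. \<integral>\<^sup>+ x. ennreal ((f (t, x))\<^sup>2) \<partial>lebesgue) < \<infinity>"

definition L1_W1inf :: "real \<Rightarrow> (real \<times> real \<Rightarrow> real) \<Rightarrow> bool" where
  "L1_W1inf T f \<longleftrightarrow> f \<in> borel_measurable (lebesgue_on (strip T)) \<and>
     (\<integral>\<^sup>+ t\<in>{0<..<T}. W1inf_norm UNIV (\<lambda>x. f (t, x)) \<partial>lebesgue) < \<infinity>"

text \<open>Norm in the dual of \<open>W\<^sup>1\<^sup>,\<^sup>\<infinity>([a, b])\<close> of the functional \<open>\<phi> \<mapsto> \<integral>\<^bsub>[a,b]\<^esub> f \<phi> dx\<close>.\<close>

definition W1inf_dual_norm :: "real \<Rightarrow> real \<Rightarrow> (real \<Rightarrow> real) \<Rightarrow> ennreal" where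
  "W1inf_dual_norm a b f =
     (SUP \<phi>\<in>{\<phi>. W1inf_norm {a<..<b} \<phi> \<le> 1}. ennreal \<bar>LINT x:{a..b}|lebesgue. f x * \<phi> x\<bar>)"

definition cont_W1inf_dual :: "(real \<times> real \<Rightarrow> real) \<Rightarrow> bool" where
  "cont_W1inf_dual \<rho> \<longleftrightarrow> (\<forall>a b. a < b \<longrightarrow>
     (\<forall>t\<ge>0. set_integrable lebesgue {a..b} (\<lambda>x. \<rho> (t, x))) \<and>
     (\<forall>t\<ge>0. ((\<lambda>s. W1inf_dual_norm a b (\<lambda>x. \<rho> (s, x) - \<rho> (t, x))) \<longlongrightarrow> 0) (at t within {0..})))"

section \<open>Rarefaction waves\<close>

definition pressure :: "real \<Rightarrow> real \<Rightarrow> real" where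
  "pressure \<gamma> \<rho> = \<rho> powr \<gamma>"

definition lambda2 :: "real \<Rightarrow> real \<Rightarrow> real \<Rightarrow> real" where
  "lambda2 \<gamma> \<rho> u = u + sqrt (deriv (pressure \<gamma>) \<rho>)"

definition Sigma2 :: "real \<Rightarrow> real \<Rightarrow> real \<Rightarrow> real" where
  "Sigma2 \<gamma> \<rho> u = u - (LINT s:{0<..<\<rho>}|lebesgue. sqrt (deriv (pressure \<gamma>) s) / s)"

definition connected_2_rarefaction :: "real \<Rightarrow> real \<Rightarrow> real \<Rightarrow> real \<Rightarrow> real \<Rightarrow> bool" where
  "connected_2_rarefaction \<gamma> \<rho>m um \<rho>p up \<longleftrightarrow>
     Sigma2 \<gamma> \<rho>m um = Sigma2 \<gamma> \<rho>p up \<and> lambda2 \<gamma> \<rho>m um < lambda2 \<gamma> \<rho>p up"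

definition Kq :: "real \<Rightarrow> real" where
  "Kq q = 1 / (LBINT y=0..\<infinity>. (1 + y\<^sup>2) powr (- q))"

definition burgers_solution ::
    "real \<Rightarrow> real \<Rightarrow> real \<Rightarrow> real \<Rightarrow> (real \<times> real \<Rightarrow> real) \<Rightarrow> bool" where
  "burgers_solution q \<eta> wm wp w \<longleftrightarrow>
     smooth_on ({0..} \<times> UNIV) w \<and>
     (\<forall>z\<in>half_plane. dt w z + w z * dx w z = 0) \<and>
     (\<forall>x. w (0, x) = (wp + wm) / 2 +
        (wp - wm) / 2 * Kq q * (LBINT y=ereal 0..ereal (\<eta> * x). (1 + y\<^sup>2) powr (- q)))"

definition smooth_2_rarefaction ::
    "real \<Rightarrow> real \<Rightarrow> real \<Rightarrow> real \<Rightarrow> real \<Rightarrow> real \<Rightarrow> real \<Rightarrow>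
     (real \<times> real \<Rightarrow> real) \<Rightarrow> (real \<times> real \<Rightarrow> real) \<Rightarrow> bool" where
  "smooth_2_rarefaction \<gamma> q \<eta> \<rho>m um \<rho>p up rbar ubar \<longleftrightarrow>
     (\<exists>w. burgers_solution q \<eta> (lambda2 \<gamma> \<rho>m um) (lambda2 \<gamma> \<rho>p up) w \<and>
        (\<forall>t\<ge>0. \<forall>x. rbar (t, x) > 0 \<and>
           lambda2 \<gamma> (rbar (t, x)) (ubar (t, x)) = w (1 + t, x) \<and>
           Sigma2 \<gamma> (rbar (t, x)) (ubar (t, x)) = Sigma2 \<gamma> \<rho>m um \<and>
           Sigma2 \<gamma> (rbar (t, x)) (ubar (t, x)) = Sigma2 \<gamma> \<rho>p up))"

section \<open>Initial data and weak solutions\<close>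

text \<open>\<open>rel_potential \<gamma> \<rho> r\<close> is the product \<open>\<rho> \<Psi>(\<rho>, r)\<close>; it is nonnegative for
  \<open>\<rho>, r \<ge> 0\<close> and \<open>\<gamma> > 1\<close>.\<close>

definition rel_potential :: "real \<Rightarrow> real \<Rightarrow> real \<Rightarrow> real" where
  "rel_potential \<gamma> \<rho> r =
     1 / (\<gamma> - 1) * (\<rho> powr \<gamma> - r powr \<gamma> - \<gamma> * r powr (\<gamma> - 1) * (\<rho> - r))"

definition admissible_data ::
    "real \<Rightarrow> real \<Rightarrow> real \<Rightarrow> real \<Rightarrow> real \<Rightarrow> real \<Rightarrow>
     (real \<times> real \<Rightarrow> real) \<Rightarrow> (real \<times> real \<Rightarrow> real) \<Rightarrow> (real \<Rightarrow> real) \<Rightarrow> (real \<Rightarrow> real) \<Rightarrow> bool" where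
  "admissible_data \<gamma> \<alpha> \<rho>m um \<rho>p up rbar ubar \<rho>0 m0 \<longleftrightarrow>
     \<rho>0 \<in> borel_measurable lebesgue \<and> m0 \<in> borel_measurable lebesgue \<and>
     (\<rho>0 \<longlongrightarrow> \<rho>m) at_bot \<and> (\<rho>0 \<longlongrightarrow> \<rho>p) at_top \<and>
     (m0 \<longlongrightarrow> \<rho>m * um) at_bot \<and> (m0 \<longlongrightarrow> \<rho>p * up) at_top \<and>
     (AE x in lebesgue. 0 \<le> \<rho>0 x) \<and>
     (AE x in lebesgue. \<rho>0 x = 0 \<longrightarrow> m0 x = 0) \<and>
     weakly_diff 1 UNIV (\<lambda>x. \<rho>0 x powr (\<alpha> - 1/2)) \<and>
     L2_on UNIV (weak_deriv 1 UNIV (\<lambda>x. \<rho>0 x powr (\<alpha> - 1/2))) \<and>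
     integrable lebesgue (\<lambda>x. rel_potential \<gamma> (\<rho>0 x) (rbar (0, x))) \<and>
     integrable lebesgue (\<lambda>x. \<rho>0 x * (m0 x / \<rho>0 x - ubar (0, x))^2) \<and>
     integrable lebesgue (\<lambda>x. \<rho>0 x * (m0 x / \<rho>0 x - ubar (0, x))^3)"

definition wvel ::
    "(real \<times> real \<Rightarrow> real) \<Rightarrow> (real \<times> real \<Rightarrow> real) \<Rightarrow> (real \<times> real \<Rightarrow> real) \<Rightarrow> real \<times> real \<Rightarrow> real"
  where "wvel ubar \<rho> u z = sqrt (\<rho> z) * (u z - ubar z)"

definition mom ::
    "(real \<times> real \<Rightarrow> real) \<Rightarrow> (real \<times> real \<Rightarrow> real) \<Rightarrow> (real \<times> real \<Rightarrow> real) \<Rightarrow> real \<times> real \<Rightarrow> real"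
  where "mom ubar \<rho> u z = sqrt (\<rho> z) * wvel ubar \<rho> u z + \<rho> z * ubar z"

text \<open>The pairing of the viscous term \<open>\<rho>\<^sup>\<alpha> (u - ubar)\<^sub>x\<close> with \<open>\<phi>\<close> over \<open>(0, T) \<times> \<real>\<close>.\<close>

definition visc_pairing ::
    "real \<Rightarrow> real \<Rightarrow> (real \<times> real \<Rightarrow> real) \<Rightarrow> (real \<times> real \<Rightarrow> real) \<Rightarrow> (real \<times> real \<Rightarrow> real) \<Rightarrow>
     (real \<times> real \<Rightarrow> real) \<Rightarrow> real" where
  "visc_pairing \<alpha> T ubar \<rho> u \<phi> =
     - (LINT z:strip T|lebesgue. \<rho> z powr (\<alpha> - 1/2) * wvel ubar \<rho> u z * dx \<phi> z)
     - 2 * \<alpha> / (2 * \<alpha> - 1) *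
       (LINT z:strip T|lebesgue. wdx (\<lambda>z. \<rho> z powr (\<alpha> - 1/2)) z * wvel ubar \<rho> u z * \<phi> z)"

definition weak_regularity ::
    "real \<Rightarrow> (real \<times> real \<Rightarrow> real) \<Rightarrow> (real \<Rightarrow> real) \<Rightarrow> (real \<times> real \<Rightarrow> real) \<Rightarrow>
     (real \<times> real \<Rightarrow> real) \<Rightarrow> bool" where
  "weak_regularity \<alpha> ubar \<rho>0 \<rho> u \<longleftrightarrow>
     (AE z in lebesgue_on half_plane. 0 \<le> \<rho> z) \<and>
     (AE x in lebesgue. \<rho> (0, x) = \<rho>0 x) \<and>
     weakly_diff (0, 1) half_plane (\<lambda>z. \<rho> z powr (\<alpha> - 1/2)) \<and>
     (\<forall>T>0. Linf_Linf T \<rho> \<and> Linf_L2 T (wdx (\<lambda>z. \<rho> z powr (\<alpha> - 1/2))) \<and>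
        Linf_L2 T (wvel ubar \<rho> u)) \<and>
     cont_W1inf_dual \<rho>"

definition weak_mass ::
    "(real \<times> real \<Rightarrow> real) \<Rightarrow> (real \<times> real \<Rightarrow> real) \<Rightarrow> (real \<times> real \<Rightarrow> real) \<Rightarrow>
     (real \<times> real \<Rightarrow> real) \<Rightarrow> bool" where
  "weak_mass rbar ubar \<rho> u \<longleftrightarrow>
     (\<forall>t1 t2 \<zeta>. 0 \<le> t1 \<and> t1 \<le> t2 \<and> test_Ck 1 ({t1..t2} \<times> UNIV) \<zeta> \<longrightarrow>
        (LINT x|lebesgue. (\<rho> (t2, x) - rbar (t2, x)) * \<zeta> (t2, x))
        - (LINT x|lebesgue. (\<rho> (t1, x) - rbar (t1, x)) * \<zeta> (t1, x))
        = (LINT z:{t1<..<t2} \<times> UNIV|lebesgue.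
             (\<rho> z - rbar z) * dt \<zeta> z + (mom ubar \<rho> u z - rbar z * ubar z) * dx \<zeta> z))"

definition weak_momentum ::
    "real \<Rightarrow> real \<Rightarrow> (real \<times> real \<Rightarrow> real) \<Rightarrow> (real \<times> real \<Rightarrow> real) \<Rightarrow> (real \<Rightarrow> real) \<Rightarrow>
     (real \<times> real \<Rightarrow> real) \<Rightarrow> (real \<times> real \<Rightarrow> real) \<Rightarrow> bool" where
  "weak_momentum \<gamma> \<alpha> rbar ubar m0 \<rho> u \<longleftrightarrow>
     (\<forall>T \<psi>. 0 < T \<and> test_smooth ({0..<T} \<times> UNIV) \<psi> \<longrightarrow>
        (LINT x|lebesgue. (m0 x - rbar (0, x) * ubar (0, x)) * \<psi> (0, x))
        + (LINT z:strip T|lebesgue.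
             (sqrt (\<rho> z) * wvel ubar \<rho> u z + (\<rho> z - rbar z) * ubar z) * dt \<psi> z)
        + (LINT z:strip T|lebesgue.
             ((wvel ubar \<rho> u z)\<^sup>2 + 2 * sqrt (\<rho> z) * wvel ubar \<rho> u z * ubar z
              + (\<rho> z - rbar z) * (ubar z)\<^sup>2 + \<rho> z powr \<gamma> - rbar z powr \<gamma>) * dx \<psi> z)
        - visc_pairing \<alpha> T ubar \<rho> u (dx \<psi>)
        - (LINT z:strip T|lebesgue. \<rho> z powr \<alpha> * dx ubar z * dx \<psi> z) = 0)"

definition weak_solution ::
    "real \<Rightarrow> real \<Rightarrow> (real \<times> real \<Rightarrow> real) \<Rightarrow> (real \<times> real \<Rightarrow> real) \<Rightarrow> (real \<Rightarrow> real) \<Rightarrow>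
     (real \<Rightarrow> real) \<Rightarrow> (real \<times> real \<Rightarrow> real) \<Rightarrow> (real \<times> real \<Rightarrow> real) \<Rightarrow> bool" where
  "weak_solution \<gamma> \<alpha> rbar ubar \<rho>0 m0 \<rho> u \<longleftrightarrow>
     weak_regularity \<alpha> ubar \<rho>0 \<rho> u \<and> weak_mass rbar ubar \<rho> u \<and>
     weak_momentum \<gamma> \<alpha> rbar ubar m0 \<rho> u"

definition is_Lambda ::
    "real \<Rightarrow> real \<Rightarrow> (real \<times> real \<Rightarrow> real) \<Rightarrow> (real \<times> real \<Rightarrow> real) \<Rightarrow> (real \<times> real \<Rightarrow> real) \<Rightarrow>
     (real \<times> real \<Rightarrow> real) \<Rightarrow> bool" where
  "is_Lambda \<alpha> T ubar \<rho> u \<Lambda> \<longleftrightarrow> L2_on (strip T) \<Lambda> \<and>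
     (\<forall>\<phi>. test_smooth (strip T) \<phi> \<longrightarrow>
        (LINT z:strip T|lebesgue. \<Lambda> z * \<phi> z) = visc_pairing \<alpha> T ubar \<rho> u \<phi>)"

text \<open>The supremum in time is an essential one, since \<open>sqrt \<rho> (u - ubar)\<close> and the weak derivative
  of \<open>\<rho> powr (\<alpha> - 1/2)\<close> are only determined for almost every time.\<close>

definition uniform_bounds ::
    "real \<Rightarrow> real \<Rightarrow> (real \<times> real \<Rightarrow> real) \<Rightarrow> (real \<times> real \<Rightarrow> real) \<Rightarrow>
     (real \<times> real \<Rightarrow> real) \<Rightarrow> (real \<times> real \<Rightarrow> real) \<Rightarrow> real \<Rightarrow> bool" where
  "uniform_bounds \<gamma> \<alpha> rbar ubar \<rho> u C \<longleftrightarrow>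
     weakly_diff (0, 1) half_plane
       (\<lambda>z. \<rho> z powr ((\<gamma> + \<alpha> - 1) / 2) - rbar z powr ((\<gamma> + \<alpha> - 1) / 2)) \<and>
     (\<forall>T>0. (\<forall>z\<in>{0..T} \<times> UNIV. 0 \<le> \<rho> z \<and> \<rho> z \<le> C) \<and>
        (\<exists>\<Lambda>. is_Lambda \<alpha> T ubar \<rho> u \<Lambda> \<and>
           esssup (lebesgue_on {0..T}) (\<lambda>t. \<integral>\<^sup>+ x. ennreal
              ((wvel ubar \<rho> u (t, x))\<^sup>2 + (wdx (\<lambda>z. \<rho> z powr (\<alpha> - 1/2)) (t, x))\<^sup>2
               + rel_potential \<gamma> (\<rho> (t, x)) (rbar (t, x))) \<partial>lebesgue)
           + (\<integral>\<^sup>+ z\<in>strip T. ennreal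
              ((wdx (\<lambda>z. \<rho> z powr ((\<gamma> + \<alpha> - 1) / 2) - rbar z powr ((\<gamma> + \<alpha> - 1) / 2)) z)\<^sup>2
               + (\<Lambda> z)\<^sup>2) \<partial>lebesgue)
           \<le> ennreal C))"

end

theory Submission
  imports Defs "HOL-Computational_Algebra.Polynomial"
begin

text \<open>
  Suppose that the integral of \<open>\<parallel>u\<^sub>x\<parallel>\<^sub>\<infinity>\<close> over \<open>(T1, T1 + \<sigma>)\<close> is finite. The density is
  positive after \<open>T1\<close>, so the velocity is locally square integrable in space and has a representative \<open>v\<close>
  that is Lipschitz in \<open>x\<close> with a constant integrable in time; the energy bound at a point where
  \<open>\<rho>(T1, \<cdot>) > 0\<close> makes \<open>v\<close> itself integrable in time. Hence particle paths exist on a short interval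
  \<open>[T1, b]\<close>, the distance of two paths changes at most by a bounded factor, and the mass between them is
  conserved. Take one path through a vacuum point \<open>x0\<close> and one through \<open>x0 + h\<close>: the mass between them
  is \<open>o(h)\<close> at time \<open>T1\<close>, whereas \<open>\<rho>(b, \<cdot>) > 0\<close> forces it to be at least of order \<open>h\<close>
  at time \<open>b\<close>. For the second assertion, the first one already makes the integral over
  \<open>(0, t)\<close> infinite for every \<open>t > T1\<close>.
\<close>

subsection \<open>Smooth step functions\<close>

text \<open>Three measurability and regularity gaps shape the proof. Nothing is known of
  \<open>u\<close> itself, only of \<open>sqrt \<rho> (u - ubar)\<close>, so the velocity is rebuilt
  from a Borel version of that product divided by \<open>sqrt \<rho>\<close>. The time function
  given by the sup norm of \<open>u_x\<close> rests on a weak derivative picked by choice separately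
  at each time, so it is not known to be measurable; it is replaced by a Borel minorant, a supremum
  over rational parameters of second differences of the primitive of the velocity. The same second
  differences produce the Lipschitz representative. Finally, the density is merely continuous and
  the paths merely absolutely continuous, so the mass between two paths cannot be differentiated in
  time; increments over short time steps are estimated instead. The energy enters twice: its
  potential part excludes a density that vanishes identically at \<open>T1\<close>, and its kinetic
  part controls one spatial average of the velocity. The time interval is shortened until the
  Lipschitz constant has integral at most 1/4, which gives both the contraction and the comparison
  of paths.\<close>

lemma Ck_on_add:
  "Ck_on k S f \<Longrightarrow> Ck_on k S g \<Longrightarrow> Ck_on k S (\<lambda>z. f z + g z)"
proof (induction k arbitrary: f g)
  case 0
  then show ?case by (auto intro: continuous_intros)
next
  case (Suc k)
  from Suc.prems obtain D1 D2 where
    D1: "\<forall>z\<in>S. (f has_derivative D1 z) (at z within S)" "\<forall>v. Ck_on k S (\<lambda>z. D1 z v)" and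
    D2: "\<forall>z\<in>S. (g has_derivative D2 z) (at z within S)" "\<forall>v. Ck_on k S (\<lambda>z. D2 z v)"
    by auto
  show ?case
    unfolding Ck_on.simps
    by (rule exI[of _ "\<lambda>z v. D1 z v + D2 z v"]) (auto intro!: has_derivative_add D1 D2 Suc.IH D1(1)[rule_format] D2(1)[rule_format] D1(2)[rule_format] D2(2)[rule_format])
qed

lemma Ck_on_const: "Ck_on k S (\<lambda>z. c)"
proof (induction k arbitrary: c)
  case (Suc k)
  show ?case
    unfolding Ck_on.simps by (rule exI[of _ "\<lambda>z v. 0"]) (auto simp: Suc.IH)
qed (auto intro: continuous_intros)

text \<open>Lowering the order is needed for the product rule, where derivatives of order
  \<open>k\<close> are multiplied by the undifferentiated factors.\<close>

lemma Ck_on_SucD: "Ck_on (Suc k) S f \<Longrightarrow> Ck_on k S f"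
proof (induction k arbitrary: f)
  case 0
  then show ?case by (auto intro: has_derivative_continuous_on)
next
  case (Suc k)
  then obtain D where D: "\<forall>z\<in>S. (f has_derivative D z) (at z within S)" "\<forall>v. Ck_on (Suc k) S (\<lambda>z. D z v)"
    unfolding Ck_on.simps(2)[of "Suc k"] by blast
  then have "\<forall>v. Ck_on k S (\<lambda>z. D z v)"
    using Suc.IH by blast
  with D(1) show ?case by (auto intro!: exI[of _ D])
qed

lemma Ck_on_mult:
  "Ck_on k S f \<Longrightarrow> Ck_on k S g \<Longrightarrow> Ck_on k S (\<lambda>z. f z * g z)"
proof (induction k arbitrary: f g)
  case 0
  then show ?case by (auto intro: continuous_intros)
next
  case (Suc k)
  from Suc.prems obtain D1 D2 where
    D1: "\<forall>z\<in>S. (f has_derivative D1 z) (at z within S)" "\<forall>v. Ck_on k S (\<lambda>z. D1 z v)" and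
    D2: "\<forall>z\<in>S. (g has_derivative D2 z) (at z within S)" "\<forall>v. Ck_on k S (\<lambda>z. D2 z v)"
    by auto
  have "Ck_on k S f" "Ck_on k S g" using Suc.prems Ck_on_SucD by blast+
  then have "Ck_on k S (\<lambda>z. f z * D2 z v + D1 z v * g z)" for v
    by (intro Ck_on_add Suc.IH D1(2)[rule_format] D2(2)[rule_format])
  moreover have "\<forall>z\<in>S. ((\<lambda>z. f z * g z) has_derivative (\<lambda>v. f z * D2 z v + D1 z v * g z)) (at z within S)"
    by (intro ballI has_derivative_mult D1(1)[rule_format] D2(1)[rule_format])
  ultimately show ?case
    unfolding Ck_on.simps by (intro exI[of _ "\<lambda>z v. f z * D2 z v + D1 z v * g z"] conjI allI)
qed

lemma Ck_on_affine:
  fixes f :: "real \<Rightarrow> real"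
  shows "Ck_on k UNIV f \<Longrightarrow> Ck_on k UNIV (\<lambda>x. f (c * x + d))"
proof (induction k arbitrary: f)
  case 0
  then show ?case
    by (auto intro!: continuous_on_compose2[of UNIV f] continuous_intros)
next
  case (Suc k)
  then obtain D where D: "\<And>z. (f has_derivative D z) (at z)" "\<And>v. Ck_on k UNIV (\<lambda>z. D z v)"
    by auto
  have "((\<lambda>x. f (c * x + d)) has_derivative (\<lambda>v. D (c * z + d) (c * v))) (at z)" for z
    by (rule has_derivative_compose[OF _ D(1)]) (auto intro!: derivative_eq_intros)
  moreover have "Ck_on k UNIV (\<lambda>z. D (c * z + d) (c * v))" for v
    using Suc.IH[OF D(2)] .
  ultimately show ?case
    unfolding Ck_on.simps by (intro exI[of _ "\<lambda>z v. D (c * z + d) (c * v)"]) auto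
qed

lemma Ck_on_SucI_real:
  fixes f :: "real \<Rightarrow> real"
  assumes "\<And>x. (f has_real_derivative f' x) (at x)" "Ck_on k UNIV f'"
  shows "Ck_on (Suc k) UNIV f"
  unfolding Ck_on.simps
  using assms by (intro exI[of _ "\<lambda>z v. f' z * v"]) (auto simp: has_field_derivative_def intro!: Ck_on_mult Ck_on_const)

lemma smooth_on_antiderivative:
  fixes f :: "real \<Rightarrow> real"
  assumes "\<And>x. (f has_real_derivative f' x) (at x)" "smooth_on UNIV f'"
  shows "smooth_on UNIV f"
  unfolding smooth_on_def
proof
  fix k
  have "Ck_on (Suc k) UNIV f"
    using assms by (intro Ck_on_SucI_real[of f f']) (auto simp: smooth_on_def)
  then show "Ck_on k UNIV f" by (rule Ck_on_SucD)
qed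

text \<open>The polynomial parameter makes the family closed under differentiation, so smoothness
  follows by one induction on the order; \<open>flat_fun 1\<close> is the classical function
  exp(-1/x), extended by 0.\<close>

definition flat_fun :: "real poly \<Rightarrow> real \<Rightarrow> real" where
  "flat_fun p x = (if x > 0 then poly p (1 / x) * exp (- (1 / x)) else 0)"

lemma poly_times_exp_minus_tendsto_0:
  "((\<lambda>y::real. y ^ n * poly p y * exp (- y)) \<longlongrightarrow> 0) at_top"
proof (induction p arbitrary: n)
  case 0
  then show ?case by simp
next
  \<comment> \<open>Horner's scheme moves one factor \<open>y\<close> from the polynomial into the
    power, which is why the exponent \<open>n\<close> is general in the induction.\<close>
  case (pCons a p)
  have "((\<lambda>y::real. a * (y ^ n / exp y) + y ^ Suc n * poly p y * exp (- y)) \<longlongrightarrow> a * 0 + 0) at_top"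
    by (intro tendsto_intros tendsto_power_div_exp_0 pCons.IH)
  then show ?case
    by (simp add: exp_minus field_simps)
qed

text \<open>The chain rule for 1/x contributes the factor 1/x^2, that is the polynomial
  \<open>[:0, 0, 1:]\<close>, while differentiating the exponential and the polynomial gives
  \<open>p\<close> and \<open>- pderiv p\<close>. Only the point 0 requires a limit.\<close>

lemma flat_fun_deriv:
  "(flat_fun p has_real_derivative flat_fun ([:0, 0, 1:] * (p - pderiv p)) x) (at x)"
proof -
  consider "x > 0" | "x < 0" | "x = 0" by linarith
  then show ?thesis
  proof cases
    case 1
    have "((\<lambda>x. poly p (1 / x) * exp (- (1 / x))) has_real_derivative
        flat_fun ([:0, 0, 1:] * (p - pderiv p)) x) (at x)"
      using 1 unfolding flat_fun_def
      by (auto intro!: derivative_eq_intros DERIV_chain2[OF poly_DERIV] simp: field_simps power2_eq_square)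
    then show ?thesis
      by (rule has_field_derivative_transform_within_open[where S = "{0<..}"]) (use 1 in \<open>auto simp: flat_fun_def\<close>)
  next
    case 2
    have "((\<lambda>x. 0) has_real_derivative flat_fun ([:0, 0, 1:] * (p - pderiv p)) x) (at x)"
      using 2 by (simp add: flat_fun_def)
    then show ?thesis
      by (rule has_field_derivative_transform_within_open[where S = "{..<0}"]) (use 2 in \<open>auto simp: flat_fun_def\<close>)
  next
    case 3
    have "((\<lambda>h. (flat_fun p (0 + h) - flat_fun p 0) / h) \<longlongrightarrow> 0) (at (0::real))"
    proof (subst filterlim_at_split, intro conjI)
      show "((\<lambda>h. (flat_fun p (0 + h) - flat_fun p 0) / h) \<longlongrightarrow> 0) (at_left 0)"
        by (rule Lim_transform_eventually[of "\<lambda>_. 0"])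
          (auto simp: eventually_at_left_field flat_fun_def intro: exI[of _ "-1"])
      \<comment> \<open>With y = 1/h the division by h is one more factor y, hence the power
        1.\<close>
      have "((\<lambda>h. (inverse h) ^ 1 * poly p (inverse h) * exp (- inverse h)) \<longlongrightarrow> 0) (at_right (0::real))"
        by (rule filterlim_compose[OF poly_times_exp_minus_tendsto_0 filterlim_inverse_at_top_right])
      then show "((\<lambda>h. (flat_fun p (0 + h) - flat_fun p 0) / h) \<longlongrightarrow> 0) (at_right 0)"
        by (rule Lim_transform_eventually)
          (auto simp: eventually_at_right_field flat_fun_def field_simps intro: exI[of _ 1])
    qed
    then show ?thesis using 3 by (simp add: DERIV_def flat_fun_def)
  qed
qed

lemma Ck_on_flat_fun: "Ck_on k UNIV (flat_fun p)"
proof (induction k arbitrary: p)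
  case 0
  show ?case
    by (auto intro!: DERIV_continuous_on flat_fun_deriv)
next
  case (Suc k)
  show ?case by (rule Ck_on_SucI_real[OF flat_fun_deriv Suc])
qed

lemma antiderivative_exists:
  fixes f :: "real \<Rightarrow> real"
  assumes "continuous_on UNIV f"
  obtains F where "\<And>x. (F has_real_derivative f x) (at x)"
proof -
  have "\<And>x. isCont f x" using assms by (auto simp: continuous_on_eq_continuous_at)
  then have "\<exists>F. \<forall>x. -\<infinity> < ereal x \<longrightarrow> ereal x < \<infinity> \<longrightarrow> (F has_vector_derivative f x) (at x)"
    by (intro einterval_antiderivative) auto
  then show ?thesis using that by (auto simp: has_real_derivative_iff_has_vector_derivative)
qed

lemma DERIV_zero_eq:
  fixes f :: "real \<Rightarrow> real"
  assumes "\<And>x. (f has_real_derivative f' x) (at x)" "\<And>x. a < x \<Longrightarrow> x < b \<Longrightarrow> f' x = 0" "a \<le> b"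
  shows "f a = f b"
proof (cases "a = b")
  case False
  then obtain z where "a < z" "z < b" "f b - f a = (b - a) * f' z"
    using MVT2[of a b f f'] assms by force
  then show ?thesis using assms by simp
qed simp

text \<open>\<open>b\<close> is a bump of mass one, \<open>B\<close> a smooth Heaviside function,
  \<open>P\<close> a smooth positive part. Rescaled, they approximate a point mass, the indicator of
  a half-line and a kink; P(n y)/n stays within 1/n of the kink, which is what the bound by 1 is
  for.\<close>

lemma smooth_step_exists:
  obtains b B P :: "real \<Rightarrow> real" where
    "smooth_on UNIV b" "smooth_on UNIV B" "smooth_on UNIV P"
    "\<And>x. (B has_real_derivative b x) (at x)" "\<And>x. (P has_real_derivative B x) (at x)"
    "\<And>x. b x \<ge> 0" "\<And>x. x \<notin> {0..1} \<Longrightarrow> b x = 0"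
    "\<And>x. x \<le> 0 \<Longrightarrow> B x = 0" "\<And>x. 1 \<le> x \<Longrightarrow> B x = 1" "\<And>x. B x \<in> {0..1}"
    "\<And>x. \<bar>P x - max 0 x\<bar> \<le> 1" "\<And>x. x \<le> 0 \<Longrightarrow> P x = 0" "\<And>x. 1 \<le> x \<Longrightarrow> P x = P 1 + (x - 1)"
proof -
  \<comment> \<open>The factor at 1 - x cuts off on the right; it is spelled
    \<open>-1 * x + 1\<close> to fit the rule for affine arguments.\<close>
  define b0 :: "real \<Rightarrow> real" where "b0 x = flat_fun 1 x * flat_fun 1 (-1 * x + 1)" for x
  have sb0: "smooth_on UNIV b0"
    unfolding smooth_on_def b0_def by (intro allI Ck_on_mult Ck_on_flat_fun Ck_on_affine)
  have b0_nn: "b0 x \<ge> 0" for x by (simp add: b0_def flat_fun_def)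
  have b0_out: "b0 x = 0" if "x \<notin> {0<..<1}" for x using that by (auto simp: b0_def flat_fun_def)
  have b0_pos: "b0 x > 0" if "x \<in> {0<..<1}" for x using that by (simp add: b0_def flat_fun_def)
  have "continuous_on UNIV b0" using sb0 by (metis smooth_on_def Ck_on.simps(1))
  then obtain F where F: "\<And>x. (F has_real_derivative b0 x) (at x)"
    by (rule antiderivative_exists) blast
  obtain z where z: "0 < z" "z < 1" "F 1 - F 0 = (1 - 0) * b0 z"
    using MVT2[of 0 1 F b0] F by auto
  define I where "I = F 1 - F 0"
  have I: "I > 0" using z b0_pos[of z] by (simp add: I_def)
  define b B where "b x = b0 x * (1 / I)" and "B x = (F x - F 0) / I" for x
  have dB: "(B has_real_derivative b x) (at x)" for x
    unfolding B_def b_def using I by (auto intro!: derivative_eq_intros F)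
  have sb: "smooth_on UNIV b"
    using sb0 unfolding b_def smooth_on_def by (intro allI Ck_on_mult Ck_on_const) blast
  have sB: "smooth_on UNIV B" by (rule smooth_on_antiderivative[OF dB sb])
  have b_nn: "b x \<ge> 0" for x using b0_nn I by (simp add: b_def)
  have b_out: "b x = 0" if "x \<notin> {0<..<1}" for x using b0_out[OF that] by (simp add: b_def)
  have B0: "B x = 0" if "x \<le> 0" for x
    using DERIV_zero_eq[OF dB _ that] b_out I by (force simp: B_def)
  have B1: "B x = 1" if "1 \<le> x" for x
    using DERIV_zero_eq[OF dB _ that] b_out I by (force simp: B_def I_def)
  have Bmono: "B x \<le> B y" if "x \<le> y" for x y
    using DERIV_nonneg_imp_nondecreasing[OF that] dB b_nn by blast
  have B01: "B x \<in> {0..1}" for x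
  proof -
    have "B (min x 0) \<le> B x" "B x \<le> B (max x 1)" by (auto intro: Bmono)
    then show ?thesis using B0[of "min x 0"] B1[of "max x 1"] by auto
  qed
  have "continuous_on UNIV B" using sB by (metis smooth_on_def Ck_on.simps(1))
  then obtain P0 where P0: "\<And>x. (P0 has_real_derivative B x) (at x)"
    by (rule antiderivative_exists) blast
  define P where "P x = P0 x - P0 0" for x
  have dP: "(P has_real_derivative B x) (at x)" for x
    unfolding P_def by (auto intro!: derivative_eq_intros P0)
  have sP: "smooth_on UNIV P" by (rule smooth_on_antiderivative[OF dP sB])
  have P_0: "P x = 0" if "x \<le> 0" for x
    using DERIV_zero_eq[OF dP _ that] B0 by (force simp: P_def)
  have P_1: "P x = P 1 + (x - 1)" if "1 \<le> x" for x
  proof -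
    have "((\<lambda>x. P x - x) has_real_derivative B x - 1) (at x)" for x
      by (auto intro!: derivative_eq_intros dP)
    from DERIV_zero_eq[OF this _ that] B1 show ?thesis by auto
  qed
  have P_abs: "\<bar>P x - max 0 x\<bar> \<le> 1" for x
  proof -
    have lip: "0 \<le> P y \<and> P y \<le> y" if y: "0 \<le> y" for y
    proof (cases "y = 0")
      case True
      then show ?thesis using P_0 by simp
    next
      case False
      then obtain z where "P y - P 0 = (y - 0) * B z"
        using MVT2[of 0 y P B] dP y by auto
      then show ?thesis using B01[of z] y P_0[of 0] by (auto intro: mult_left_le)
    qed
    consider "x \<le> 0" | "0 \<le> x" "x \<le> 1" | "1 \<le> x" by linarith
    then show ?thesis
      by cases (use P_0[of x] lip[of x] lip[of 1] P_1[of x] in auto)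
  qed
  show ?thesis
    by (rule that[OF sb sB sP dB dP b_nn _ B0 B1 B01 P_abs P_0 P_1]) (auto intro: b_out)
qed

text \<open>The limit exists at every point, and at the jump y = c it is 0. Differences of such
  limits are therefore indicators of intervals open on the left and closed on the right, the
  intervals used from here on.\<close>

lemma step_tendsto:
  fixes B :: "real \<Rightarrow> real"
  assumes B0: "\<And>x. x \<le> 0 \<Longrightarrow> B x = 0" and B1: "\<And>x. 1 \<le> x \<Longrightarrow> B x = 1"
  shows "(\<lambda>n. B (real (Suc n) * (y - c))) \<longlonglongrightarrow> (if c < y then 1 else 0)"
proof (cases "c < y")
  case True
  obtain m :: nat where m: "1 / (y - c) < real m" using reals_Archimedean2 by blast
  have "\<forall>n\<ge>m. B (real (Suc n) * (y - c)) = 1"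
  proof (intro allI impI B1)
    fix n assume "n \<ge> m"
    then have "1 / (y - c) \<le> real (Suc n)" using m by simp
    then show "1 \<le> real (Suc n) * (y - c)" using True by (simp add: field_simps)
  qed
  then have "\<forall>\<^sub>F n in sequentially. B (real (Suc n) * (y - c)) = 1"
    unfolding eventually_sequentially by blast
  then show ?thesis using True by (simp add: tendsto_eventually)
next
  case False
  then show ?thesis by (simp add: B0 mult_nonneg_nonpos)
qed

subsection \<open>Bounded weak derivatives and second differences of the primitive\<close>

lemma dir_deriv_real:
  fixes f :: "real \<Rightarrow> real"
  assumes "(f has_real_derivative D) (at x)"
  shows "dir_deriv 1 f x = D"
  unfolding dir_deriv_def frechet_derivative_at[OF assms[unfolded has_field_derivative_def], symmetric]
  by simp

lemma max_0_square_deriv: "((\<lambda>y::real. (max 0 y)\<^sup>2 / 2) has_real_derivative max 0 x) (at x)"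
proof -
  consider "x > 0" | "x < 0" | "x = 0" by linarith
  then show ?thesis
  proof cases
    case 1
    have "((\<lambda>y. y\<^sup>2 / 2) has_real_derivative max 0 x) (at x)"
      using 1 by (auto intro!: derivative_eq_intros)
    then show ?thesis
      by (rule has_field_derivative_transform_within_open[where S = "{0<..}"]) (use 1 in auto)
  next
    case 2
    have "((\<lambda>y. 0) has_real_derivative max 0 x) (at x)"
      using 2 by (auto intro!: derivative_eq_intros)
    then show ?thesis
      by (rule has_field_derivative_transform_within_open[where S = "{..<0}"]) (use 2 in auto)
  next
    case 3
    have "((\<lambda>h::real. (max 0 h)\<^sup>2 / 2 / h) \<longlongrightarrow> 0) (at 0)"
    proof (rule Lim_null_comparison)
      show "\<forall>\<^sub>F h::real in at 0. norm ((max 0 h)\<^sup>2 / 2 / h) \<le> \<bar>h\<bar>"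
        by (intro always_eventually) (auto simp: max_def power2_eq_square)
      show "((\<lambda>h::real. \<bar>h\<bar>) \<longlongrightarrow> 0) (at 0)"
        by (intro tendsto_eq_intros) auto
    qed
    then show ?thesis using 3 by (simp add: DERIV_def)
  qed
qed

text \<open>\<open>tr\<close> is the convolution of the indicators of two intervals of lengths
  \<open>h\<close> and \<open>r\<close>, so its integral is the product of the lengths. The proof
  evaluates a primitive built from half squares of positive parts.\<close>

lemma trapezoid_integral:
  fixes a h r :: real
  assumes h: "0 \<le> h" and r: "0 \<le> r"
  defines "tr \<equiv> \<lambda>y. max 0 (y - a) + max 0 (y - a - h - r) - max 0 (y - a - h) - max 0 (y - a - r)"
  shows "(LINT y|lborel. tr y * indicator {a..a + h + r + 1} y) = h * r"
proof -
  let ?Q = "\<lambda>y. (max 0 y)\<^sup>2 / 2 :: real"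
  let ?F = "\<lambda>y. ?Q (y - a) + ?Q (y - a - h - r) - ?Q (y - a - h) - ?Q (y - a - r)"
  have d: "((\<lambda>y. ?Q (y - c)) has_real_derivative max 0 (x - c)) (at x)" for c x
    using max_0_square_deriv[of "x + - c"] unfolding DERIV_shift by simp
  have "(?F has_real_derivative tr x) (at x)" for x
    unfolding tr_def
    using d[of "a + h + r" x] d[of "a + h" x] d[of "a + r" x] d[of a x]
    by (intro DERIV_diff DERIV_add) (auto simp: algebra_simps)
  then have "(LINT y|lborel. tr y * indicator {a..a + h + r + 1} y) = ?F (a + h + r + 1) - ?F a"
    using h r by (intro integral_FTC_Icc_real) (auto simp: tr_def simp del: max.absorb1 max.absorb2 intro!: continuous_intros)
  also have "\<dots> = ((h + r + 1)\<^sup>2 + 1\<^sup>2 - (r + 1)\<^sup>2 - (h + 1)\<^sup>2) / 2"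
  proof -
    have "max 0 (a + h + r + 1 - a) = h + r + 1" "max 0 (a + h + r + 1 - a - h - r) = 1"
      "max 0 (a + h + r + 1 - a - h) = r + 1" "max 0 (a + h + r + 1 - a - r) = h + 1"
      "max 0 (a - a) = 0" "max 0 (a - a - h - r) = 0" "max 0 (a - a - h) = 0" "max 0 (a - a - r) = 0"
      using h r by auto
    then show ?thesis by (simp only:) simp
  qed
  also have "\<dots> = h * r"
    by (simp add: power2_eq_square algebra_simps)
  finally show ?thesis .
qed

text \<open>The difference of the two interval indicators is the derivative of minus a trapezoid.
  Testing the weak derivative with a smoothed trapezoid moves the derivative onto \<open>g\<close>,
  and the trapezoid has integral h r. The result bounds the Lipschitz constant through integrals
  alone, without choosing a representative of \<open>f\<close>.\<close>

lemma weak_deriv_bounded_second_difference: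
  assumes f: "is_weak_deriv 1 UNIV f g" and g: "AE x in lebesgue. \<bar>g x\<bar> \<le> N"
    and h: "0 \<le> h" and r: "0 \<le> r"
  shows "\<bar>(LINT y:{a + h<..a + h + r}|lebesgue. f y) - (LINT y:{a<..a + r}|lebesgue. f y)\<bar> \<le> N * h * r"
proof -
  obtain b B P :: "real \<Rightarrow> real" where "smooth_on UNIV b" and
    smB: "smooth_on UNIV B" and smP: "smooth_on UNIV P" and
    "\<And>x. (B has_real_derivative b x) (at x)" and dP: "\<And>x. (P has_real_derivative B x) (at x)" and
    "\<And>x. b x \<ge> 0" "\<And>x. x \<notin> {0..1} \<Longrightarrow> b x = 0" and
    B0: "\<And>x. x \<le> 0 \<Longrightarrow> B x = 0" and B1: "\<And>x. 1 \<le> x \<Longrightarrow> B x = 1" and B01: "\<And>x. B x \<in> {0..1}" and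
    P: "\<And>x. \<bar>P x - max 0 x\<bar> \<le> 1" and P0: "\<And>x. x \<le> 0 \<Longrightarrow> P x = 0" and
    P1: "\<And>x. 1 \<le> x \<Longrightarrow> P x = P 1 + (x - 1)"
    by (rule smooth_step_exists) (rule that)
  \<comment> \<open>The extra length 1 is room for smoothing: for n >= 1 each rescaled step has
    reached its final form at distance 1 from its kink.\<close>
  define K where "K = {a..a + h + r + 1}"
  have N: "0 \<le> N"
  proof -
    have "ae_filter (lebesgue :: real measure) \<noteq> bot"
      by (simp add: ae_filter_eq_bot_iff)
    then obtain x where "\<bar>g x\<bar> \<le> N" using eventually_happens[OF g] by blast
    then show ?thesis by force
  qed
  define tr where "tr y = max 0 (y - a) + max 0 (y - a - h - r) - max 0 (y - a - h) - max 0 (y - a - r)" for y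
  have tr_nn: "0 \<le> tr y" for y using h r by (auto simp: tr_def max_def)
  \<comment> \<open>Minus the smoothed trapezoid, written with sums, products and affine arguments
    only, so that the closure rules for \<open>Ck_on\<close> apply literally.\<close>
  define \<phi> where "\<phi> n y = (P (n * y + - n * (a + h)) + (-1) * P (n * y + - n * (a + h + r)) + (-1) * P (n * y + - n * a) + P (n * y + - n * (a + r))) * (1 / n)" for n y :: real
  define \<psi> where "\<psi> n y = B (n * (y - (a + h))) - B (n * (y - (a + h + r))) - B (n * (y - a)) + B (n * (y - (a + r)))" for n y :: real
  have sm\<phi>: "smooth_on UNIV (\<phi> n)" for n
  proof -
    have "Ck_on k UNIV (\<lambda>y. P (n * y + d))" for k d
      using smP by (intro Ck_on_affine) (simp add: smooth_on_def)
    then show ?thesis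
      unfolding \<phi>_def smooth_on_def by (intro allI Ck_on_mult Ck_on_add Ck_on_const)
  qed
  have d\<phi>: "(\<phi> n has_real_derivative \<psi> n y) (at y)" if "n \<ge> 1" for n y
    unfolding \<phi>_def \<psi>_def using that
    by (auto intro!: derivative_eq_intros DERIV_chain2[OF dP] simp: field_simps)
  have args: "n * (y - c) \<ge> 1" if "n \<ge> 1" "y - c \<ge> 1" for n y c :: real
    using mult_mono[of 1 n 1 "y - c"] that by auto
  have args': "n * (y - c) \<le> 0" if "n \<ge> 1" "y - c \<le> 0" for n y c :: real
    using that by (simp add: mult_nonneg_nonpos)
  have \<phi>': "\<phi> n y = (P (n * (y - (a + h))) - P (n * (y - (a + h + r))) - P (n * (y - a)) + P (n * (y - (a + r)))) / n" for n y
  proof -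
    have e: "n * y + - n * c = n * (y - c)" for c by (simp add: algebra_simps)
    show ?thesis unfolding \<phi>_def e by simp
  qed
  have \<phi>_out: "\<phi> n y = 0" if "y \<notin> K" "n \<ge> 1" for n y
  proof (cases "y < a")
    case True
    then show ?thesis using that h r by (simp add: \<phi>' P0 args')
  next
    case False
    then have y: "y > a + h + r + 1" using that by (auto simp: K_def)
    have "P (n * (y - c)) = P 1 + (n * (y - c) - 1)" if "c \<le> a + h + r" for c
      by (rule P1, rule args) (use that y \<open>n \<ge> 1\<close> in auto)
    from this[of "a + h"] this[of "a + h + r"] this[of a] this[of "a + r"] h r
    have "P (n * (y - (a + h))) - P (n * (y - (a + h + r))) - P (n * (y - a)) + P (n * (y - (a + r))) =
      (n * (y - (a + h))) - (n * (y - (a + h + r))) - (n * (y - a)) + (n * (y - (a + r)))"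
      by linarith
    also have "\<dots> = 0" by (simp add: algebra_simps)
    finally show ?thesis by (simp add: \<phi>')
  qed
  have \<psi>_out: "\<psi> n y = 0" if "y \<notin> K" "n \<ge> 1" for n y
  proof (cases "y < a")
    case True
    then show ?thesis using that h r by (simp add: \<psi>_def B0 args')
  next
    case False
    then have y: "y > a + h + r + 1" using that by (auto simp: K_def)
    have "B (n * (y - c)) = 1" if "c \<le> a + h + r" for c
      by (rule B1, rule args) (use that y \<open>n \<ge> 1\<close> in auto)
    then show ?thesis using h r by (simp add: \<psi>_def)
  qed
  \<comment> \<open>Each of the four kinks is off by at most 1/n.\<close>
  have \<phi>_abs: "\<bar>\<phi> n y\<bar> \<le> tr y + 4 / n" if "n \<ge> 1" for n y
  proof -
    have e: "\<bar>P (n * (y - c)) / n - max 0 (y - c)\<bar> \<le> 1 / n" for c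
    proof -
      have "max 0 (n * (y - c)) = n * max 0 (y - c)"
        using that by (auto simp: max_def zero_le_mult_iff mult_le_0_iff)
      then have "P (n * (y - c)) / n - max 0 (y - c) = (P (n * (y - c)) - max 0 (n * (y - c))) / n"
        using that by (simp add: field_simps)
      then show ?thesis using P[of "n * (y - c)"] that by (simp add: divide_right_mono)
    qed
    define E M q where "E c = P (n * (y - c)) / n" and "M c = max 0 (y - c)" and "q = 1 / n" for c
    have "\<bar>E c - M c\<bar> \<le> q" for c using e by (simp add: E_def M_def q_def)
    from this[of "a + h"] this[of "a + h + r"] this[of a] this[of "a + r"]
    have "\<bar>E (a + h) - E (a + h + r) - E a + E (a + r)\<bar> \<le>
      \<bar>M a + M (a + h + r) - M (a + h) - M (a + r)\<bar> + 4 * q"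
      by linarith
    moreover have "\<phi> n y = E (a + h) - E (a + h + r) - E a + E (a + r)"
      by (simp add: \<phi>' E_def diff_divide_distrib add_divide_distrib)
    moreover have "tr y = M a + M (a + h + r) - M (a + h) - M (a + r)"
      by (simp add: tr_def M_def diff_diff_eq)
    ultimately show ?thesis using tr_nn[of y] by (simp add: q_def)
  qed
  have test: "test_smooth UNIV (\<phi> n)" if "n \<ge> 1" for n
    unfolding test_smooth_def compact_supp_in_def
    using sm\<phi> \<phi>_out that by (auto intro!: exI[of _ K] simp: K_def)
  have fK: "integrable lebesgue (\<lambda>y. indicator K y * f y)"
    using f unfolding is_weak_deriv_def loc_integrable_def set_integrable_def K_def by simp
  have bound: "\<bar>LINT y|lebesgue. f y * \<psi> n y\<bar> \<le> N * (h * r + 4 / n * (h + r + 1))" if n: "n \<ge> 1" for n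
  proof -
    have "(LINT y|lebesgue. f y * \<psi> n y) = - (LINT y|lebesgue. g y * \<phi> n y)"
    proof -
      have "(LINT y:UNIV|lebesgue. f y * dir_deriv 1 (\<phi> n) y) = - (LINT y:UNIV|lebesgue. g y * \<phi> n y)"
        using f test[OF n] unfolding is_weak_deriv_def by blast
      then show ?thesis
        unfolding dir_deriv_real[OF d\<phi>[OF n]] by (simp add: set_lebesgue_integral_def)
    qed
    have trK: "integrable lborel (\<lambda>y. tr y * indicator K y)"
      unfolding tr_def K_def by (intro borel_integrable_atLeastAtMost) (auto intro!: continuous_intros)
    have iK: "integrable lborel (\<lambda>y. 4 / n * indicator K y)"
      unfolding K_def by (intro integrable_mult_right integrable_real_indicator) (auto simp: emeasure_lborel_Icc_eq)
    from \<open>(LINT y|lebesgue. f y * \<psi> n y) = _\<close>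
    have "\<bar>LINT y|lebesgue. f y * \<psi> n y\<bar> = \<bar>LINT y|lebesgue. g y * \<phi> n y\<bar>" by simp
    also have "\<dots> \<le> (LINT y|lebesgue. \<bar>g y * \<phi> n y\<bar>)"
      using integral_norm_bound[of lebesgue "\<lambda>y. g y * \<phi> n y"] by simp
    also have "\<dots> \<le> (LINT y|lebesgue. N * (tr y * indicator K y + 4 / n * indicator K y))"
    proof (rule integral_mono_AE')
      have "integrable lborel (\<lambda>y. N * (tr y * indicator K y + 4 / n * indicator K y))"
        by (intro integrable_mult_right Bochner_Integration.integrable_add trK iK)
      then show "integrable lebesgue (\<lambda>y. N * (tr y * indicator K y + 4 / n * indicator K y))"
        by (subst integrable_completion) (auto dest: borel_measurable_integrable)
      show "AE x in lebesgue. \<bar>g x * \<phi> n x\<bar> \<le> N * (tr x * indicator K x + 4 / n * indicator K x)"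
        using g
      proof eventually_elim
        case (elim x)
        then show ?case
          using \<phi>_out[of x n] \<phi>_abs[OF n, of x] n N
          by (cases "x \<in> K") (simp_all add: abs_mult mult_mono)
      qed
      show "AE x in lebesgue. 0 \<le> N * (tr x * indicator K x + 4 / n * indicator K x)"
        using N tr_nn n by (auto intro!: mult_nonneg_nonneg add_nonneg_nonneg)
    qed
    also have "\<dots> = (LINT y|lborel. N * (tr y * indicator K y + 4 / n * indicator K y))"
      by (rule integral_completion) (simp add: tr_def K_def)
    also have "\<dots> = N * ((LINT y|lborel. tr y * indicator K y) + (LINT y|lborel. 4 / n * indicator K y))"
      by (simp only: integral_mult_right_zero Bochner_Integration.integral_add[OF trK iK])
    also have "\<dots> = N * (h * r + 4 / n * (h + r + 1))"
      using trapezoid_integral[OF h r, of a] h r by (simp add: tr_def K_def)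
    finally show ?thesis .
  qed
  define s where "s y = indicator {a + h<..a + h + r} y - (indicator {a<..a + r} y :: real)" for y
  \<comment> \<open>\<open>\<psi>\<close> combines four values of \<open>B\<close> in [0, 1] and
    vanishes outside \<open>K\<close>, hence the dominating function with factor 4.\<close>
  have lim: "(\<lambda>n. LINT y|lebesgue. f y * \<psi> (real (Suc n)) y) \<longlonglongrightarrow> (LINT y|lebesgue. f y * s y)"
  proof (rule integral_dominated_convergence[where w = "\<lambda>y. 4 * \<bar>indicator K y * f y\<bar>"])
    have \<psi>eq: "f y * \<psi> (real (Suc n)) y = (indicator K y * f y) * \<psi> (real (Suc n)) y" for y n
      using \<psi>_out[of y "real (Suc n)"] by (cases "y \<in> K") auto
    have seq: "f y * s y = (indicator K y * f y) * s y" for y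
      using h r by (cases "y \<in> K") (auto simp: s_def K_def split: split_indicator)
    have cB: "continuous_on UNIV B"
      using smB[unfolded smooth_on_def, rule_format, of 0] by simp
    have "continuous_on UNIV (\<psi> (real (Suc n)))" for n
      unfolding \<psi>_def by (intro continuous_intros continuous_on_compose2[OF cB]) auto
    then have m\<psi>: "\<psi> (real (Suc n)) \<in> borel_measurable lebesgue" for n
      by (intro measurable_completion) (simp add: borel_measurable_continuous_onI)
    show "(\<lambda>y. f y * \<psi> (real (Suc n)) y) \<in> borel_measurable lebesgue" for n
      unfolding \<psi>eq by (intro borel_measurable_times borel_measurable_integrable[OF fK] m\<psi>)
    have "s \<in> borel_measurable lebesgue"
      unfolding s_def by (intro measurable_completion) simp
    then show "(\<lambda>y. f y * s y) \<in> borel_measurable lebesgue"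
      unfolding seq by (intro borel_measurable_times borel_measurable_integrable[OF fK])
    show "integrable lebesgue (\<lambda>y. 4 * \<bar>indicator K y * f y\<bar>)"
      by (intro integrable_mult_right integrable_abs fK)
    show "AE y in lebesgue. norm (f y * \<psi> (real (Suc n)) y) \<le> 4 * \<bar>indicator K y * f y\<bar>" for n
    proof (rule AE_I2)
      fix y
      have "\<bar>\<psi> (real (Suc n)) y\<bar> \<le> 4"
        unfolding \<psi>_def
        using B01[of "real (Suc n) * (y - (a + h))"] B01[of "real (Suc n) * (y - (a + h + r))"]
          B01[of "real (Suc n) * (y - a)"] B01[of "real (Suc n) * (y - (a + r))"] by auto
      then show "norm (f y * \<psi> (real (Suc n)) y) \<le> 4 * \<bar>indicator K y * f y\<bar>"
        unfolding \<psi>eq real_norm_def abs_mult[of _ "\<psi> (real (Suc n)) y"]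
        using mult_left_mono[of "\<bar>\<psi> (real (Suc n)) y\<bar>" 4 "\<bar>indicator K y * f y\<bar>"] by (simp add: mult.commute)
    qed
    have limB: "(\<lambda>n. B (real (Suc n) * (y - c))) \<longlonglongrightarrow> (if c < y then 1 else 0)" for y c
      by (rule step_tendsto[OF B0 B1])
    show "AE y in lebesgue. (\<lambda>n. f y * \<psi> (real (Suc n)) y) \<longlonglongrightarrow> f y * s y"
    proof (rule AE_I2)
      fix y
      have "s y = (if a + h < y then 1 else 0) - (if a + h + r < y then 1 else 0) - (if a < y then 1 else 0) + (if a + r < y then 1 else 0)"
        using h r by (auto simp: s_def split: split_indicator)
      then show "(\<lambda>n. f y * \<psi> (real (Suc n)) y) \<longlonglongrightarrow> f y * s y"
        unfolding \<psi>_def by (simp only:) (intro tendsto_intros limB)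
    qed
  qed
  have "\<bar>LINT y|lebesgue. f y * s y\<bar> \<le> N * (h * r + 0 * (h + r + 1))"
  proof (rule tendsto_le[OF sequentially_bot _ tendsto_rabs[OF lim]])
    have "(\<lambda>n. 4 * inverse (real (Suc n))) \<longlonglongrightarrow> 4 * 0"
      by (intro tendsto_intros LIMSEQ_inverse_real_of_nat)
    then have "(\<lambda>n. 4 / real (Suc n)) \<longlonglongrightarrow> 0" by (simp add: field_simps)
    then show "(\<lambda>n. N * (h * r + 4 / real (Suc n) * (h + r + 1))) \<longlonglongrightarrow> N * (h * r + 0 * (h + r + 1))"
      by (intro tendsto_intros)
  qed (use bound in auto)
  moreover have "(LINT y|lebesgue. f y * s y) =
      (LINT y:{a + h<..a + h + r}|lebesgue. f y) - (LINT y:{a<..a + r}|lebesgue. f y)"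
  proof -
    have i: "integrable lebesgue (\<lambda>y. indicator A y *\<^sub>R f y)" if "A \<in> sets borel" "A \<subseteq> K" for A
    proof -
      have "(\<lambda>y. indicator A y *\<^sub>R f y) = (\<lambda>y. indicator A y *\<^sub>R (indicator K y * f y))"
        using that by (intro ext) (auto split: split_indicator)
      then show ?thesis using integrable_mult_indicator[OF _ fK, of A] that by simp
    qed
    have "(LINT y|lebesgue. f y * s y) =
      (LINT y|lebesgue. indicator {a + h<..a + h + r} y *\<^sub>R f y - indicator {a<..a + r} y *\<^sub>R f y)"
      by (simp add: s_def algebra_simps)
    also have "\<dots> = (LINT y:{a + h<..a + h + r}|lebesgue. f y) - (LINT y:{a<..a + r}|lebesgue. f y)"
      unfolding set_lebesgue_integral_def
      by (intro Bochner_Integration.integral_diff i) (use h r in \<open>auto simp: K_def\<close>)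
    finally show ?thesis .
  qed
  ultimately show ?thesis by (simp add: mult.assoc)
qed

section \<open>Integrals over half-open intervals as functions of their endpoints\<close>

lemma integrable_imp_set_integrable:
  fixes f :: "real \<Rightarrow> real"
  shows "integrable lborel f \<Longrightarrow> A \<in> sets borel \<Longrightarrow> set_integrable lborel A f"
  unfolding set_integrable_def by (rule integrable_mult_indicator) simp

lemma set_integral_Ioc_near_const:
  fixes f :: "real \<Rightarrow> real"
  assumes f: "set_integrable lborel {x<..y} f" and xy: "x \<le> y"
    and near: "\<And>z. x < z \<Longrightarrow> z \<le> y \<Longrightarrow> \<bar>f z - c\<bar> \<le> e"
  shows "\<bar>(LINT z:{x<..y}|lborel. f z) - c * (y - x)\<bar> \<le> e * (y - x)"
proof -
  have c: "set_integrable lborel {x<..y} (\<lambda>z. c)" "(LINT z:{x<..y}|lborel. c) = c * (y - x)" for c :: real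
    using xy by (simp_all add: set_integrable_def set_lebesgue_integral_def)
  have "(LINT z:{x<..y}|lborel. f z) - c * (y - x) = (LINT z:{x<..y}|lborel. f z - c)"
    by (simp add: set_integral_diff(2)[OF f c(1)] c(2))
  also have "\<bar>\<dots>\<bar> \<le> (LINT z:{x<..y}|lborel. \<bar>f z - c\<bar>)"
    using set_integral_norm_bound[OF set_integral_diff(1)[OF f c(1)]] by simp
  also have "\<dots> \<le> (LINT z:{x<..y}|lborel. e)"
    by (rule set_integral_mono) (auto intro!: set_integrable_abs set_integral_diff(1)[OF f c(1)] c near)
  finally show ?thesis by (simp add: c)
qed

lemma set_integral_Ioc_split:
  fixes f :: "real \<Rightarrow> real"
  assumes f: "set_integrable lborel {x<..z} f" and xy: "x \<le> y" "y \<le> z"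
  shows "(LINT s:{x<..z}|lborel. f s) = (LINT s:{x<..y}|lborel. f s) + (LINT s:{y<..z}|lborel. f s)"
proof -
  have eq: "{x<..z} = {x<..y} \<union> {y<..z}" using xy by auto
  have "set_integrable lborel {x<..y} f" "set_integrable lborel {y<..z} f"
    using xy by (auto intro: set_integrable_subset[OF f])
  then show ?thesis
    unfolding eq by (intro set_integral_Un) auto
qed

lemma tendsto_integral_Ioc:
  fixes f :: "real \<Rightarrow> real"
  assumes f: "\<And>a b. set_integrable lborel {a<..b} f"
    and a: "a \<longlonglongrightarrow> a0" and b: "b \<longlonglongrightarrow> b0"
  shows "(\<lambda>n. LINT y:{a n<..b n}|lborel. f y) \<longlonglongrightarrow> (LINT y:{a0<..b0}|lborel. f y)"
proof -
  have fm: "f \<in> borel_measurable borel"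
  proof -
    have "(\<lambda>n::nat. indicator {- real n<..real n} y *\<^sub>R f y) \<longlonglongrightarrow> f y" for y
    proof (rule tendsto_eventually)
      obtain m :: nat where m: "\<bar>y\<bar> < real m" using reals_Archimedean2 by blast
      have "\<forall>n\<ge>m. indicator {- real n<..real n} y *\<^sub>R f y = f y"
        using m by (auto simp: indicator_def)
      then show "\<forall>\<^sub>F n::nat in sequentially. indicator {- real n<..real n} y *\<^sub>R f y = f y"
        unfolding eventually_sequentially by blast
    qed
    moreover have "(\<lambda>y. indicator {- real n<..real n} y *\<^sub>R f y) \<in> borel_measurable lborel" for n
      using f[unfolded set_integrable_def] by (rule borel_measurable_integrable)
    ultimately have "f \<in> borel_measurable lborel"
      by (rule borel_measurable_LIMSEQ_real)
    then show ?thesis by simp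
  qed
  have "bounded (range a)" "bounded (range b)"
    using a b convergent_imp_bounded by auto
  then obtain A B where "\<And>n. \<bar>a n\<bar> \<le> A" "\<And>n. \<bar>b n\<bar> \<le> B"
    by (auto simp: bounded_iff)
  then have sub: "{a n<..b n} \<subseteq> {-A-1<..B}" for n
  proof -
    have "- A \<le> a n" "b n \<le> B"
      using \<open>\<And>n. \<bar>a n\<bar> \<le> A\<close>[of n] \<open>\<And>n. \<bar>b n\<bar> \<le> B\<close>[of n] by auto
    then show ?thesis by auto
  qed
  show ?thesis
    unfolding set_lebesgue_integral_def
  proof (rule integral_dominated_convergence[where w = "\<lambda>y. \<bar>indicator {-A-1<..B} y *\<^sub>R f y\<bar>"])
    show "integrable lborel (\<lambda>y. \<bar>indicator {-A-1<..B} y *\<^sub>R f y\<bar>)"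
      using f[unfolded set_integrable_def] by (rule integrable_abs)
    show "AE y in lborel. norm (indicator {a n<..b n} y *\<^sub>R f y) \<le> \<bar>indicator {-A-1<..B} y *\<^sub>R f y\<bar>" for n
      using sub[of n] by (intro AE_I2) (auto simp: indicator_def)
    \<comment> \<open>At a limit endpoint itself the comparison of \<open>y\<close> with the moving
      endpoint need not stabilize.\<close>
    have "AE y in lborel. y \<noteq> a0 \<and> y \<noteq> b0"
      using AE_lborel_singleton[of a0] AE_lborel_singleton[of b0] by eventually_elim simp
    then show "AE y in lborel. (\<lambda>n. indicator {a n<..b n} y *\<^sub>R f y) \<longlonglongrightarrow> indicator {a0<..b0} y *\<^sub>R f y"
    proof eventually_elim
      case (elim y)
      have "\<forall>\<^sub>F n in sequentially. (a n < y) = (a0 < y)"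
      proof (cases "a0 < y")
        case True
        then show ?thesis using order_tendstoD(2)[OF a] by auto
      next
        case False
        then have "y < a0" using elim by auto
        then show ?thesis using order_tendstoD(1)[OF a, of y] by (auto elim: eventually_mono)
      qed
      moreover have "\<forall>\<^sub>F n in sequentially. (y \<le> b n) = (y \<le> b0)"
      proof (cases "y < b0")
        case True
        then show ?thesis using order_tendstoD(1)[OF b, of y] by (auto elim: eventually_mono)
      next
        case False
        then have "b0 < y" using elim by auto
        then show ?thesis using order_tendstoD(2)[OF b, of y] by (auto elim: eventually_mono)
      qed
      ultimately have "\<forall>\<^sub>F n in sequentially. indicator {a n<..b n} y *\<^sub>R f y = indicator {a0<..b0} y *\<^sub>R f y"
        by eventually_elim (auto simp: indicator_def)
      then show ?case by (rule tendsto_eventually)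
    qed
  qed (use fm in auto)
qed

lemma continuous_on_integral_Ioc:
  fixes f :: "real \<Rightarrow> real"
  assumes "integrable lborel f"
  shows "continuous_on UNIV (\<lambda>t. LINT s:{a<..t}|lborel. f s)"
proof (intro continuous_at_imp_continuous_on ballI)
  fix t :: real
  show "isCont (\<lambda>t. LINT s:{a<..t}|lborel. f s) t"
    unfolding continuous_at_sequentially comp_def
    by (intro allI impI tendsto_integral_Ioc integrable_imp_set_integrable assms tendsto_const) auto
qed

text \<open>After truncation to a bounded interval, the positive and the negative part are densities
  of two measures that agree on all half-lines, hence everywhere. So the two parts agree almost
  everywhere, and having disjoint supports they vanish.\<close>

lemma AE_eq_0_if_integral_Ioc_eq_0:
  fixes f :: "real \<Rightarrow> real"
  assumes f: "\<And>a b. set_integrable lborel {a<..b} f"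
    and z: "\<And>a b. (LINT y:{a<..b}|lborel. f y) = 0"
  shows "AE y in lborel. f y = 0"
proof -
  have "AE y in lborel. y \<in> {- real N<..real N} \<longrightarrow> f y = 0" for N
  proof -
    define w where "w y = indicator {- real N<..real N} y *\<^sub>R f y" for y
    have w: "integrable lborel w" using f unfolding w_def set_integrable_def by simp
    then have [measurable]: "w \<in> borel_measurable borel" by (auto dest: borel_measurable_integrable)
    have eq: "(\<integral>\<^sup>+y. ennreal (w y) * indicator {x<..} y \<partial>lborel) = (\<integral>\<^sup>+y. ennreal (- w y) * indicator {x<..} y \<partial>lborel)"
      "(\<integral>\<^sup>+y. ennreal (w y) * indicator {x<..} y \<partial>lborel) < \<infinity>" for x
    proof -
      have e1: "indicator {x<..} y *\<^sub>R w y = indicator {max x (- real N)<..real N} y *\<^sub>R f y" for y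
        by (auto simp: w_def indicator_def)
      have iw: "integrable lborel (\<lambda>y. indicator {x<..} y *\<^sub>R w y)"
        using f unfolding e1 set_integrable_def by simp
      have 0: "(LINT y|lborel. indicator {x<..} y *\<^sub>R w y) = 0"
        using z unfolding e1 set_lebesgue_integral_def by simp
      have e2: "ennreal (indicator {x<..} y *\<^sub>R w y) = ennreal (w y) * indicator {x<..} y"
        "ennreal (- (indicator {x<..} y *\<^sub>R w y)) = ennreal (- w y) * indicator {x<..} y" for y
        by (auto simp: indicator_def)
      have fin: "(\<integral>\<^sup>+y. ennreal (w y) * indicator {x<..} y \<partial>lborel) \<noteq> \<infinity>"
        "(\<integral>\<^sup>+y. ennreal (- w y) * indicator {x<..} y \<partial>lborel) \<noteq> \<infinity>"
        using iw unfolding real_integrable_def e2 by auto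
      show "(\<integral>\<^sup>+y. ennreal (w y) * indicator {x<..} y \<partial>lborel) = (\<integral>\<^sup>+y. ennreal (- w y) * indicator {x<..} y \<partial>lborel)"
        using 0 fin unfolding real_lebesgue_integral_def[OF iw] e2
        by (cases rule: ennreal2_cases[of "\<integral>\<^sup>+y. ennreal (w y) * indicator {x<..} y \<partial>lborel"
            "\<integral>\<^sup>+y. ennreal (- w y) * indicator {x<..} y \<partial>lborel"]) simp_all
      show "(\<integral>\<^sup>+y. ennreal (w y) * indicator {x<..} y \<partial>lborel) < \<infinity>"
        using fin by (simp add: less_top)
    qed
    have "density lborel (\<lambda>y. ennreal (w y)) = density lborel (\<lambda>y. ennreal (- w y))"
      by (rule measure_eqI_lessThan) (use eq in \<open>simp_all add: emeasure_density\<close>)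
    then have "AE y in lborel. ennreal (w y) = ennreal (- w y)"
      using w by (subst (asm) finite_density_unique) (auto simp: real_integrable_def)
    then show ?thesis
    proof eventually_elim
      \<comment> \<open>\<open>ennreal\<close> sends negative reals to 0, so the two sides are the
        positive and the negative part of \<open>w y\<close>.\<close>
      case (elim y)
      then have "w y = 0"
        by (cases "0 \<le> w y") (auto simp: ennreal_neg)
      then show ?case by (auto simp: w_def)
    qed
  qed
  then have "AE y in lborel. \<forall>N. y \<in> {- real N<..real N} \<longrightarrow> f y = 0"
    by (subst AE_all_countable) blast
  then show ?thesis
  proof eventually_elim
    case (elim y)
    obtain N :: nat where "\<bar>y\<bar> < real N" using reals_Archimedean2 by blast
    then have "y \<in> {- real N<..real N}" by auto
    then show ?case using elim by blast
  qed
qed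

section \<open>The Lipschitz representative of a function with bounded second differences\<close>

lemma rational_sequence: "\<exists>q. (\<forall>n. q n \<in> \<rat>) \<and> q \<longlonglongrightarrow> x" for x :: real
  using Rats_closure_real closure_sequential[of x "\<rat>"] by (metis UNIV_I)

lemma positive_rational_sequence:
  assumes "0 < x" shows "\<exists>q. (\<forall>n. q n \<in> \<rat> \<and> 0 < q n) \<and> q \<longlonglongrightarrow> (x::real)"
proof -
  obtain q where q: "\<forall>n. q n \<in> \<rat>" "q \<longlonglongrightarrow> x" using rational_sequence[of x] by blast
  have "\<forall>\<^sub>F n in sequentially. 0 < q n"
    using order_tendstoD(1)[OF q(2) assms] .
  then obtain m where m: "\<forall>n\<ge>m. 0 < q n"
    unfolding eventually_sequentially by blast
  have "(\<lambda>n. q (n + m)) \<longlonglongrightarrow> x" by (rule LIMSEQ_ignore_initial_segment[OF q(2)])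
  moreover have "\<forall>n. q (n + m) \<in> \<rat> \<and> 0 < q (n + m)" using q(1) m by simp
  ultimately show ?thesis by (intro exI[of _ "\<lambda>n. q (n + m)"] conjI)
qed

text \<open>\<open>D n x\<close> averages \<open>f\<close> over an interval of length 1/(n + 1) to
  the right of \<open>x\<close>. The hypothesis says that neighbouring averages differ by at most
  \<open>L\<close> times their distance; hence the averages are Lipschitz in \<open>x\<close> and
  Cauchy in \<open>n\<close>. Only rational parameters are assumed, to match a countable supremum,
  and the explicit rate later bounds a point value by an average.\<close>

lemma second_difference_imp_lipschitz:
  fixes f :: "real \<Rightarrow> real" and L :: real
  defines "A \<equiv> \<lambda>a r. LINT y:{a<..a + r}|lborel. f y"
  defines "D \<equiv> \<lambda>n x. real (Suc n) * A x (1 / real (Suc n))"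
  assumes f: "\<And>a b. set_integrable lborel {a<..b} f"
    and sd: "\<And>a h r. a \<in> \<rat> \<Longrightarrow> h \<in> \<rat> \<Longrightarrow> r \<in> \<rat> \<Longrightarrow> 0 < h \<Longrightarrow> 0 < r \<Longrightarrow> \<bar>A (a + h) r - A a r\<bar> \<le> L * h * r"
  shows "convergent (\<lambda>n. D n x)"
    and "\<bar>lim (\<lambda>n. D n x) - D n x\<bar> \<le> L / real (Suc n)"
    and "\<bar>lim (\<lambda>n. D n x) - lim (\<lambda>n. D n y)\<bar> \<le> L * \<bar>x - y\<bar>"
    and "AE x in lborel. f x = lim (\<lambda>n. D n x)"
proof -
  have sdR: "\<bar>A (a + h) r - A a r\<bar> \<le> L * h * r" if hr: "0 < h" "0 < r" for a h r
  proof -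
    obtain qa where qa: "\<And>n. qa n \<in> \<rat>" "qa \<longlonglongrightarrow> a" using rational_sequence[of a] by blast
    obtain qh where qh: "\<And>n. qh n \<in> \<rat>" "\<And>n. 0 < qh n" "qh \<longlonglongrightarrow> h" using positive_rational_sequence[OF hr(1)] by blast
    obtain qr where qr: "\<And>n. qr n \<in> \<rat>" "\<And>n. 0 < qr n" "qr \<longlonglongrightarrow> r" using positive_rational_sequence[OF hr(2)] by blast
    have "(\<lambda>n. \<bar>A (qa n + qh n) (qr n) - A (qa n) (qr n)\<bar>) \<longlonglongrightarrow> \<bar>A (a + h) r - A a r\<bar>"
      unfolding A_def by (intro tendsto_intros tendsto_integral_Ioc f qa qh qr)
    moreover have "(\<lambda>n. L * qh n * qr n) \<longlonglongrightarrow> L * h * r"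
      by (intro tendsto_intros qh qr)
    ultimately show ?thesis
      by (rule LIMSEQ_le) (intro exI allI impI sd qa qh qr)
  qed
  have L: "0 \<le> L" using order_trans[OF abs_ge_zero sdR[of 1 1 0]] by simp
  have A_add: "A x (r + s) = A x r + A (x + r) s" if "0 \<le> r" "0 \<le> s" for x r s
    unfolding A_def using set_integral_Ioc_split[OF f, of x "x + r" "x + (r + s)"] that by (simp add: add.assoc)
  have A0: "A x 0 = 0" for x by (simp add: A_def set_lebesgue_integral_def)
  \<comment> \<open>Cut the interval into \<open>m\<close> pieces of length \<open>s\<close>; the
    piece starting at distance j s differs from the first one by at most L j s^2.\<close>
  have mult: "\<bar>A x (real m * s) - real m * A x s\<bar> \<le> L * (real m * s)\<^sup>2" if "0 < s" for m x s
  proof (induction m)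
    case 0
    then show ?case by (simp add: A0)
  next
    case (Suc m)
    have "A x (real (Suc m) * s) = A x (real m * s) + A (x + real m * s) s"
      using A_add[of "real m * s" s x] that by (simp add: algebra_simps)
    moreover have "\<bar>A (x + real m * s) s - A x s\<bar> \<le> L * (real m * s) * s"
      using sdR[of "real m * s" s x] that by (cases "m = 0") auto
    ultimately have "\<bar>A x (real (Suc m) * s) - real (Suc m) * A x s\<bar> \<le> L * (real m * s)\<^sup>2 + L * (real m * s) * s"
      using Suc by (simp add: algebra_simps)
    also have "\<dots> \<le> L * (real (Suc m) * s)\<^sup>2"
      using L that by (simp add: power2_eq_square algebra_simps)
    finally show ?case .
  qed
  have DD: "\<bar>D n x - D m x\<bar> \<le> L / real (Suc n) + L / real (Suc m)" for n m x
  proof -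
    \<comment> \<open>The two averages are compared through the common refinement of their interval
      lengths.\<close>
    define \<delta> where "\<delta> = 1 / (real (Suc n) * real (Suc m))"
    have aux: "\<bar>D k x - real (Suc k) * real (Suc l) * A x \<delta>\<bar> \<le> L / real (Suc k)"
      if "\<delta> = 1 / (real (Suc k) * real (Suc l))" for k l
    proof -
      have "real (Suc l) * \<delta> = 1 / real (Suc k)" using that by (simp add: field_simps del: of_nat_Suc)
      then have "\<bar>A x (1 / real (Suc k)) - real (Suc l) * A x \<delta>\<bar> \<le> L * (1 / real (Suc k))\<^sup>2"
        using mult[of \<delta> x "Suc l"] by (simp add: \<delta>_def)
      then have "real (Suc k) * \<bar>A x (1 / real (Suc k)) - real (Suc l) * A x \<delta>\<bar> \<le> real (Suc k) * (L * (1 / real (Suc k))\<^sup>2)"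
        by (intro mult_left_mono) auto
      also have "real (Suc k) * (L * (1 / real (Suc k))\<^sup>2) = L / real (Suc k)"
        by (simp add: power2_eq_square field_simps del: of_nat_Suc)
      also have "real (Suc k) * \<bar>A x (1 / real (Suc k)) - real (Suc l) * A x \<delta>\<bar> =
          \<bar>real (Suc k) * (A x (1 / real (Suc k)) - real (Suc l) * A x \<delta>)\<bar>"
        by (simp only: abs_mult abs_of_nat)
      also have "\<dots> = \<bar>D k x - real (Suc k) * real (Suc l) * A x \<delta>\<bar>"
        by (simp only: D_def right_diff_distrib mult.assoc)
      finally show ?thesis .
    qed
    have "\<bar>D n x - real (Suc n) * real (Suc m) * A x \<delta>\<bar> \<le> L / real (Suc n)"
      by (rule aux) (simp add: \<delta>_def)
    moreover have "\<bar>D m x - real (Suc m) * real (Suc n) * A x \<delta>\<bar> \<le> L / real (Suc m)"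
      by (rule aux) (simp add: \<delta>_def mult.commute)
    moreover have "real (Suc m) * real (Suc n) * A x \<delta> = real (Suc n) * real (Suc m) * A x \<delta>"
      by (simp only: mult.commute)
    ultimately show ?thesis by linarith
  qed
  have null: "(\<lambda>n. L / real (Suc n)) \<longlonglongrightarrow> 0"
    using tendsto_mult[OF tendsto_const LIMSEQ_inverse_real_of_nat, of L] by (simp add: divide_inverse)
  show conv: "convergent (\<lambda>n. D n x)" for x
  proof -
    have "Cauchy (\<lambda>n. D n x)"
    proof (rule metric_CauchyI)
      fix e :: real assume "0 < e"
      then obtain M where M: "\<And>n. n \<ge> M \<Longrightarrow> L / real (Suc n) < e / 2"
        using order_tendstoD(2)[OF null, of "e / 2"] by (auto simp: eventually_sequentially)
      show "\<exists>M. \<forall>m\<ge>M. \<forall>n\<ge>M. dist (D m x) (D n x) < e"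
      proof (intro exI allI impI)
        fix m n assume "M \<le> m" "M \<le> n"
        then show "dist (D m x) (D n x) < e"
          using M[of m] M[of n] DD[of m x n] unfolding dist_real_def by linarith
      qed
    qed
    then show ?thesis by (simp add: Cauchy_convergent_iff)
  qed
  define v where "v x = lim (\<lambda>n. D n x)" for x
  have Dv: "(\<lambda>n. D n x) \<longlonglongrightarrow> v x" for x
    using conv unfolding v_def by (simp add: convergent_LIMSEQ_iff)
  have vD: "\<bar>v x - D n x\<bar> \<le> L / real (Suc n)" for n x
  proof -
    have l1: "(\<lambda>m. \<bar>D m x - D n x\<bar>) \<longlonglongrightarrow> \<bar>v x - D n x\<bar>"
      by (intro tendsto_intros Dv)
    have l2: "(\<lambda>m. L / real (Suc m) + L / real (Suc n)) \<longlonglongrightarrow> 0 + L / real (Suc n)"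
      by (intro tendsto_intros null)
    have "\<bar>v x - D n x\<bar> \<le> 0 + L / real (Suc n)"
      by (rule LIMSEQ_le[OF l1 l2]) (intro exI[of _ 0] allI impI DD)
    then show ?thesis by simp
  qed
  then show "\<bar>lim (\<lambda>n. D n x) - D n x\<bar> \<le> L / real (Suc n)" unfolding v_def .
  have D_lip: "\<bar>D n x - D n y\<bar> \<le> L * \<bar>x - y\<bar>" if "x \<le> y" for n x y
  proof (cases "x = y")
    case False
    then have "\<bar>A (x + (y - x)) (1 / real (Suc n)) - A x (1 / real (Suc n))\<bar> \<le> L * (y - x) * (1 / real (Suc n))"
      using that by (intro sdR) auto
    then have "real (Suc n) * \<bar>A y (1 / real (Suc n)) - A x (1 / real (Suc n))\<bar> \<le> real (Suc n) * (L * (y - x) * (1 / real (Suc n)))"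
      by (intro mult_left_mono) auto
    also have "\<dots> = L * \<bar>x - y\<bar>" using that by simp
    also have "real (Suc n) * \<bar>A y (1 / real (Suc n)) - A x (1 / real (Suc n))\<bar> = \<bar>D n y - D n x\<bar>"
      by (simp only: D_def right_diff_distrib[symmetric] abs_mult abs_of_nat)
    also have "\<dots> = \<bar>D n x - D n y\<bar>" by (rule abs_minus_commute)
    finally show ?thesis .
  qed simp
  have v_lip: "\<bar>v x - v y\<bar> \<le> L * \<bar>x - y\<bar>" for x y
  proof -
    have "\<bar>D n x - D n y\<bar> \<le> L * \<bar>x - y\<bar>" for n
      using D_lip[of x y n] D_lip[of y x n] by (cases "x \<le> y") (auto simp: abs_minus_commute)
    moreover have "(\<lambda>n. \<bar>D n x - D n y\<bar>) \<longlonglongrightarrow> \<bar>v x - v y\<bar>"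
      by (intro tendsto_intros Dv)
    ultimately show ?thesis by (meson LIMSEQ_le_const2)
  qed
  then show "\<bar>lim (\<lambda>n. D n x) - lim (\<lambda>n. D n y)\<bar> \<le> L * \<bar>x - y\<bar>" unfolding v_def .
  have v_cont: "continuous_on S v" for S
  proof -
    have "L-lipschitz_on UNIV v"
      using v_lip L by (auto simp: lipschitz_on_def dist_real_def)
    then show ?thesis using lipschitz_on_continuous_on continuous_on_subset by blast
  qed
  have v_int: "set_integrable lborel {a<..b} v" for a b
    using borel_integrable_atLeastAtMost'[OF v_cont, of a b] by (rule set_integrable_subset) auto
  have fv_int: "set_integrable lborel {a<..b} (\<lambda>y. f y - v y)" for a b
    by (intro set_integral_diff f v_int)
  \<comment> \<open>To identify \<open>v\<close> with \<open>f\<close>, the integral of the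
    difference is estimated on intervals of length 1/(n + 1). There it is quadratically small, so
    the sum over the order of n pieces that fill a fixed interval tends to 0.\<close>
  define F where "F x p = (LINT y:{x<..x + p}|lborel. f y - v y)" for x p
  have F_small: "\<bar>F x (1 / real (Suc n))\<bar> \<le> 2 * L / (real (Suc n))\<^sup>2" for x n
  proof -
    let ?s = "1 / real (Suc n)"
    have "F x ?s = A x ?s - (LINT y:{x<..x + ?s}|lborel. v y)"
      unfolding F_def A_def by (intro set_integral_diff f v_int)
    moreover have "\<bar>(LINT y:{x<..x + ?s}|lborel. v y) - ?s * v x\<bar> \<le> L * ?s * ?s"
    proof -
      have "\<bar>(LINT y:{x<..x + ?s}|lborel. v y) - v x * (x + ?s - x)\<bar> \<le> L * ?s * (x + ?s - x)"
      proof (rule set_integral_Ioc_near_const[OF v_int])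
        fix z assume "x < z" "z \<le> x + ?s"
        then have "L * \<bar>z - x\<bar> \<le> L * ?s" using L by (intro mult_left_mono) auto
        then show "\<bar>v z - v x\<bar> \<le> L * ?s" using v_lip[of z x] by linarith
      qed simp
      then show ?thesis by (simp add: mult.commute)
    qed
    moreover have "\<bar>A x ?s - ?s * v x\<bar> \<le> L * ?s * ?s"
    proof -
      have "A x ?s = ?s * D n x" by (simp add: D_def)
      then have "\<bar>A x ?s - ?s * v x\<bar> = \<bar>?s * (D n x - v x)\<bar>"
        by (simp only: right_diff_distrib)
      also have "\<dots> = ?s * \<bar>v x - D n x\<bar>"
        by (simp only: abs_mult) (simp add: abs_minus_commute)
      also have "\<dots> \<le> ?s * (L / real (Suc n))"
        by (intro mult_left_mono vD) auto
      finally show ?thesis by simp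
    qed
    ultimately have "\<bar>F x ?s\<bar> \<le> 2 * (L * ?s * ?s)" by linarith
    then show ?thesis by (simp add: power2_eq_square)
  qed
  have F_add: "F x (r + s) = F x r + F (x + r) s" if "0 \<le> r" "0 \<le> s" for x r s
    unfolding F_def using set_integral_Ioc_split[OF fv_int, of x "x + r" "x + (r + s)"] that by (simp add: add.assoc)
  have F_mult: "\<bar>F x (real k / real (Suc n))\<bar> \<le> real k * (2 * L / (real (Suc n))\<^sup>2)" for x k n
  proof (induction k)
    case 0
    then show ?case by (simp add: F_def set_lebesgue_integral_def)
  next
    case (Suc k)
    have "F x (real (Suc k) / real (Suc n)) = F x (real k / real (Suc n)) + F (x + real k / real (Suc n)) (1 / real (Suc n))"
      using F_add[of "real k / real (Suc n)" "1 / real (Suc n)" x] by (simp add: add_divide_distrib[symmetric] add.commute)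
    moreover have "real (Suc k) * (2 * L / (real (Suc n))\<^sup>2) =
      real k * (2 * L / (real (Suc n))\<^sup>2) + 2 * L / (real (Suc n))\<^sup>2"
      by (simp only: of_nat_Suc[of k] distrib_right mult_1_left add.commute)
    ultimately show ?case
      using Suc F_small[of "x + real k / real (Suc n)" n] by linarith
  qed
  have F0: "F x p = 0" if "0 \<le> p" for x p
  proof -
    \<comment> \<open>An arbitrary length \<open>p\<close> is approached from below by multiples of
      1/(n + 1).\<close>
    define k where "k n = nat \<lfloor>real (Suc n) * p\<rfloor>" for n
    have k: "real (Suc n) * p - 1 \<le> real (k n)" "real (k n) \<le> real (Suc n) * p" for n
    proof -
      have "0 \<le> real (Suc n) * p" using that by (intro mult_nonneg_nonneg) auto
      then have "real (k n) = of_int \<lfloor>real (Suc n) * p\<rfloor>" unfolding k_def by simp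
      then show "real (Suc n) * p - 1 \<le> real (k n)" "real (k n) \<le> real (Suc n) * p"
        using floor_correct[of "real (Suc n) * p"] by linarith+
    qed
    have lim: "(\<lambda>n. real (k n) / real (Suc n)) \<longlonglongrightarrow> p"
    proof (rule tendsto_sandwich[of "\<lambda>n. p - inverse (real (Suc n))" _ _ "\<lambda>n. p"])
      show "\<forall>\<^sub>F n in sequentially. p - inverse (real (Suc n)) \<le> real (k n) / real (Suc n)"
      proof (intro always_eventually allI)
        fix n
        have "p - inverse (real (Suc n)) = (real (Suc n) * p - 1) / real (Suc n)"
          by (simp add: field_simps del: of_nat_Suc)
        also have "\<dots> \<le> real (k n) / real (Suc n)"
          by (rule divide_right_mono[OF k(1)]) simp
        finally show "p - inverse (real (Suc n)) \<le> real (k n) / real (Suc n)" .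
      qed
      show "\<forall>\<^sub>F n in sequentially. real (k n) / real (Suc n) \<le> p"
      proof (intro always_eventually allI)
        fix n
        have "real (k n) / real (Suc n) \<le> real (Suc n) * p / real (Suc n)"
          by (rule divide_right_mono[OF k(2)]) simp
        then show "real (k n) / real (Suc n) \<le> p" by (simp del: of_nat_Suc)
      qed
      show "(\<lambda>n. p - inverse (real (Suc n))) \<longlonglongrightarrow> p"
        using tendsto_diff[OF tendsto_const LIMSEQ_inverse_real_of_nat, of p] by simp
    qed simp
    have "(\<lambda>n. F x (real (k n) / real (Suc n))) \<longlonglongrightarrow> F x p"
      unfolding F_def by (intro tendsto_integral_Ioc fv_int tendsto_intros lim)
    moreover have "(\<lambda>n. F x (real (k n) / real (Suc n))) \<longlonglongrightarrow> 0"
    proof (rule Lim_null_comparison)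
      show "\<forall>\<^sub>F n in sequentially. norm (F x (real (k n) / real (Suc n))) \<le> 2 * p * (L / real (Suc n))"
      proof (intro always_eventually allI)
        fix n
        have "\<bar>F x (real (k n) / real (Suc n))\<bar> \<le> real (k n) * (2 * L / (real (Suc n))\<^sup>2)" by (rule F_mult)
        also have "\<dots> \<le> (real (Suc n) * p) * (2 * L / (real (Suc n))\<^sup>2)"
          using k(2) L by (intro mult_right_mono) auto
        also have "\<dots> = 2 * p * (L / real (Suc n))" by (simp add: power2_eq_square)
        finally show "norm (F x (real (k n) / real (Suc n))) \<le> 2 * p * (L / real (Suc n))" by simp
      qed
      show "(\<lambda>n. 2 * p * (L / real (Suc n))) \<longlonglongrightarrow> 0"
        using tendsto_mult[OF tendsto_const null, of "2 * p"] by simp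
    qed
    ultimately show ?thesis by (rule LIMSEQ_unique)
  qed
  have "AE x in lborel. f x - v x = 0"
  proof (rule AE_eq_0_if_integral_Ioc_eq_0[OF fv_int])
    fix a b :: real
    show "(LINT y:{a<..b}|lborel. f y - v y) = 0"
    proof (cases "a \<le> b")
      case True
      then show ?thesis using F0[of "b - a" a] by (simp add: F_def)
    qed (simp add: set_lebesgue_integral_def)
  qed
  then show "AE x in lborel. f x = lim (\<lambda>n. D n x)" by (simp add: v_def)
qed

subsection \<open>Particle paths\<close>

text \<open>Valid even for a non-integrable \<open>f\<close>: its integral is then 0 by convention,
  and the bound is non-negative on \<open>A\<close>.\<close>

lemma abs_set_integral_le:
  fixes f g :: "real \<Rightarrow> real"
  assumes "integrable lborel g" "A \<in> sets borel" "\<And>s. s \<in> A \<Longrightarrow> \<bar>f s\<bar> \<le> g s"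
  shows "\<bar>LINT s:A|lborel. f s\<bar> \<le> (LINT s:A|lborel. g s)"
proof -
  have "\<bar>LINT s:A|lborel. f s\<bar> \<le> (LINT s|lborel. \<bar>indicator A s *\<^sub>R f s\<bar>)"
    unfolding set_lebesgue_integral_def
    using integral_norm_bound[of lborel "\<lambda>s. indicator A s *\<^sub>R f s"] by simp
  also have "\<dots> \<le> (LINT s|lborel. indicator A s *\<^sub>R g s)"
  proof (rule integral_mono')
    show "integrable lborel (\<lambda>s. indicator A s *\<^sub>R g s)"
      by (intro integrable_mult_indicator) (use assms in auto)
    fix s :: real
    have "s \<in> A \<Longrightarrow> 0 \<le> g s" using assms(3)[of s] by linarith
    then show "\<bar>indicator A s *\<^sub>R f s\<bar> \<le> indicator A s *\<^sub>R g s" "0 \<le> indicator A s *\<^sub>R g s"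
      using assms(3)[of s] by (auto split: split_indicator)
  qed
  finally show ?thesis unfolding set_lebesgue_integral_def .
qed

lemma set_integral_le_integral:
  fixes g :: "real \<Rightarrow> real"
  assumes "integrable lborel g" "\<And>s. 0 \<le> g s" "A \<in> sets borel"
  shows "(LINT s:A|lborel. g s) \<le> (LINT s|lborel. g s)"
  unfolding set_lebesgue_integral_def
  by (rule integral_mono') (use assms in \<open>auto split: split_indicator\<close>)

text \<open>The bounds are demanded at every time, not almost every one; the application sets the
  field to 0 at exceptional times. The total Lipschitz weight 1/4 lets one contraction argument work
  on the whole time axis.\<close>

locale lipschitz_field =
  fixes v :: "real \<times> real \<Rightarrow> real" and L g :: "real \<Rightarrow> real"
  assumes v_borel [measurable]: "v \<in> borel_measurable borel"
    and v_lip: "\<bar>v (t, x) - v (t, y)\<bar> \<le> L t * \<bar>x - y\<bar>"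
    and v_0: "\<bar>v (t, 0)\<bar> \<le> g t"
    and L_int: "integrable lborel L" and g_int: "integrable lborel g"
    and L_small: "(LINT t|lborel. L t) \<le> 1 / 4"
begin

lemma L_nonneg: "0 \<le> L t"
  using order_trans[OF abs_ge_zero v_lip[of t 1 0]] by simp

lemma v_bound: "\<bar>x\<bar> \<le> B \<Longrightarrow> \<bar>v (t, x)\<bar> \<le> g t + L t * B"
  using v_lip[of t x 0] v_0[of t] mult_left_mono[OF _ L_nonneg, of "\<bar>x\<bar>" B t] by auto

lemma bound_int: "integrable lborel (\<lambda>t. g t + L t * B)"
  by (intro Bochner_Integration.integrable_add integrable_mult_left g_int L_int)

lemma curve_int:
  assumes "continuous_on UNIV X" "\<And>t. \<bar>X t\<bar> \<le> B"
  shows "integrable lborel (\<lambda>t. v (t, X t))"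
proof (rule Bochner_Integration.integrable_bound[OF bound_int[of B]])
  have [measurable]: "X \<in> borel_measurable borel"
    using assms(1) by (rule borel_measurable_continuous_onI)
  show "(\<lambda>t. v (t, X t)) \<in> borel_measurable lborel" by measurable
  have "\<bar>v (t, X t)\<bar> \<le> \<bar>g t + L t * B\<bar>" for t
    using v_bound[OF assms(2)] by (meson abs_ge_self order_trans)
  then show "AE t in lborel. norm (v (t, X t)) \<le> norm (g t + L t * B)" by simp
qed

text \<open>Picard's operator on bounded continuous functions of time: the integrable bounds keep
  its values bounded, and it contracts distances by the factor 1/4. For t < a the integral is over
  an empty set, so a path rests at its starting point.\<close>

lemma flow_exists:
  obtains X B where "continuous_on UNIV X" "\<And>t. \<bar>X t\<bar> \<le> B"
    "\<And>t. X t = x0 + (LINT s:{a<..t}|lborel. v (s, X s))"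
proof -
  define T where "T X t = x0 + (LINT s:{a<..t}|lborel. v (s, X s))" for X :: "real \<Rightarrow> real" and t
  have bnd: "\<bar>apply_bcontfun X t\<bar> \<le> norm X" for X :: "real \<Rightarrow>\<^sub>C real" and t
    using norm_bounded[of X t] by simp
  have int: "integrable lborel (\<lambda>t. v (t, apply_bcontfun X t))" for X
    by (rule curve_int[OF _ bnd]) simp
  have T: "T (apply_bcontfun X) \<in> bcontfun" for X
  proof (rule bcontfun_normI)
    show "continuous_on UNIV (T (apply_bcontfun X))"
      unfolding T_def by (intro continuous_intros continuous_on_integral_Ioc int)
    fix t
    have "\<bar>LINT s:{a<..t}|lborel. v (s, apply_bcontfun X s)\<bar> \<le> (LINT s:{a<..t}|lborel. g s + L s * norm X)"
      by (intro abs_set_integral_le bound_int v_bound bnd) simp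
    also have "\<dots> \<le> (LINT s|lborel. g s + L s * norm X)"
    proof (rule set_integral_le_integral[OF bound_int])
      show "0 \<le> g s + L s * norm X" for s
        using v_bound[of 0 "norm X" s] by simp
    qed simp
    finally show "norm (T (apply_bcontfun X) t) \<le> \<bar>x0\<bar> + (LINT s|lborel. g s + L s * norm X)"
      unfolding T_def by simp
  qed
  define TT where "TT X = Bcontfun (T (apply_bcontfun X))" for X
  have TT: "apply_bcontfun (TT X) = T (apply_bcontfun X)" for X
    unfolding TT_def by (rule Bcontfun_inverse[OF T])
  have "dist (TT X) (TT Y) \<le> 1 / 4 * dist X Y" for X Y
  proof (rule dist_bound)
    fix t
    have "apply_bcontfun (TT X) t - apply_bcontfun (TT Y) t =
        (LINT s:{a<..t}|lborel. v (s, apply_bcontfun X s) - v (s, apply_bcontfun Y s))"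
      unfolding TT T_def
      by (subst set_integral_diff(2)) (auto intro!: integrable_imp_set_integrable int)
    also have "\<bar>\<dots>\<bar> \<le> (LINT s:{a<..t}|lborel. L s * dist X Y)"
    proof (rule abs_set_integral_le)
      fix s
      have "\<bar>apply_bcontfun X s - apply_bcontfun Y s\<bar> \<le> dist X Y"
        using dist_bounded[of X s Y] by (simp add: dist_real_def)
      then show "\<bar>v (s, apply_bcontfun X s) - v (s, apply_bcontfun Y s)\<bar> \<le> L s * dist X Y"
        using v_lip[of s "apply_bcontfun X s" "apply_bcontfun Y s"] mult_left_mono[OF _ L_nonneg[of s]]
        by (meson order_trans)
    qed (auto intro: L_int)
    also have "\<dots> \<le> (LINT s|lborel. L s * dist X Y)"
      by (rule set_integral_le_integral) (auto intro: L_int L_nonneg mult_nonneg_nonneg)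
    also have "\<dots> = (LINT s|lborel. L s) * dist X Y" by simp
    also have "\<dots> \<le> 1 / 4 * dist X Y" by (intro mult_right_mono L_small) simp
    finally show "dist (apply_bcontfun (TT X) t) (apply_bcontfun (TT Y) t) \<le> 1 / 4 * dist X Y"
      by (simp add: dist_real_def)
  qed
  then obtain X where "TT X = X"
    using banach_fix_type[of "1 / 4" TT] by auto
  then have "apply_bcontfun X t = T (apply_bcontfun X) t" for t using TT[of X] by simp
  then have "apply_bcontfun X t = x0 + (LINT s:{a<..t}|lborel. v (s, apply_bcontfun X s))" for t
    unfolding T_def .
  then show ?thesis
    by (rule that[OF continuous_on_apply_bcontfun bnd])
qed

text \<open>If S is the largest distance of the two paths, then this distance deviates from
  \<open>h\<close> by at most S/4 at each time. Taking the supremum gives S <= h + S/4, so S <= 4h/3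
  and the deviation is at most h/3. This replaces Gronwall's inequality.\<close>

lemma flow_compare:
  assumes X: "continuous_on UNIV X" "\<And>t. \<bar>X t\<bar> \<le> B" "\<And>t. X t = x0 + (LINT s:{a<..t}|lborel. v (s, X s))"
    and Y: "continuous_on UNIV Y" "\<And>t. \<bar>Y t\<bar> \<le> B'" "\<And>t. Y t = x0 + h + (LINT s:{a<..t}|lborel. v (s, Y s))"
    and h: "0 \<le> h"
  shows "2 / 3 * h \<le> Y t - X t" "Y t - X t \<le> 4 / 3 * h"
proof -
  define S where "S = (SUP t. \<bar>Y t - X t\<bar>)"
  have bdd: "bdd_above (range (\<lambda>t. \<bar>Y t - X t\<bar>))"
  proof (rule bdd_aboveI2)
    show "\<bar>Y t - X t\<bar> \<le> B + B'" for t using X(2)[of t] Y(2)[of t] by linarith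
  qed
  have S: "\<bar>Y t - X t\<bar> \<le> S" for t unfolding S_def by (rule cSUP_upper[OF _ bdd]) simp
  have S0: "0 \<le> S" using order_trans[OF abs_ge_zero S] .
  have D: "\<bar>Y t - X t - h\<bar> \<le> S / 4" for t
  proof -
    have "Y t - X t - h = (LINT s:{a<..t}|lborel. v (s, Y s) - v (s, X s))"
      using X(3)[of t] Y(3)[of t]
      by (subst set_integral_diff(2)) (auto intro!: integrable_imp_set_integrable curve_int[OF X(1,2)] curve_int[OF Y(1,2)])
    also have "\<bar>\<dots>\<bar> \<le> (LINT s:{a<..t}|lborel. L s * S)"
    proof (rule abs_set_integral_le)
      show "\<bar>v (s, Y s) - v (s, X s)\<bar> \<le> L s * S" for s
        using v_lip[of s "Y s" "X s"] mult_left_mono[OF S L_nonneg[of s], of s] by linarith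
    qed (auto intro: L_int)
    also have "\<dots> \<le> (LINT s|lborel. L s * S)"
      by (rule set_integral_le_integral) (auto intro: L_int L_nonneg mult_nonneg_nonneg S0)
    also have "\<dots> = (LINT s|lborel. L s) * S" by simp
    also have "\<dots> \<le> 1 / 4 * S" by (intro mult_right_mono L_small S0)
    finally show ?thesis by simp
  qed
  have "S \<le> h + S / 4"
  proof -
    have "\<bar>Y t - X t\<bar> \<le> h + S / 4" for t using D[of t] h by linarith
    then show ?thesis unfolding S_def by (intro cSUP_least) (auto simp: S_def)
  qed
  then have "S \<le> 4 / 3 * h" by simp
  then show "2 / 3 * h \<le> Y t - X t" "Y t - X t \<le> 4 / 3 * h"
    using D[of t] by linarith+
qed

end

subsection \<open>Conservation of mass between particle paths\<close>

text \<open>A substitute for a vanishing derivative: increments that are small relative to an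
  integrable weight, uniformly on short intervals, add up along a partition to at most
  \<open>e\<close> times the total weight.\<close>

lemma constant_if_small_increments:
  fixes f G :: "real \<Rightarrow> real"
  assumes ab: "a \<le> b" and G: "integrable lborel G" "\<And>s. 0 \<le> G s"
    and inc: "\<And>e. 0 < e \<Longrightarrow> \<exists>d>0. \<forall>s t. a \<le> s \<longrightarrow> s \<le> t \<longrightarrow> t \<le> b \<longrightarrow> t - s \<le> d \<longrightarrow>
      \<bar>f t - f s\<bar> \<le> e * (LINT r:{s<..t}|lborel. G r)"
  shows "f b = f a"
proof -
  let ?I = "LINT r|lborel. G r"
  have small: "\<bar>f b - f a\<bar> \<le> e * ?I" if "0 < e" for e
  proof -
    obtain d where d: "0 < d" and inc_d: "\<And>s t. a \<le> s \<Longrightarrow> s \<le> t \<Longrightarrow> t \<le> b \<Longrightarrow> t - s \<le> d \<Longrightarrow>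
      \<bar>f t - f s\<bar> \<le> e * (LINT r:{s<..t}|lborel. G r)"
      using inc[OF \<open>0 < e\<close>] by auto
    obtain n :: nat where n: "(b - a) / d < real n" using reals_Archimedean2 by blast
    define q where "q = (b - a) / real (Suc n)"
    have q0: "0 \<le> q" using ab by (simp add: q_def)
    have qd: "q \<le> d"
    proof -
      have "b - a < real n * d" using n d by (simp add: field_simps)
      also have "\<dots> \<le> real (Suc n) * d" using d by (intro mult_right_mono) auto
      finally show ?thesis unfolding q_def by (simp add: divide_le_eq mult.commute del: of_nat_Suc)
    qed
    have qn: "a + real (Suc n) * q = b" by (simp add: q_def del: of_nat_Suc)
    have "k \<le> Suc n \<Longrightarrow> \<bar>f (a + real k * q) - f a\<bar> \<le> e * (LINT r:{a<..a + real k * q}|lborel. G r)" for k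
    proof (induction k)
      case 0
      then show ?case by (simp add: set_lebesgue_integral_def)
    next
      case (Suc k)
      define s t where "s = a + real k * q" and "t = a + real (Suc k) * q"
      have ts: "t = s + q" by (simp add: s_def t_def algebra_simps)
      have as: "a \<le> s" using q0 by (simp add: s_def)
      have "real (Suc k) * q \<le> real (Suc n) * q" using Suc.prems q0 by (intro mult_right_mono) auto
      then have tb: "t \<le> b" using qn by (simp only: t_def)
      have "\<bar>f t - f s\<bar> \<le> e * (LINT r:{s<..t}|lborel. G r)"
        by (rule inc_d) (use as tb qd q0 ts in auto)
      moreover have "\<bar>f s - f a\<bar> \<le> e * (LINT r:{a<..s}|lborel. G r)"
        using Suc unfolding s_def by simp
      moreover have "(LINT r:{a<..t}|lborel. G r) = (LINT r:{a<..s}|lborel. G r) + (LINT r:{s<..t}|lborel. G r)"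
        by (rule set_integral_Ioc_split) (use as ts q0 in \<open>auto intro: integrable_imp_set_integrable G\<close>)
      ultimately have "\<bar>f t - f a\<bar> \<le> e * (LINT r:{a<..t}|lborel. G r)"
        by (simp add: distrib_left)
      then show ?case unfolding t_def .
    qed
    from this[of "Suc n"] have "\<bar>f b - f a\<bar> \<le> e * (LINT r:{a<..b}|lborel. G r)"
      unfolding qn by simp
    also have "\<dots> \<le> e * ?I"
      using that by (intro mult_left_mono set_integral_le_integral G) auto
    finally show ?thesis .
  qed
  have I: "0 \<le> ?I" using G(2) by simp
  have "\<bar>f b - f a\<bar> \<le> 0 + e" if "0 < e" for e
  proof -
    \<comment> \<open>The summand 1 covers a total weight of zero.\<close>
    have "\<bar>f b - f a\<bar> \<le> e / (?I + 1) * ?I" using that I by (intro small) auto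
    also have "\<dots> \<le> e" using that I by (simp add: field_simps)
    finally show ?thesis by simp
  qed
  then have "\<bar>f b - f a\<bar> \<le> 0" by (rule field_le_epsilon)
  then show ?thesis by simp
qed

locale mass_transport = lipschitz_field v L g for v L g +
  fixes \<rho> :: "real \<times> real \<Rightarrow> real" and C a b :: real
  assumes ab: "a \<le> b"
    and \<rho>_borel [measurable]: "\<rho> \<in> borel_measurable borel"
    and \<rho>_cont: "continuous_on ({a..b} \<times> UNIV) \<rho>"
    and \<rho>_bound: "0 \<le> \<rho> z" "\<rho> z \<le> C"
    and mass: "a \<le> s \<Longrightarrow> s \<le> t \<Longrightarrow> t \<le> b \<Longrightarrow> x < y \<Longrightarrow>
      (LINT z:{x<..y}|lborel. \<rho> (t, z)) - (LINT z:{x<..y}|lborel. \<rho> (s, z)) =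
      - (LINT r:{s<..t}|lborel. \<rho> (r, y) * v (r, y) - \<rho> (r, x) * v (r, x))"
begin

lemma C_nonneg: "0 \<le> C" using \<rho>_bound order_trans by blast

lemma \<rho>_abs: "\<bar>\<rho> z\<bar> \<le> C" using \<rho>_bound[of z] by simp

lemma \<rho>_int: "set_integrable lborel {x<..y} (\<lambda>z. \<rho> (t, z))"
  unfolding set_integrable_def
proof (rule Bochner_Integration.integrable_bound[where f = "\<lambda>z. indicator {x<..y} z * C"])
  show "integrable lborel (\<lambda>z. indicator {x<..y} z * C)"
    by (intro integrable_mult_left integrable_real_indicator) (cases "x \<le> y"; simp)+
  show "AE z in lborel. norm (indicator {x<..y} z *\<^sub>R \<rho> (t, z)) \<le> norm (indicator {x<..y} z * C)"
    using \<rho>_abs C_nonneg by (intro AE_I2) (auto split: split_indicator)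
qed measurable

lemma flux_int: "integrable lborel (\<lambda>r. \<rho> (r, x) * v (r, x))"
proof (rule Bochner_Integration.integrable_bound[where f = "\<lambda>r. C * (g r + L r * \<bar>x\<bar>)"])
  show "integrable lborel (\<lambda>r. C * (g r + L r * \<bar>x\<bar>))"
    by (intro integrable_mult_right bound_int)
  have "\<bar>\<rho> (r, x) * v (r, x)\<bar> \<le> C * (g r + L r * \<bar>x\<bar>)" for r
    unfolding abs_mult using v_bound[of x "\<bar>x\<bar>" r] by (intro mult_mono \<rho>_abs C_nonneg) auto
  then show "AE r in lborel. norm (\<rho> (r, x) * v (r, x)) \<le> norm (C * (g r + L r * \<bar>x\<bar>))"
    by (intro AE_I2) (metis abs_ge_self order_trans real_norm_def)
qed measurable

text \<open>\<open>M\<close> is a potential of the mass flow: its space derivative is the density,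
  its time derivative minus the flux. Formally dM = \<rho> dX - \<rho> v dt vanishes along a path.
  The base point \<open>z0\<close> lies to the left of the whole path, and the second term of
  \<open>M\<close> accounts for the mass crossing it.\<close>

lemma flow_mass_potential:
  assumes X: "continuous_on UNIV X" "\<And>t. \<bar>X t\<bar> \<le> B" "\<And>t. X t = x0 + (LINT s:{a<..t}|lborel. v (s, X s))"
    and z0: "z0 < - B"
  defines "M \<equiv> \<lambda>t x. (LINT z:{z0<..x}|lborel. \<rho> (t, z)) - (LINT r:{a<..t}|lborel. \<rho> (r, z0) * v (r, z0))"
  shows "M b (X b) = M a (X a)"
proof -
  define G0 where "G0 r = g r + L r * B" for r
  \<comment> \<open>Three errors: the density varying in space between \<open>X s\<close> and
    \<open>X t\<close>, the density varying in time at \<open>X s\<close>, and the velocity being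
    taken at \<open>X s\<close> rather than on the path. The first two cost \<open>G0\<close> each,
    the third \<open>C * L\<close>.\<close>
  define G where "G r = 2 * G0 r + C * L r" for r
  have B: "0 \<le> B" using order_trans[OF abs_ge_zero X(2)] .
  have vX: "\<bar>v (r, X r)\<bar> \<le> G0 r" for r unfolding G0_def by (rule v_bound[OF X(2)])
  have G0_nn: "0 \<le> G0 r" for r using order_trans[OF abs_ge_zero vX] .
  have G0_int: "integrable lborel G0" unfolding G0_def by (rule bound_int)
  have G_int: "integrable lborel G"
    unfolding G_def by (intro Bochner_Integration.integrable_add integrable_mult_right G0_int L_int)
  have G_nn: "0 \<le> G r" for r
    unfolding G_def using G0_nn C_nonneg L_nonneg by (intro add_nonneg_nonneg mult_nonneg_nonneg) auto
  have vXi: "integrable lborel (\<lambda>r. v (r, X r))" by (rule curve_int[OF X(1,2)])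
  have Mt: "M t x - M s x = - (LINT r:{s<..t}|lborel. \<rho> (r, x) * v (r, x))"
    if "a \<le> s" "s \<le> t" "t \<le> b" "z0 < x" for s t x
  proof -
    have "(LINT r:{s<..t}|lborel. \<rho> (r, x) * v (r, x) - \<rho> (r, z0) * v (r, z0)) =
      (LINT r:{s<..t}|lborel. \<rho> (r, x) * v (r, x)) - (LINT r:{s<..t}|lborel. \<rho> (r, z0) * v (r, z0))"
      by (rule set_integral_diff) (auto intro: integrable_imp_set_integrable flux_int)
    moreover have "(LINT r:{a<..t}|lborel. \<rho> (r, z0) * v (r, z0)) =
      (LINT r:{a<..s}|lborel. \<rho> (r, z0) * v (r, z0)) + (LINT r:{s<..t}|lborel. \<rho> (r, z0) * v (r, z0))"
      by (rule set_integral_Ioc_split) (use that in \<open>auto intro: integrable_imp_set_integrable flux_int\<close>)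
    ultimately show ?thesis
      using mass[OF that] unfolding M_def by linarith
  qed
  have Mx: "\<bar>M t y - M t x - c * (y - x)\<bar> \<le> e * \<bar>y - x\<bar>"
    if "z0 < x" "z0 < y" "\<And>z. min x y \<le> z \<Longrightarrow> z \<le> max x y \<Longrightarrow> \<bar>\<rho> (t, z) - c\<bar> \<le> e" for t x y c e
  proof (cases "x \<le> y")
    case True
    have "(LINT z:{z0<..y}|lborel. \<rho> (t, z)) = (LINT z:{z0<..x}|lborel. \<rho> (t, z)) + (LINT z:{x<..y}|lborel. \<rho> (t, z))"
      by (rule set_integral_Ioc_split) (use that True \<rho>_int in auto)
    moreover have "\<bar>(LINT z:{x<..y}|lborel. \<rho> (t, z)) - c * (y - x)\<bar> \<le> e * (y - x)"
      by (rule set_integral_Ioc_near_const) (use that(3) True \<rho>_int in auto)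
    ultimately show ?thesis using True unfolding M_def by simp
  next
    case False
    then have yx: "y \<le> x" by simp
    have "(LINT z:{z0<..x}|lborel. \<rho> (t, z)) = (LINT z:{z0<..y}|lborel. \<rho> (t, z)) + (LINT z:{y<..x}|lborel. \<rho> (t, z))"
      by (rule set_integral_Ioc_split) (use that yx \<rho>_int in auto)
    moreover have "\<bar>(LINT z:{y<..x}|lborel. \<rho> (t, z)) - c * (x - y)\<bar> \<le> e * (x - y)"
      by (rule set_integral_Ioc_near_const) (use that(3) yx \<rho>_int in auto)
    moreover have "c * (y - x) = - (c * (x - y))" by (simp add: algebra_simps)
    ultimately show ?thesis using yx unfolding M_def by (simp add: abs_minus_commute)
  qed
  show ?thesis
  proof (rule constant_if_small_increments[OF ab G_int G_nn])
    fix e :: real assume e: "0 < e"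
    have "uniformly_continuous_on ({a..b} \<times> {-B..B}) \<rho>"
      by (rule compact_uniformly_continuous[OF continuous_on_subset[OF \<rho>_cont]])
        (auto intro: compact_Times)
    then obtain d1 where d1: "0 < d1" and unif: "\<And>z z'. z \<in> {a..b} \<times> {-B..B} \<Longrightarrow> z' \<in> {a..b} \<times> {-B..B} \<Longrightarrow>
        dist z' z < d1 \<Longrightarrow> dist (\<rho> z') (\<rho> z) < e"
      using e unfolding uniformly_continuous_on_def by metis
    have "uniformly_continuous_on {a..b} X"
      by (rule compact_uniformly_continuous[OF continuous_on_subset[OF X(1)]]) auto
    \<comment> \<open>The displacement must be below \<open>e\<close> for the velocity error and
      below \<open>d1\<close> for the density error.\<close>
    moreover have "0 < min e d1" using e d1 by simp
    ultimately obtain d2 where d2: "0 < d2" and unifX: "\<And>s t. s \<in> {a..b} \<Longrightarrow> t \<in> {a..b} \<Longrightarrow>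
        dist t s < d2 \<Longrightarrow> dist (X t) (X s) < min e d1"
      unfolding uniformly_continuous_on_def by metis
    define d where "d = min (d1 / 2) (d2 / 2)"
    show "\<exists>d>0. \<forall>s t. a \<le> s \<longrightarrow> s \<le> t \<longrightarrow> t \<le> b \<longrightarrow> t - s \<le> d \<longrightarrow>
      \<bar>M t (X t) - M s (X s)\<bar> \<le> e * (LINT r:{s<..t}|lborel. G r)"
    proof (intro exI[of _ d] conjI allI impI)
      show "0 < d" using d1 d2 by (simp add: d_def)
      fix s t assume st: "a \<le> s" "s \<le> t" "t \<le> b" "t - s \<le> d"
      have Xr: "\<bar>X r - X s\<bar> < min e d1" if "s \<le> r" "r \<le> t" for r
        using unifX[of s r] that st d2 by (auto simp: dist_real_def d_def)
      have z0X: "z0 < X r" for r using X(2)[of r] z0 by linarith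
      \<comment> \<open>The density is frozen at the later time and the earlier position: the
        increment splits into a move in space at time \<open>t\<close>, followed by a change of time
        at position \<open>X s\<close>.\<close>
      define c where "c = \<rho> (t, X s)"
      have rho_x: "\<bar>\<rho> (t, z) - c\<bar> \<le> e" if "min (X s) (X t) \<le> z" "z \<le> max (X s) (X t)" for z
      proof -
        have "\<bar>z - X s\<bar> \<le> \<bar>X t - X s\<bar>" using that by auto
        then have "\<bar>z - X s\<bar> < d1" using Xr[of t] st by auto
        moreover have "\<bar>z\<bar> \<le> B" using X(2)[of s] X(2)[of t] that by auto
        ultimately have "dist (\<rho> (t, z)) (\<rho> (t, X s)) < e"
          using X(2)[of s] st by (intro unif) (auto simp: dist_Pair_Pair dist_real_def abs_le_iff)
        then show ?thesis by (simp add: c_def dist_real_def)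
      qed
      have rho_t: "\<bar>c - \<rho> (r, X s)\<bar> \<le> e" if "s < r" "r \<le> t" for r
      proof -
        have "dist (\<rho> (t, X s)) (\<rho> (r, X s)) < e"
          using X(2)[of s] st that d1 by (intro unif) (auto simp: dist_Pair_Pair dist_real_def abs_le_iff d_def)
        then show ?thesis by (simp add: c_def dist_real_def)
      qed
      have XX: "X t - X s = (LINT r:{s<..t}|lborel. v (r, X r))"
      proof -
        have "(LINT r:{a<..t}|lborel. v (r, X r)) = (LINT r:{a<..s}|lborel. v (r, X r)) + (LINT r:{s<..t}|lborel. v (r, X r))"
          by (rule set_integral_Ioc_split) (use st in \<open>auto intro: integrable_imp_set_integrable vXi\<close>)
        then show ?thesis using X(3)[of t] X(3)[of s] by linarith
      qed
      have XX_abs: "\<bar>X t - X s\<bar> \<le> (LINT r:{s<..t}|lborel. G0 r)"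
        unfolding XX by (rule abs_set_integral_le[OF G0_int]) (auto intro: vX)
      have i1: "integrable lborel (\<lambda>r. c * v (r, X r))" by (intro integrable_mult_right vXi)
      have main: "c * (X t - X s) - (LINT r:{s<..t}|lborel. \<rho> (r, X s) * v (r, X s)) =
          (LINT r:{s<..t}|lborel. c * v (r, X r) - \<rho> (r, X s) * v (r, X s))"
        unfolding XX by (subst set_integral_diff(2)) (auto intro: integrable_imp_set_integrable i1 flux_int)
      have "\<bar>c * (X t - X s) - (LINT r:{s<..t}|lborel. \<rho> (r, X s) * v (r, X s))\<bar> \<le>
          (LINT r:{s<..t}|lborel. e * (G0 r + C * L r))"
        unfolding main
      proof (rule abs_set_integral_le)
        show "integrable lborel (\<lambda>r. e * (G0 r + C * L r))"
          by (intro integrable_mult_right Bochner_Integration.integrable_add G0_int L_int)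
        fix r assume r: "r \<in> {s<..t}"
        \<comment> \<open>Replace first the density, then the point at which the velocity is
          evaluated.\<close>
        have "c * v (r, X r) - \<rho> (r, X s) * v (r, X s) =
          (c - \<rho> (r, X s)) * v (r, X r) + \<rho> (r, X s) * (v (r, X r) - v (r, X s))"
          by (simp add: algebra_simps)
        moreover have "\<bar>(c - \<rho> (r, X s)) * v (r, X r)\<bar> \<le> e * G0 r"
          unfolding abs_mult using r e by (intro mult_mono rho_t vX) auto
        moreover have "\<bar>\<rho> (r, X s) * (v (r, X r) - v (r, X s))\<bar> \<le> C * (L r * e)"
          unfolding abs_mult
        proof (intro mult_mono \<rho>_abs C_nonneg)
          have "\<bar>X r - X s\<bar> \<le> e" using Xr[of r] r by auto
          then show "\<bar>v (r, X r) - v (r, X s)\<bar> \<le> L r * e"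
            using v_lip[of r "X r" "X s"] mult_left_mono[OF _ L_nonneg[of r]] order_trans by blast
        qed simp
        ultimately show "\<bar>c * v (r, X r) - \<rho> (r, X s) * v (r, X s)\<bar> \<le> e * (G0 r + C * L r)"
          by (simp add: algebra_simps)
      qed simp
      moreover have "\<bar>M t (X t) - M t (X s) - c * (X t - X s)\<bar> \<le> e * (LINT r:{s<..t}|lborel. G0 r)"
        using order_trans[OF Mx[OF z0X z0X rho_x, of s t] mult_left_mono[OF XX_abs]] e by simp
      moreover have "M t (X s) - M s (X s) = - (LINT r:{s<..t}|lborel. \<rho> (r, X s) * v (r, X s))"
        using st z0X by (intro Mt)
      ultimately have "\<bar>M t (X t) - M s (X s)\<bar> \<le>
          (LINT r:{s<..t}|lborel. e * (G0 r + C * L r)) + e * (LINT r:{s<..t}|lborel. G0 r)"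
        by linarith
      also have "\<dots> = (LINT r:{s<..t}|lborel. e * (G0 r + C * L r) + e * G0 r)"
        by (subst set_integral_add(2))
          (auto intro!: integrable_imp_set_integrable integrable_mult_right Bochner_Integration.integrable_add G0_int L_int)
      also have "\<dots> = e * (LINT r:{s<..t}|lborel. G r)"
        unfolding set_integral_mult_right[symmetric] G_def by (simp add: algebra_simps)
      finally show "\<bar>M t (X t) - M s (X s)\<bar> \<le> e * (LINT r:{s<..t}|lborel. G r)" .
    qed
  qed
qed

theorem vacuum_transported:
  assumes vac: "\<rho> (a, x0) = 0"
  shows "\<exists>x. \<rho> (b, x) = 0"
proof (rule ccontr)
  assume no: "\<nexists>x. \<rho> (b, x) = 0"
  obtain X B where X: "continuous_on UNIV X" "\<And>t. \<bar>X t\<bar> \<le> B" "\<And>t. X t = x0 + (LINT s:{a<..t}|lborel. v (s, X s))"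
    by (rule flow_exists[of x0 a]) (rule that)
  define c where "c = \<rho> (b, X b)"
  have c: "0 < c" using no \<rho>_bound(1)[of "(b, X b)"] by (force simp: c_def less_le)
  have cont: "continuous_on UNIV (\<lambda>z. \<rho> (t, z))" if "t \<in> {a..b}" for t
    by (rule continuous_on_compose2[OF \<rho>_cont]) (use that in \<open>auto intro!: continuous_intros\<close>)
  have near: "\<exists>d>0. \<forall>z. \<bar>z - x\<bar> \<le> d \<longrightarrow> \<bar>\<rho> (t, z) - \<rho> (t, x)\<bar> \<le> e" if t: "t \<in> {a..b}" and e: "0 < e" for t x e
  proof -
    obtain d where d: "0 < d" "\<And>z. dist z x < d \<Longrightarrow> dist (\<rho> (t, z)) (\<rho> (t, x)) < e"
      using cont[OF t] e unfolding continuous_on_iff by (metis UNIV_I)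
    have "\<bar>\<rho> (t, z) - \<rho> (t, x)\<bar> \<le> e" if "\<bar>z - x\<bar> \<le> d / 2" for z
      using d(2)[of z] that d(1) by (simp add: dist_real_def)
    then show ?thesis using d(1) by (intro exI[of _ "d / 2"]) simp
  qed
  obtain d1 where d1: "0 < d1" "\<And>z. \<bar>z - X b\<bar> \<le> d1 \<Longrightarrow> \<bar>\<rho> (b, z) - c\<bar> \<le> c / 2"
    using near[of b "c / 2" "X b"] ab c unfolding c_def by auto
  \<comment> \<open>The constants are fixed by the final comparison: the later mass is at least
    (c/2)(2h/3) = c h/3, the initial one at most c h/6, and these are incompatible.\<close>
  obtain d2 where d2: "0 < d2" "\<And>z. \<bar>z - x0\<bar> \<le> d2 \<Longrightarrow> \<bar>\<rho> (a, z) - 0\<bar> \<le> c / 6"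
    using near[of a "c / 6" x0] ab c vac by auto
  \<comment> \<open>Half of \<open>d1\<close> suffices because the paths separate to at most
    4h/3.\<close>
  define h where "h = min (d1 / 2) d2"
  have h: "0 < h" "h \<le> d2" "4 / 3 * h \<le> d1" using d1 d2 by (auto simp: h_def)
  obtain Y B' where Y: "continuous_on UNIV Y" "\<And>t. \<bar>Y t\<bar> \<le> B'" "\<And>t. Y t = x0 + h + (LINT s:{a<..t}|lborel. v (s, Y s))"
    by (rule flow_exists[of "x0 + h" a]) (rule that)
  have YX: "2 / 3 * h \<le> Y b - X b" "Y b - X b \<le> 4 / 3 * h"
    using flow_compare[OF X Y, of b] h by auto
  \<comment> \<open>One base point for both potentials, so that the flux through it cancels in their
    difference.\<close>
  define z0 where "z0 = - max B B' - 1"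
  have Xa: "X a = x0" "Y a = x0 + h" using X(3)[of a] Y(3)[of a] by (auto simp: set_lebesgue_integral_def)
  have z0: "z0 < X t" "z0 < Y t" for t using X(2)[of t] Y(2)[of t] by (auto simp: z0_def)
  have split: "(LINT z:{z0<..y}|lborel. \<rho> (t, z)) = (LINT z:{z0<..x}|lborel. \<rho> (t, z)) + (LINT z:{x<..y}|lborel. \<rho> (t, z))"
    if "z0 < x" "x \<le> y" for t x y
    by (rule set_integral_Ioc_split) (use that \<rho>_int in auto)
  have zB: "z0 < - B" "z0 < - B'" by (auto simp: z0_def)
  have le: "X b \<le> Y b" "X a \<le> Y a" using YX h Xa by auto
  have "(LINT z:{X b<..Y b}|lborel. \<rho> (b, z)) = (LINT z:{X a<..Y a}|lborel. \<rho> (a, z))"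
    using flow_mass_potential[OF X zB(1)] flow_mass_potential[OF Y zB(2)]
      split[OF z0(1) le(1), of b] split[OF z0(1) le(2), of a] by linarith
  moreover have "\<bar>(LINT z:{X a<..Y a}|lborel. \<rho> (a, z)) - 0 * (Y a - X a)\<bar> \<le> c / 6 * (Y a - X a)"
    by (rule set_integral_Ioc_near_const) (use \<rho>_int Xa h d2 in auto)
  then have "(LINT z:{X a<..Y a}|lborel. \<rho> (a, z)) \<le> c / 6 * h" using Xa by simp
  moreover have "\<bar>(LINT z:{X b<..Y b}|lborel. \<rho> (b, z)) - c * (Y b - X b)\<bar> \<le> c / 2 * (Y b - X b)"
    by (rule set_integral_Ioc_near_const) (use \<rho>_int YX h d1 in auto)
  moreover have "c * (Y b - X b) = c / 2 * (Y b - X b) + c / 2 * (Y b - X b)" by simp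
  ultimately have "c / 2 * (Y b - X b) \<le> c / 6 * h" by linarith
  moreover have "c / 2 * (2 / 3 * h) \<le> c / 2 * (Y b - X b)"
    using c YX by (intro mult_left_mono) auto
  moreover have "c / 2 * (2 / 3 * h) = 2 * (c / 6 * h)" by simp
  moreover have "0 < c / 6 * h" using c h by simp
  ultimately show False by linarith
qed

end

subsection \<open>From the weak to the integrated continuity equation\<close>

lemma DERIV_affine_argument:
  fixes B b :: "real \<Rightarrow> real"
  assumes "\<And>x. (B has_real_derivative b x) (at x)"
  shows "((\<lambda>z. B (m * (z - c))) has_real_derivative m * b (m * (z - c))) (at z)"
proof -
  have "((\<lambda>z. m * (z - c)) has_real_derivative m) (at z)" by (auto intro!: derivative_eq_intros)
  from DERIV_chain2[OF assms this] show ?thesis by (simp add: mult.commute)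
qed

text \<open>The kernel is non-negative, is supported in [x, x + 1/m], and has mass one because its
  primitive climbs from 0 to 1. With c = F x this will give convergence to the point value; with c =
  0 it bounds the average by the size of \<open>F\<close> near \<open>x\<close>.\<close>

lemma bump_kernel:
  fixes b B F :: "real \<Rightarrow> real"
  assumes b: "continuous_on UNIV b" "\<And>x. 0 \<le> b x" "\<And>x. x \<notin> {0..1} \<Longrightarrow> b x = 0"
    and B: "\<And>x. (B has_real_derivative b x) (at x)" "\<And>x. x \<le> 0 \<Longrightarrow> B x = 0" "\<And>x. 1 \<le> x \<Longrightarrow> B x = 1"
    and F: "continuous_on UNIV F" and x: "l \<le> x" "x + 1 \<le> u" and m: "1 \<le> m"
    and near: "\<And>z. x \<le> z \<Longrightarrow> z \<le> x + 1 / m \<Longrightarrow> \<bar>F z - c\<bar> \<le> e"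
  shows "\<bar>(LINT z:{l..u}|lborel. F z * (m * b (m * (z - x)))) - c\<bar> \<le> e"
proof -
  define k where "k z = m * b (m * (z - x))" for z
  have k_nn: "0 \<le> k z" for z using b(2) m by (simp add: k_def)
  have dk: "((\<lambda>z. B (m * (z - x))) has_real_derivative k z) (at z)" for z
    unfolding k_def by (rule DERIV_affine_argument[OF B(1)])
  have kc: "continuous_on X k" for X
    unfolding k_def by (intro continuous_intros continuous_on_compose2[OF b(1)]) auto
  have Fc: "continuous_on X F" for X using F continuous_on_subset by blast
  have int: "set_integrable lborel {l..u} f" if "continuous_on UNIV f" for f :: "real \<Rightarrow> real"
    using that continuous_on_subset by (intro borel_integrable_atLeastAtMost') blast
  have "(LINT z|lborel. indicator {l..u} z *\<^sub>R k z) = B (m * (u - x)) - B (m * (l - x))"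
  proof (rule integral_FTC_Icc)
    show "l \<le> u" using x by simp
    show "((\<lambda>z. B (m * (z - x))) has_vector_derivative k z) (at z within {l..u})" for z
      using dk[of z] by (simp add: has_real_derivative_iff_has_vector_derivative has_vector_derivative_at_within)
  qed (rule kc)
  also have "\<dots> = 1"
  proof -
    have "1 * 1 \<le> m * (u - x)" using x m by (intro mult_mono) auto
    moreover have "m * (l - x) \<le> 0" using x m by (simp add: mult_nonneg_nonpos)
    ultimately show ?thesis using B by simp
  qed
  finally have k1: "(LINT z:{l..u}|lborel. k z) = 1" by (simp add: set_lebesgue_integral_def)
  have "(LINT z:{l..u}|lborel. F z * k z) - c = (LINT z:{l..u}|lborel. F z * k z) - (LINT z:{l..u}|lborel. c * k z)"
    using k1 by simp
  also have "\<dots> = (LINT z:{l..u}|lborel. F z * k z - c * k z)"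
    by (rule set_integral_diff(2)[symmetric]; intro int continuous_intros Fc kc)
  also have "\<bar>\<dots>\<bar> \<le> (LINT z:{l..u}|lborel. \<bar>F z * k z - c * k z\<bar>)"
    using set_integral_norm_bound[OF int, of "\<lambda>z. F z * k z - c * k z"] by (simp add: continuous_intros Fc kc)
  also have "\<dots> \<le> (LINT z:{l..u}|lborel. e * k z)"
  proof (rule set_integral_mono)
    show "set_integrable lborel {l..u} (\<lambda>z. \<bar>F z * k z - c * k z\<bar>)" "set_integrable lborel {l..u} (\<lambda>z. e * k z)"
      by (intro int continuous_intros Fc kc)+
    fix z
    show "\<bar>F z * k z - c * k z\<bar> \<le> e * k z"
    proof (cases "m * (z - x) \<in> {0..1}")
      case True
      then have "x \<le> z" "z \<le> x + 1 / m" using m by (auto simp: zero_le_mult_iff field_simps)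
      then have "\<bar>F z - c\<bar> * k z \<le> e * k z" by (intro mult_right_mono near k_nn)
      moreover have "\<bar>F z * k z - c * k z\<bar> = \<bar>F z - c\<bar> * k z"
        using k_nn[of z] by (simp add: left_diff_distrib[symmetric] abs_mult)
      ultimately show ?thesis by simp
    next
      case False
      then show ?thesis using b(3) by (simp add: k_def)
    qed
  qed
  also have "\<dots> = e" using k1 by simp
  finally show ?thesis unfolding k_def .
qed

lemma bump_kernel_tendsto:
  fixes b B F :: "real \<Rightarrow> real"
  assumes b: "continuous_on UNIV b" "\<And>x. 0 \<le> b x" "\<And>x. x \<notin> {0..1} \<Longrightarrow> b x = 0"
    and B: "\<And>x. (B has_real_derivative b x) (at x)" "\<And>x. x \<le> 0 \<Longrightarrow> B x = 0" "\<And>x. 1 \<le> x \<Longrightarrow> B x = 1"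
    and F: "continuous_on UNIV F" and x: "l \<le> x" "x + 1 \<le> u"
  shows "(\<lambda>n. LINT z:{l..u}|lborel. F z * (real (Suc n) * b (real (Suc n) * (z - x)))) \<longlonglongrightarrow> F x"
proof (rule LIMSEQ_I)
  fix e :: real assume "0 < e"
  then obtain d where d: "0 < d" "\<And>z. dist z x < d \<Longrightarrow> dist (F z) (F x) < e / 2"
    using F unfolding continuous_on_iff by (metis UNIV_I half_gt_zero)
  obtain N :: nat where N: "1 / d < real N" using reals_Archimedean2 by blast
  show "\<exists>N. \<forall>n\<ge>N. norm ((LINT z:{l..u}|lborel. F z * (real (Suc n) * b (real (Suc n) * (z - x)))) - F x) < e"
  proof (intro exI allI impI)
    fix n assume n: "n \<ge> N"
    have nd: "1 / real (Suc n) < d"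
    proof -
      have "1 / d < real (Suc n)" using N n by simp
      then show ?thesis using d(1) by (simp add: field_simps del: of_nat_Suc)
    qed
    have "\<bar>(LINT z:{l..u}|lborel. F z * (real (Suc n) * b (real (Suc n) * (z - x)))) - F x\<bar> \<le> e / 2"
    proof (rule bump_kernel[OF b B F x])
      show "\<bar>F z - F x\<bar> \<le> e / 2" if "x \<le> z" "z \<le> x + 1 / real (Suc n)" for z
        using d(2)[of z] that nd by (simp add: dist_real_def del: of_nat_Suc)
    qed simp_all
    then show "norm ((LINT z:{l..u}|lborel. F z * (real (Suc n) * b (real (Suc n) * (z - x)))) - F x) < e"
      using \<open>0 < e\<close> by simp
  qed
qed

text \<open>Test with smooth approximations of the indicator of (x, y]; their derivatives are two
  concentrating bumps. Point values of the flux make sense because density and velocity are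
  continuous in space at each fixed time. Dominated convergence is applied in space on the left and
  in time on the right.\<close>

lemma (in lipschitz_field) weak_form_imp_flux_balance:
  assumes \<rho>_borel [measurable]: "\<rho> \<in> borel_measurable borel"
    and \<rho>_cont: "continuous_on ({a..b} \<times> UNIV) \<rho>"
    and \<rho>_bound: "\<And>z. 0 \<le> \<rho> z" "\<And>z. \<rho> z \<le> C"
    and st: "a \<le> s" "s \<le> t" "t \<le> b" and xy: "x < y"
    and weak: "\<And>\<phi> \<phi>' l u. l \<le> u \<Longrightarrow> (\<And>x. (\<phi> has_real_derivative \<phi>' x) (at x)) \<Longrightarrow> continuous_on UNIV \<phi>' \<Longrightarrow>
      (\<And>x. x \<notin> {l<..<u} \<Longrightarrow> \<phi> x = 0 \<and> \<phi>' x = 0) \<Longrightarrow>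
      (LINT z:{l..u}|lborel. \<rho> (t, z) * \<phi> z) - (LINT z:{l..u}|lborel. \<rho> (s, z) * \<phi> z) =
      (LINT r:{s<..t}|lborel. LINT z:{l..u}|lborel. \<rho> (r, z) * v (r, z) * \<phi>' z)"
  shows "(LINT z:{x<..y}|lborel. \<rho> (t, z)) - (LINT z:{x<..y}|lborel. \<rho> (s, z)) =
      - (LINT r:{s<..t}|lborel. \<rho> (r, y) * v (r, y) - \<rho> (r, x) * v (r, x))"
proof -
  obtain \<beta> B P :: "real \<Rightarrow> real" where sm\<beta>: "smooth_on UNIV \<beta>" and "smooth_on UNIV B" "smooth_on UNIV P" and
    dB: "\<And>x. (B has_real_derivative \<beta> x) (at x)" and "\<And>x. (P has_real_derivative B x) (at x)" and
    \<beta>_nn: "\<And>x. \<beta> x \<ge> 0" and \<beta>_out: "\<And>x. x \<notin> {0..1} \<Longrightarrow> \<beta> x = 0" and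
    B0: "\<And>x. x \<le> 0 \<Longrightarrow> B x = 0" and B1: "\<And>x. 1 \<le> x \<Longrightarrow> B x = 1" and B01: "\<And>x. B x \<in> {0..1}" and
    "\<And>x. \<bar>P x - max 0 x\<bar> \<le> 1" "\<And>x. x \<le> 0 \<Longrightarrow> P x = 0" "\<And>x. 1 \<le> x \<Longrightarrow> P x = P 1 + (x - 1)"
    by (rule smooth_step_exists) (rule that)
  have \<beta>c: "continuous_on UNIV \<beta>" using sm\<beta>[unfolded smooth_on_def, rule_format, of 0] by simp
  have Bc: "continuous_on UNIV B" by (rule DERIV_continuous_on[OF dB])
  have C: "0 \<le> C" using order_trans[OF \<rho>_bound] .
  have \<rho>_abs: "\<bar>\<rho> z\<bar> \<le> C" for z using \<rho>_bound[of z] by simp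
  have \<rho>c: "continuous_on X (\<lambda>z. \<rho> (r, z))" if "r \<in> {a..b}" for r X
    by (rule continuous_on_compose2[OF \<rho>_cont]) (use that in \<open>auto intro!: continuous_intros\<close>)
  have vc: "continuous_on X (\<lambda>z. v (r, z))" for r X
  proof -
    have "(L r)-lipschitz_on X (\<lambda>z. v (r, z))"
      using v_lip L_nonneg by (auto simp: lipschitz_on_def dist_real_def)
    then show ?thesis by (rule lipschitz_on_continuous_on)
  qed
  \<comment> \<open>The window contains the support of every bump at \<open>x\<close> or
    \<open>y\<close>, which has length at most 1, with a margin for vanishing at the ends.\<close>
  let ?l = "x - 1" and ?u = "y + 2"
  define m where "m n = real (Suc n)" for n
  have m1: "1 \<le> m n" for n by (simp add: m_def)
  define \<phi> where "\<phi> n z = B (m n * (z - x)) - B (m n * (z - y))" for n z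
  define \<phi>' where "\<phi>' n z = m n * \<beta> (m n * (z - x)) - m n * \<beta> (m n * (z - y))" for n z
  have arg: "1 < m n * (z - c)" if "c + 1 < z" for n z c
  proof -
    have "1 < 1 * (z - c)" using that by simp
    also have "\<dots> \<le> m n * (z - c)" by (rule mult_right_mono[OF m1]) (use that in simp)
    finally show ?thesis .
  qed
  have arg': "m n * (z - c) < 0" if "z < c" for n z c
    using m1[of n] that by (simp add: mult_pos_neg)
  have eq: "(LINT z:{?l..?u}|lborel. \<rho> (t, z) * \<phi> n z) - (LINT z:{?l..?u}|lborel. \<rho> (s, z) * \<phi> n z) =
      (LINT r:{s<..t}|lborel. LINT z:{?l..?u}|lborel. \<rho> (r, z) * v (r, z) * \<phi>' n z)" for n
  proof (rule weak)
    show "?l \<le> ?u" using xy by simp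
    show "(\<phi> n has_real_derivative \<phi>' n z) (at z)" for z
      unfolding \<phi>_def \<phi>'_def by (intro DERIV_diff DERIV_affine_argument[OF dB])
    show "continuous_on UNIV (\<phi>' n)"
      unfolding \<phi>'_def by (intro continuous_intros continuous_on_compose2[OF \<beta>c]) auto
    fix z assume z: "z \<notin> {?l<..<?u}"
    show "\<phi> n z = 0 \<and> \<phi>' n z = 0"
    proof (cases "z < x")
      case True
      then show ?thesis
        using arg'[of z x n] arg'[of z y n] xy by (simp add: \<phi>_def \<phi>'_def B0 \<beta>_out)
    next
      case False
      then have "y + 1 < z" "x + 1 < z" using z xy by auto
      then show ?thesis
        using arg[of x z n] arg[of y z n] by (simp add: \<phi>_def \<phi>'_def B1 \<beta>_out)
    qed
  qed
  have lhs: "(\<lambda>n. LINT z:{?l..?u}|lborel. \<rho> (r, z) * \<phi> n z) \<longlonglongrightarrow> (LINT z:{x<..y}|lborel. \<rho> (r, z))" for r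
    unfolding set_lebesgue_integral_def
  proof (rule integral_dominated_convergence[where w = "\<lambda>z. indicator {?l..?u} z * C"])
    have "continuous_on UNIV (\<phi> n)" for n
      unfolding \<phi>_def by (intro continuous_intros continuous_on_compose2[OF Bc]) auto
    then have [measurable]: "\<phi> n \<in> borel_measurable borel" for n by (rule borel_measurable_continuous_onI)
    show "(\<lambda>z. indicator {?l..?u} z *\<^sub>R (\<rho> (r, z) * \<phi> n z)) \<in> borel_measurable lborel" for n
      by measurable
    show "integrable lborel (\<lambda>z. indicator {?l..?u} z * C)"
      by (intro integrable_mult_left integrable_real_indicator) (use xy in auto)
    have "\<bar>\<phi> n z\<bar> \<le> 1" for n z
      using B01[of "m n * (z - x)"] B01[of "m n * (z - y)"] by (auto simp: \<phi>_def)
    then have "\<bar>\<rho> (r, z) * \<phi> n z\<bar> \<le> C * 1" for n z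
      unfolding abs_mult by (intro mult_mono \<rho>_abs C) auto
    then show "AE z in lborel. norm (indicator {?l..?u} z *\<^sub>R (\<rho> (r, z) * \<phi> n z)) \<le> indicator {?l..?u} z * C" for n
      by (intro AE_I2) (auto split: split_indicator)
    have limB: "(\<lambda>n. B (m n * (z - c))) \<longlonglongrightarrow> (if c < z then 1 else 0)" for z c
      unfolding m_def by (rule step_tendsto[OF B0 B1])
    have l: "(\<lambda>n. indicator {?l..?u} z *\<^sub>R (\<rho> (r, z) * \<phi> n z)) \<longlonglongrightarrow>
      indicator {?l..?u} z *\<^sub>R (\<rho> (r, z) * ((if x < z then 1 else 0) - (if y < z then 1 else 0)))" for z
      unfolding \<phi>_def by (intro tendsto_intros limB)
    have e: "indicator {?l..?u} z *\<^sub>R (\<rho> (r, z) * ((if x < z then 1 else 0) - (if y < z then 1 else 0))) =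
      indicator {x<..y} z *\<^sub>R \<rho> (r, z)" for z
      using xy by (auto split: split_indicator)
    show "AE z in lborel. (\<lambda>n. indicator {?l..?u} z *\<^sub>R (\<rho> (r, z) * \<phi> n z)) \<longlonglongrightarrow> indicator {x<..y} z *\<^sub>R \<rho> (r, z)"
      by (rule AE_I2) (rule l[unfolded e])
  qed measurable
  let ?K = "\<bar>x\<bar> + \<bar>y\<bar> + 1"
  \<comment> \<open>The time majorant is uniform in \<open>n\<close>: a kernel average is compared
    with the reference value 0, and \<open>?K\<close> bounds all positions in the support of the
    bumps.\<close>
  have kb: "\<bar>LINT z:{?l..?u}|lborel. \<rho> (r, z) * v (r, z) * (m n * \<beta> (m n * (z - c)))\<bar> \<le> C * (g r + L r * ?K)"
    if r: "r \<in> {s<..t}" and c: "c = x \<or> c = y" for r n c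
  proof -
    have "\<bar>(LINT z:{?l..?u}|lborel. \<rho> (r, z) * v (r, z) * (m n * \<beta> (m n * (z - c)))) - 0\<bar> \<le> C * (g r + L r * ?K)"
    proof (rule bump_kernel[OF \<beta>c \<beta>_nn \<beta>_out dB B0 B1 _ _ _ m1])
      show "continuous_on UNIV (\<lambda>z. \<rho> (r, z) * v (r, z))"
        using r st by (intro continuous_intros \<rho>c vc) auto
      show "?l \<le> c" "c + 1 \<le> ?u" using c xy by auto
      fix z assume z: "c \<le> z" "z \<le> c + 1 / m n"
      have "1 / m n \<le> 1" using m1[of n] by (simp add: divide_le_eq)
      then have "\<bar>z\<bar> \<le> ?K" using z c by auto
      then show "\<bar>\<rho> (r, z) * v (r, z) - 0\<bar> \<le> C * (g r + L r * ?K)"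
        unfolding diff_zero abs_mult by (intro mult_mono \<rho>_abs C v_bound) auto
    qed
    then show ?thesis by simp
  qed
  have split: "(LINT z:{?l..?u}|lborel. \<rho> (r, z) * v (r, z) * \<phi>' n z) =
      (LINT z:{?l..?u}|lborel. \<rho> (r, z) * v (r, z) * (m n * \<beta> (m n * (z - x)))) -
      (LINT z:{?l..?u}|lborel. \<rho> (r, z) * v (r, z) * (m n * \<beta> (m n * (z - y))))"
    if r: "r \<in> {s<..t}" for r n
  proof -
    have "set_integrable lborel {?l..?u} (\<lambda>z. \<rho> (r, z) * v (r, z) * (m n * \<beta> (m n * (z - c))))" for c
      using r st
      by (intro borel_integrable_atLeastAtMost' continuous_intros \<rho>c vc continuous_on_compose2[OF \<beta>c]) auto
    from set_integral_diff(2)[OF this this, of x y] show ?thesis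
      by (simp add: \<phi>'_def right_diff_distrib)
  qed
  let ?J = "\<lambda>n r. indicator {s<..t} r *\<^sub>R (LINT z:{?l..?u}|lborel. \<rho> (r, z) * v (r, z) * \<phi>' n z)"
  have rhs: "(\<lambda>n. LINT r:{s<..t}|lborel. LINT z:{?l..?u}|lborel. \<rho> (r, z) * v (r, z) * \<phi>' n z) \<longlonglongrightarrow>
      (LINT r:{s<..t}|lborel. \<rho> (r, x) * v (r, x) - \<rho> (r, y) * v (r, y))"
    unfolding set_lebesgue_integral_def[of _ "{s<..t}"]
  proof (rule integral_dominated_convergence[where w = "\<lambda>r. 2 * (C * (g r + L r * ?K))"])
    have "continuous_on UNIV (\<phi>' n)" for n
      unfolding \<phi>'_def by (intro continuous_intros continuous_on_compose2[OF \<beta>c]) auto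
    then have [measurable]: "\<phi>' n \<in> borel_measurable borel" for n by (rule borel_measurable_continuous_onI)
    show "(\<lambda>r. ?J n r) \<in> borel_measurable lborel" for n
      unfolding set_lebesgue_integral_def by measurable
    show "(\<lambda>r. indicator {s<..t} r *\<^sub>R (\<rho> (r, x) * v (r, x) - \<rho> (r, y) * v (r, y))) \<in> borel_measurable lborel"
      by measurable
    show "integrable lborel (\<lambda>r. 2 * (C * (g r + L r * ?K)))"
      by (intro integrable_mult_right bound_int)
    show "AE r in lborel. norm (?J n r) \<le> 2 * (C * (g r + L r * ?K))" for n
    proof (rule AE_I2)
      fix r
      have nn: "0 \<le> C * (g r + L r * ?K)" using v_bound[of 0 ?K r] C by (intro mult_nonneg_nonneg) auto
      show "norm (?J n r) \<le> 2 * (C * (g r + L r * ?K))"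
      proof (cases "r \<in> {s<..t}")
        case True
        then show ?thesis using kb[OF True, of x n] kb[OF True, of y n] split[OF True, of n] by simp
      qed (use nn in simp)
    qed
    show "AE r in lborel. (\<lambda>n. ?J n r) \<longlonglongrightarrow>
      indicator {s<..t} r *\<^sub>R (\<rho> (r, x) * v (r, x) - \<rho> (r, y) * v (r, y))"
    proof (rule AE_I2)
      fix r
      show "(\<lambda>n. ?J n r) \<longlonglongrightarrow>
        indicator {s<..t} r *\<^sub>R (\<rho> (r, x) * v (r, x) - \<rho> (r, y) * v (r, y))"
      proof (cases "r \<in> {s<..t}")
        case True
        have F: "continuous_on UNIV (\<lambda>z. \<rho> (r, z) * v (r, z))"
          using True st by (intro continuous_intros \<rho>c vc) auto
        have "(\<lambda>n. LINT z:{?l..?u}|lborel. \<rho> (r, z) * v (r, z) * (m n * \<beta> (m n * (z - c)))) \<longlonglongrightarrow> \<rho> (r, c) * v (r, c)"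
          if "c = x \<or> c = y" for c
          unfolding m_def by (rule bump_kernel_tendsto[OF \<beta>c \<beta>_nn \<beta>_out dB B0 B1 F]) (use that xy in auto)
        then show ?thesis
          unfolding split[OF True] by (intro tendsto_intros) auto
      qed simp
    qed
  qed
  have "(LINT z:{x<..y}|lborel. \<rho> (t, z)) - (LINT z:{x<..y}|lborel. \<rho> (s, z)) =
    (LINT r:{s<..t}|lborel. \<rho> (r, x) * v (r, x) - \<rho> (r, y) * v (r, y))"
    using LIMSEQ_unique[OF tendsto_diff[OF lhs lhs, of t s] rhs[folded eq]] .
  also have "\<dots> = - (LINT r:{s<..t}|lborel. \<rho> (r, y) * v (r, y) - \<rho> (r, x) * v (r, x))"
    unfolding set_lebesgue_integral_def Bochner_Integration.integral_minus[symmetric]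
    by (rule Bochner_Integration.integral_cong) (auto simp: algebra_simps)
  finally show ?thesis .
qed

subsection \<open>The rarefaction wave\<close>

lemma deriv_pressure: "0 < s \<Longrightarrow> deriv (pressure \<gamma>) s = \<gamma> * s powr (\<gamma> - 1)"
  unfolding pressure_def[abs_def] by (intro DERIV_imp_deriv has_real_derivative_powr)

lemma lambda2_eq:
  assumes "0 < \<rho>" "0 < \<gamma>"
  shows "lambda2 \<gamma> \<rho> u = u + sqrt \<gamma> * \<rho> powr ((\<gamma> - 1) / 2)"
  using assms by (simp add: lambda2_def deriv_pressure real_sqrt_mult powr_half_sqrt[symmetric] powr_powr)

text \<open>The integrand is the square root of \<gamma> times s to the power \<theta> - 1 with
  \<theta> = (\<gamma> - 1)/2, integrable at 0 since \<theta> > 0.\<close>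

lemma Sigma2_eq:
  assumes \<rho>: "0 < \<rho>" and \<gamma>: "1 < \<gamma>"
  shows "Sigma2 \<gamma> \<rho> u = u - sqrt \<gamma> * \<rho> powr ((\<gamma> - 1) / 2) / ((\<gamma> - 1) / 2)"
proof -
  let ?\<theta> = "(\<gamma> - 1) / 2"
  let ?f = "\<lambda>s. sqrt \<gamma> * s powr (?\<theta> - 1)"
  have "(?f has_integral sqrt \<gamma> * (\<rho> powr (?\<theta> - 1 + 1) / (?\<theta> - 1 + 1))) {0..\<rho>}"
    using \<rho> \<gamma> by (intro has_integral_mult_right has_integral_powr_from_0) auto
  then have i: "(?f has_integral sqrt \<gamma> * \<rho> powr ?\<theta> / ?\<theta>) {0<..<\<rho>}"
    by (simp add: has_integral_Icc_iff_Ioo mult.assoc)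
  have "(LINT s:{0<..<\<rho>}|lebesgue. sqrt (deriv (pressure \<gamma>) s) / s) = (LINT s:{0<..<\<rho>}|lebesgue. ?f s)"
  proof (rule set_lebesgue_integral_cong, goal_cases)
    case 2
    have "sqrt (\<gamma> * s powr (\<gamma> - 1)) / s = sqrt \<gamma> * s powr (?\<theta> - 1)" if "0 < s" for s
    proof -
      have "sqrt (s powr (\<gamma> - 1)) = s powr ?\<theta>"
        using that by (simp add: powr_half_sqrt[symmetric] powr_powr)
      moreover have "s powr (?\<theta> - 1) = s powr ?\<theta> / s" using that by (simp only: powr_diff) simp
      ultimately show ?thesis by (simp only: real_sqrt_mult) simp
    qed
    then show ?case by (auto simp: deriv_pressure)
  qed simp
  also have "\<dots> = integral {0<..<\<rho>} ?f"
  proof (rule set_lebesgue_integral_eq_integral(2))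
    show "set_integrable lebesgue {0<..<\<rho>} ?f"
      using i \<gamma> by (intro nonnegative_absolutely_integrable_1) auto
  qed
  also have "\<dots> = sqrt \<gamma> * \<rho> powr ?\<theta> / ?\<theta>" using i by (rule integral_unique)
  finally show ?thesis by (simp only: Sigma2_def)
qed

text \<open>The weak mass equation is written for the difference of the density and the wave. To
  isolate the density, the wave's own continuity equation has to be derived from the defining
  relations collected here.\<close>

locale rarefaction_wave =
  fixes \<gamma> S :: real and w rbar ubar :: "real \<times> real \<Rightarrow> real"
  assumes gamma: "1 < \<gamma>"
    and w_smooth: "smooth_on ({0..} \<times> UNIV) w"
    and burgers: "z \<in> half_plane \<Longrightarrow> dt w z + w z * dx w z = 0"
    and rbar_pos: "0 \<le> t \<Longrightarrow> 0 < rbar (t, x)"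
    and lambda: "0 \<le> t \<Longrightarrow> lambda2 \<gamma> (rbar (t, x)) (ubar (t, x)) = w (1 + t, x)"
    and Sigma: "0 \<le> t \<Longrightarrow> Sigma2 \<gamma> (rbar (t, x)) (ubar (t, x)) = S"
begin

text \<open>With sound speed c, the two defining relations read u + c = W and u - c/\<theta> = S.
  Hence c = \<kappa> (W - S) and u = S + c/\<theta>; \<open>R\<close> and \<open>V\<close> recover
  density and velocity from W, and \<open>R'\<close> is the derivative of the power
  \<open>R\<close>. The time shift in \<open>W\<close> makes time 0 an interior time of
  \<open>w\<close>.\<close>

definition \<theta> where "\<theta> = (\<gamma> - 1) / 2"
definition \<kappa> where "\<kappa> = \<theta> / (\<theta> + 1)"
definition R where "R y = (\<kappa> * (y - S) / sqrt \<gamma>) powr (1 / \<theta>)"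
definition V where "V y = S + \<kappa> * (y - S) / \<theta>"
definition R' where "R' y = R y / (\<theta> * (y - S))"
definition W where "W z = w (1 + fst z, snd z)"

lemma \<theta>_pos: "0 < \<theta>" using gamma by (simp add: \<theta>_def)
lemma \<kappa>_pos: "0 < \<kappa>" using \<theta>_pos by (simp add: \<kappa>_def)

lemma wave_formula:
  assumes "0 \<le> t"
  shows "S < W (t, x)" "rbar (t, x) = R (W (t, x))" "ubar (t, x) = V (W (t, x))"
proof -
  define c where "c = sqrt \<gamma> * rbar (t, x) powr \<theta>"
  have c: "0 < c" using rbar_pos[OF assms, of x] gamma by (simp add: c_def)
  have "ubar (t, x) + c = W (t, x)" "ubar (t, x) - c / \<theta> = S"
    using lambda[OF assms, of x] Sigma[OF assms, of x] rbar_pos[OF assms, of x] gamma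
    by (simp_all add: lambda2_eq Sigma2_eq c_def \<theta>_def W_def)
  then have u: "ubar (t, x) = S + c / \<theta>" and "W (t, x) - S = c + c / \<theta>"
    by linarith+
  moreover have "c + c / \<theta> = c * ((\<theta> + 1) / \<theta>)"
    using \<theta>_pos by (simp add: field_simps)
  ultimately have ck: "c = \<kappa> * (W (t, x) - S)"
    using \<theta>_pos by (simp add: \<kappa>_def)
  with c \<kappa>_pos show "S < W (t, x)" by (simp add: zero_less_mult_iff)
  show "ubar (t, x) = V (W (t, x))" using u ck by (simp add: V_def)
  have "c / sqrt \<gamma> = rbar (t, x) powr \<theta>" using gamma by (simp add: c_def)
  then have "(c / sqrt \<gamma>) powr (1 / \<theta>) = rbar (t, x)"
    using rbar_pos[OF assms, of x] \<theta>_pos by (simp add: powr_powr)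
  then show "rbar (t, x) = R (W (t, x))" using ck by (simp add: R_def)
qed

lemma R_deriv:
  assumes "S < y"
  shows "(R has_real_derivative R' y) (at y)"
proof -
  have y: "0 < \<kappa> * (y - S) / sqrt \<gamma>" using assms \<kappa>_pos gamma by simp
  have "((\<lambda>y. \<kappa> * (y - S) / sqrt \<gamma>) has_real_derivative \<kappa> / sqrt \<gamma>) (at y)"
    by (rule DERIV_cdivide) (auto intro!: derivative_eq_intros)
  from DERIV_chain2[OF has_real_derivative_powr[OF y] this]
  have "(R has_real_derivative 1 / \<theta> * (\<kappa> * (y - S) / sqrt \<gamma>) powr (1 / \<theta> - 1) * (\<kappa> / sqrt \<gamma>)) (at y)"
    unfolding R_def[abs_def] .
  also have "1 / \<theta> * (\<kappa> * (y - S) / sqrt \<gamma>) powr (1 / \<theta> - 1) * (\<kappa> / sqrt \<gamma>) =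
      R y / \<theta> * ((\<kappa> / sqrt \<gamma>) / (\<kappa> * (y - S) / sqrt \<gamma>))"
  proof -
    have "z powr (p - 1) = z powr p / z" if "0 < z" for z p :: real
      using that by (simp add: powr_diff)
    moreover have "1 / t * (P / z) * k = P / t * (k / z)" for t P z k :: real by simp
    ultimately show ?thesis by (simp only: R_def y)
  qed
  also have "(\<kappa> / sqrt \<gamma>) / (\<kappa> * (y - S) / sqrt \<gamma>) = 1 / (y - S)"
    using \<kappa>_pos assms gamma by simp
  also have "R y / \<theta> * (1 / (y - S)) = R' y" by (simp add: R'_def)
  finally show ?thesis .
qed

text \<open>The momentum changes with the density at the rate u + c, which is the characteristic
  speed \<open>y\<close>. By Burgers' equation this yields the continuity equation, whose left side
  becomes R'(W) (W_t + W W_x).\<close>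

lemma RV_deriv:
  assumes "S < y"
  shows "((\<lambda>y. R y * V y) has_real_derivative R' y * y) (at y)"
proof -
  have "((\<lambda>y. R y * V y) has_real_derivative R' y * V y + \<kappa> / \<theta> * R y) (at y)"
    unfolding V_def using \<theta>_pos by (auto intro!: derivative_eq_intros R_deriv assms)
  moreover have "R' y * V y + \<kappa> / \<theta> * R y = R' y * (V y + \<kappa> * (y - S))"
    using assms \<theta>_pos by (simp add: R'_def field_simps)
  moreover have "V y + \<kappa> * (y - S) = y"
  proof -
    have "\<kappa> / \<theta> = 1 / (\<theta> + 1)" using \<theta>_pos by (simp add: \<kappa>_def)
    then have "\<kappa> / \<theta> + \<kappa> = 1"
      using \<theta>_pos by (simp add: \<kappa>_def add_divide_distrib[symmetric] add.commute)
    moreover have "V y + \<kappa> * (y - S) = S + (\<kappa> / \<theta> + \<kappa>) * (y - S)" by (simp add: V_def algebra_simps)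
    ultimately show ?thesis by simp
  qed
  ultimately show ?thesis by simp
qed

lemma W_derivs:
  obtains Wt Wx where
    "continuous_on ({0..} \<times> UNIV) Wt" "continuous_on ({0..} \<times> UNIV) Wx"
    "\<And>t x. 0 \<le> t \<Longrightarrow> ((\<lambda>t. W (t, x)) has_real_derivative Wt (t, x)) (at t)"
    "\<And>t x. 0 \<le> t \<Longrightarrow> ((\<lambda>x. W (t, x)) has_real_derivative Wx (t, x)) (at x)"
    "\<And>t x. 0 \<le> t \<Longrightarrow> Wt (t, x) + W (t, x) * Wx (t, x) = 0"
proof -
  have "Ck_on (Suc 0) ({0..} \<times> UNIV) w" using w_smooth unfolding smooth_on_def by blast
  then obtain D where D: "\<And>z. z \<in> {0..} \<times> UNIV \<Longrightarrow> (w has_derivative D z) (at z within {0..} \<times> UNIV)"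
    and Dc: "\<And>v. continuous_on ({0..} \<times> UNIV) (\<lambda>z. D z v)" by auto
  \<comment> \<open>At times 1 + t > 0 the derivative within the closed half-plane is two-sided, so
    it agrees with the derivatives occurring in Burgers' equation.\<close>
  have D1: "(w has_derivative D (1 + t, x)) (at (1 + t, x))" if "0 \<le> t" for t x
  proof -
    have "at (1 + t, x) within {0..} \<times> UNIV = at (1 + t, x)"
      by (rule at_within_open_subset[of _ half_plane]) (use that in \<open>auto intro: open_Times\<close>)
    then show ?thesis using D[of "(1 + t, x)"] that by simp
  qed
  have Dlin: "D (1 + t, x) (h *\<^sub>R e) = h * D (1 + t, x) e" if "0 \<le> t" for t x h e
    using linear_scale[OF bounded_linear.linear[OF has_derivative_bounded_linear[OF D1[OF that]]]] by simp
  show ?thesis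
  proof (rule that[of "\<lambda>z. D (1 + fst z, snd z) (1, 0)" "\<lambda>z. D (1 + fst z, snd z) (0, 1)"])
    show "continuous_on ({0..} \<times> UNIV) (\<lambda>z. D (1 + fst z, snd z) (1, 0))"
      "continuous_on ({0..} \<times> UNIV) (\<lambda>z. D (1 + fst z, snd z) (0, 1))"
      by (rule continuous_on_compose2[OF Dc]; auto intro!: continuous_intros)+
    fix t x :: real assume t: "0 \<le> t"
    have *: "((\<lambda>t. w (1 + t, x)) has_derivative (\<lambda>h. D (1 + t, x) (h, 0))) (at t)"
    proof (rule has_derivative_compose[where g = w])
      show "((\<lambda>t. (1 + t, x)) has_derivative (\<lambda>h. (h, 0))) (at t)"
        by (auto intro!: derivative_eq_intros)
    qed (rule D1[OF t])
    show "((\<lambda>t. W (t, x)) has_real_derivative D (1 + fst (t, x), snd (t, x)) (1, 0)) (at t)"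
    proof -
      have "(\<lambda>h. D (1 + t, x) (h, 0)) = (\<lambda>h. D (1 + t, x) (1, 0) * h)"
      proof
        show "D (1 + t, x) (h, 0) = D (1 + t, x) (1, 0) * h" for h
          using Dlin[OF t, of x h "(1, 0)"] by simp
      qed
      with * show ?thesis by (simp only: W_def has_field_derivative_def fst_conv snd_conv)
    qed
    have *: "((\<lambda>x. w (1 + t, x)) has_derivative (\<lambda>h. D (1 + t, x) (0, h))) (at x)"
    proof (rule has_derivative_compose[where g = w])
      show "((\<lambda>x. (1 + t, x)) has_derivative (\<lambda>h. (0, h))) (at x)"
        by (auto intro!: derivative_eq_intros)
    qed (rule D1[OF t])
    show "((\<lambda>x. W (t, x)) has_real_derivative D (1 + fst (t, x), snd (t, x)) (0, 1)) (at x)"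
    proof -
      have "(\<lambda>h. D (1 + t, x) (0, h)) = (\<lambda>h. D (1 + t, x) (0, 1) * h)"
      proof
        show "D (1 + t, x) (0, h) = D (1 + t, x) (0, 1) * h" for h
          using Dlin[OF t, of x h "(0, 1)"] by simp
      qed
      with * show ?thesis by (simp only: W_def has_field_derivative_def fst_conv snd_conv)
    qed
    show "D (1 + fst (t, x), snd (t, x)) (1, 0) + W (t, x) * D (1 + fst (t, x), snd (t, x)) (0, 1) = 0"
      using burgers[of "(1 + t, x)"] t frechet_derivative_at[OF D1[OF t], of x]
      by (simp add: dir_deriv_def W_def)
  qed
qed

lemma W_cont: "continuous_on ({0..} \<times> UNIV) W"
proof -
  have "Ck_on 0 ({0..} \<times> UNIV) w" using w_smooth unfolding smooth_on_def by blast
  then have "continuous_on ({0..} \<times> UNIV) w" by simp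
  then show ?thesis
    unfolding W_def by (rule continuous_on_compose2) (auto intro!: continuous_intros)
qed

lemma R_cont: "continuous_on {S<..} R"
  by (rule DERIV_continuous_on[where D = R']) (auto intro: R_deriv has_field_derivative_at_within)

lemma R'_cont: "continuous_on {S<..} R'"
  unfolding R'_def using \<theta>_pos by (intro continuous_intros R_cont) auto

lemma compose_W_cont:
  assumes "continuous_on {S<..} F"
  shows "continuous_on ({0..} \<times> UNIV) (\<lambda>z. F (W z))"
  by (rule continuous_on_compose2[OF assms W_cont]) (use wave_formula(1) in auto)

lemma rbar_cont: "continuous_on ({0..} \<times> UNIV) rbar"
  by (rule continuous_on_eq[OF compose_W_cont[OF R_cont]]) (auto simp: wave_formula(2))

lemma ubar_cont: "continuous_on ({0..} \<times> UNIV) ubar"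
proof -
  have "continuous_on {S<..} V" unfolding V_def by (intro continuous_intros) (use \<theta>_pos in auto)
  then show ?thesis
    by (rule continuous_on_eq[OF compose_W_cont]) (auto simp: wave_formula(3))
qed

text \<open>Differentiate the weighted mass under the integral sign, turn the time derivative into a
  space derivative by Burgers' equation, integrate by parts with vanishing boundary values, and
  integrate in time.\<close>

lemma mass_balance:
  fixes \<phi> \<phi>' :: "real \<Rightarrow> real"
  assumes st: "0 \<le> s" "s \<le> t" and AB: "A \<le> B" and \<phi>: "\<And>x. (\<phi> has_real_derivative \<phi>' x) (at x)"
    and \<phi>'_cont: "continuous_on UNIV \<phi>'" and ends: "\<phi> A = 0" "\<phi> B = 0"
  shows "(LINT x:{A..B}|lborel. rbar (t, x) * \<phi> x) - (LINT x:{A..B}|lborel. rbar (s, x) * \<phi> x) =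
    (LINT r:{s..t}|lborel. LINT x:{A..B}|lborel. rbar (r, x) * ubar (r, x) * \<phi>' x)" (is ?balance)
    and "set_integrable lborel {s..t} (\<lambda>r. LINT x:{A..B}|lborel. rbar (r, x) * ubar (r, x) * \<phi>' x)" (is ?int)
proof -
  obtain Wt Wx where Wt: "continuous_on ({0..} \<times> UNIV) Wt" and Wx: "continuous_on ({0..} \<times> UNIV) Wx"
    and dWt: "\<And>t x. 0 \<le> t \<Longrightarrow> ((\<lambda>t. W (t, x)) has_real_derivative Wt (t, x)) (at t)"
    and dWx: "\<And>t x. 0 \<le> t \<Longrightarrow> ((\<lambda>x. W (t, x)) has_real_derivative Wx (t, x)) (at x)"
    and eqn: "\<And>t x. 0 \<le> t \<Longrightarrow> Wt (t, x) + W (t, x) * Wx (t, x) = 0"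
    by (rule W_derivs) (rule that)
  have \<phi>_cont: "continuous_on X \<phi>" for X
    using \<phi> by (intro DERIV_continuous_on[of X \<phi> \<phi>']) (auto intro: has_field_derivative_at_within)
  have \<phi>'c: "continuous_on X \<phi>'" for X using \<phi>'_cont continuous_on_subset by blast
  have slice: "continuous_on X (\<lambda>x. F (r, x))" if "continuous_on ({0..} \<times> UNIV) F" "0 \<le> r" for F :: "real \<times> real \<Rightarrow> real" and r X
    by (rule continuous_on_compose2[OF that(1)]) (use that in \<open>auto intro!: continuous_intros\<close>)
  have rW: "continuous_on ({0..} \<times> UNIV) (\<lambda>z. R' (W z))" by (rule compose_W_cont[OF R'_cont])
  let ?I = "\<lambda>r. integral {A..B} (\<lambda>x. rbar (r, x) * \<phi> x)"
  let ?J = "\<lambda>r. integral {A..B} (\<lambda>x. rbar (r, x) * ubar (r, x) * \<phi>' x)"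
  have ibp: "integral {A..B} (\<lambda>x. R' (W (r, x)) * Wt (r, x) * \<phi> x) = ?J r" if r: "0 \<le> r" for r
  proof -
    have "((\<lambda>x. R (W (r, x)) * V (W (r, x)) * \<phi> x) has_real_derivative
        R' (W (r, x)) * W (r, x) * Wx (r, x) * \<phi> x + R (W (r, x)) * V (W (r, x)) * \<phi>' x) (at x)" for x
    proof -
      have "((\<lambda>x. R (W (r, x)) * V (W (r, x))) has_real_derivative R' (W (r, x)) * W (r, x) * Wx (r, x)) (at x)"
        by (rule DERIV_chain2[OF RV_deriv[OF wave_formula(1)[OF r]] dWx[OF r]])
      from DERIV_mult[OF this \<phi>[of x]] show ?thesis by (simp add: algebra_simps)
    qed
    then have "((\<lambda>x. R' (W (r, x)) * W (r, x) * Wx (r, x) * \<phi> x + R (W (r, x)) * V (W (r, x)) * \<phi>' x) has_integral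
        (R (W (r, B)) * V (W (r, B)) * \<phi> B - R (W (r, A)) * V (W (r, A)) * \<phi> A)) {A..B}"
      using AB by (intro fundamental_theorem_of_calculus)
        (auto simp: has_real_derivative_iff_has_vector_derivative[symmetric] intro: has_field_derivative_at_within)
    then have "((\<lambda>x. rbar (r, x) * ubar (r, x) * \<phi>' x - R' (W (r, x)) * Wt (r, x) * \<phi> x) has_integral 0) {A..B}"
    proof (rule has_integral_eq_rhs[OF has_integral_eq, rotated])
      fix x assume "x \<in> {A..B}"
      have "W (r, x) * Wx (r, x) = - Wt (r, x)" using eqn[OF r, of x] by linarith
      then have "R' (W (r, x)) * W (r, x) * Wx (r, x) * \<phi> x = - (R' (W (r, x)) * Wt (r, x) * \<phi> x)"
        by (metis (no_types, lifting) mult.assoc mult_minus_left mult_minus_right)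
      then show "R' (W (r, x)) * W (r, x) * Wx (r, x) * \<phi> x + R (W (r, x)) * V (W (r, x)) * \<phi>' x =
        rbar (r, x) * ubar (r, x) * \<phi>' x - R' (W (r, x)) * Wt (r, x) * \<phi> x"
        by (simp add: wave_formula[OF r])
    qed (simp add: ends)
    then have "integral {A..B} (\<lambda>x. rbar (r, x) * ubar (r, x) * \<phi>' x - R' (W (r, x)) * Wt (r, x) * \<phi> x) = 0"
      by (rule integral_unique)
    moreover have "(\<lambda>x. rbar (r, x) * ubar (r, x) * \<phi>' x) integrable_on {A..B}"
      by (intro integrable_continuous_interval continuous_intros slice rbar_cont ubar_cont \<phi>'c r)
    moreover have "(\<lambda>x. R' (W (r, x)) * Wt (r, x) * \<phi> x) integrable_on {A..B}"
      by (intro integrable_continuous_interval continuous_intros slice[OF rW] slice[OF Wt] \<phi>_cont r)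
    ultimately show ?thesis by (simp add: integral_diff)
  qed
  \<comment> \<open>The wave is described by \<open>R\<close> and \<open>W\<close> for t >= 0 only,
    so at time 0 the derivative is one-sided.\<close>
  have dI: "(?I has_real_derivative ?J r) (at r within {0..})" if r: "0 \<le> r" for r
  proof -
    have "((\<lambda>r. integral (cbox A B) (\<lambda>x. rbar (r, x) * \<phi> x)) has_field_derivative
      integral (cbox A B) (\<lambda>x. R' (W (r, x)) * Wt (r, x) * \<phi> x)) (at r within {0..})"
    proof (rule leibniz_rule_field_derivative)
      fix t x :: real assume t: "t \<in> {0..}"
      have "((\<lambda>t. R (W (t, x)) * \<phi> x) has_real_derivative R' (W (t, x)) * Wt (t, x) * \<phi> x) (at t)"
        using t by (intro DERIV_cmult_right DERIV_chain2[OF R_deriv dWt] wave_formula) auto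
      then have "((\<lambda>t. R (W (t, x)) * \<phi> x) has_real_derivative R' (W (t, x)) * Wt (t, x) * \<phi> x) (at t within {0..})"
        by (rule has_field_derivative_at_within)
      then show "((\<lambda>t. rbar (t, x) * \<phi> x) has_real_derivative R' (W (t, x)) * Wt (t, x) * \<phi> x) (at t within {0..})"
        by (rule has_field_derivative_transform_within[OF _ zero_less_one t]) (simp add: wave_formula)
    next
      fix t :: real assume "t \<in> {0..}"
      then show "(\<lambda>x. rbar (t, x) * \<phi> x) integrable_on cbox A B"
        unfolding cbox_interval by (intro integrable_continuous_interval continuous_intros slice rbar_cont \<phi>_cont) simp
    next
      have "continuous_on ({0..} \<times> cbox A B) (\<lambda>z. R' (W z) * Wt z * \<phi> (snd z))"
        by (intro continuous_intros continuous_on_subset[OF rW] continuous_on_subset[OF Wt] continuous_on_compose2[OF \<phi>_cont[of UNIV]]) auto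
      then show "continuous_on ({0..} \<times> cbox A B) (\<lambda>(t, x). R' (W (t, x)) * Wt (t, x) * \<phi> x)"
        by (simp add: case_prod_beta)
    qed (use r in auto)
    then show ?thesis using ibp[OF r] by simp
  qed
  have J_cont: "continuous_on {s..t} ?J"
  proof -
    have "continuous_on ({s..t} \<times> cbox A B) (\<lambda>z. rbar z * ubar z * \<phi>' (snd z))"
      using st by (intro continuous_intros continuous_on_subset[OF rbar_cont] continuous_on_subset[OF ubar_cont] continuous_on_compose2[OF \<phi>'_cont]) auto
    then have "continuous_on {s..t} (\<lambda>r. integral (cbox A B) (\<lambda>x. rbar (r, x) * ubar (r, x) * \<phi>' x))"
      by (intro integral_continuous_on_param) (simp add: case_prod_beta)
    then show ?thesis by simp
  qed
  have J_eq: "?J r = (LINT x:{A..B}|lborel. rbar (r, x) * ubar (r, x) * \<phi>' x)" if "r \<in> {s..t}" for r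
    using st that by (intro set_borel_integral_eq_integral(2)[symmetric] borel_integrable_atLeastAtMost'
      continuous_intros slice rbar_cont ubar_cont \<phi>'c) auto
  have "set_integrable lborel {s..t} ?J"
    by (rule borel_integrable_atLeastAtMost'[OF J_cont])
  then show ?int
    unfolding set_integrable_def
    by (rule Bochner_Integration.integrable_cong[THEN iffD1, rotated -1]) (auto simp: J_eq split: split_indicator)
  have "(?J has_integral (?I t - ?I s)) {s..t}"
  proof (rule fundamental_theorem_of_calculus[OF st(2)])
    fix r assume "r \<in> {s..t}"
    then show "(?I has_vector_derivative ?J r) (at r within {s..t})"
      unfolding has_real_derivative_iff_has_vector_derivative[symmetric]
      using st by (intro has_field_derivative_subset[OF dI]) auto
  qed
  then have "?I t - ?I s = integral {s..t} ?J" by (simp add: integral_unique)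
  also have "\<dots> = (LINT r:{s..t}|lborel. ?J r)"
    by (rule set_borel_integral_eq_integral(2)[symmetric, OF borel_integrable_atLeastAtMost'[OF J_cont]])
  also have "\<dots> = (LINT r:{s..t}|lborel. LINT x:{A..B}|lborel. rbar (r, x) * ubar (r, x) * \<phi>' x)"
    unfolding set_lebesgue_integral_def[of _ "{s..t}"]
    by (rule Bochner_Integration.integral_cong) (auto simp: J_eq split: split_indicator)
  also have "?I t = (LINT x:{A..B}|lborel. rbar (t, x) * \<phi> x)"
    using st by (intro set_borel_integral_eq_integral(2)[symmetric] borel_integrable_atLeastAtMost'
      continuous_intros slice rbar_cont \<phi>_cont) auto
  also have "?I s = (LINT x:{A..B}|lborel. rbar (s, x) * \<phi> x)"
    using st by (intro set_borel_integral_eq_integral(2)[symmetric] borel_integrable_atLeastAtMost'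
      continuous_intros slice rbar_cont \<phi>_cont) auto
  finally show ?balance .
qed

end

subsection \<open>Measurability of the Lipschitz constant\<close>

text \<open>A Lipschitz constant read off from second differences of the primitive. Rational
  parameters make the supremum countable, which gives a Borel function of time when \<open>f\<close>
  is a time slice of a Borel function.\<close>

definition lip_const :: "(real \<Rightarrow> real) \<Rightarrow> ennreal" where
  "lip_const f = (SUP (a, h, r)\<in>\<rat> \<times> (\<rat> \<inter> {0<..}) \<times> (\<rat> \<inter> {0<..}).
     ennreal (\<bar>(LINT y:{a + h<..a + h + r}|lborel. f y) - (LINT y:{a<..a + r}|lborel. f y)\<bar> / (h * r)))"

lemma borel_measurable_lip_const:
  fixes F :: "real \<times> real \<Rightarrow> real"
  assumes [measurable]: "F \<in> borel_measurable borel"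
  shows "(\<lambda>t. lip_const (\<lambda>x. F (t, x))) \<in> borel_measurable borel"
  unfolding lip_const_def case_prod_beta
proof (rule borel_measurable_SUP)
  show "countable (\<rat> \<times> (\<rat> \<inter> {0<..}) \<times> (\<rat> \<inter> {0<..}) :: (real \<times> real \<times> real) set)"
    by (intro countable_SIGMA countable_Int1 countable_rat)
  have m: "(\<lambda>t. LINT y:{l<..u}|lborel. F (t, y)) \<in> borel_measurable borel" for l u
    unfolding set_lebesgue_integral_def
    by (rule lborel.borel_measurable_lebesgue_integral) measurable
  show "(\<lambda>t. ennreal (\<bar>(LINT y:{fst p + fst (snd p)<..fst p + fst (snd p) + snd (snd p)}|lborel. F (t, y)) -
      (LINT y:{fst p<..fst p + snd (snd p)}|lborel. F (t, y))\<bar> / (fst (snd p) * snd (snd p)))) \<in> borel_measurable borel"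
    for p :: "real \<times> real \<times> real"
    by (intro measurable_compose[OF _ measurable_ennreal] borel_measurable_divide borel_measurable_abs
      borel_measurable_diff m borel_measurable_const)
qed

lemma lip_const_le_iff:
  assumes "0 \<le> L"
  shows "lip_const f \<le> ennreal L \<longleftrightarrow> (\<forall>a h r. a \<in> \<rat> \<longrightarrow> h \<in> \<rat> \<longrightarrow> r \<in> \<rat> \<longrightarrow> 0 < h \<longrightarrow> 0 < r \<longrightarrow>
    \<bar>(LINT y:{a + h<..a + h + r}|lborel. f y) - (LINT y:{a<..a + r}|lborel. f y)\<bar> \<le> L * h * r)"
proof -
  have "ennreal (A / (h * r)) \<le> ennreal L \<longleftrightarrow> A \<le> L * h * r" if "0 < h" "0 < r" for A h r :: real
    using that assms by (simp add: ennreal_le_iff divide_le_eq mult.assoc)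
  then show ?thesis
    unfolding lip_const_def SUP_le_iff by auto
qed

text \<open>Integrals do not distinguish \<open>u\<close> from its Borel version \<open>f\<close>,
  so the second-difference bound for weak derivatives applies. An inequality suffices: finiteness of
  the integral of the right side then passes to the measurable left side.\<close>

lemma lip_const_le_Linf_norm_deriv:
  assumes [measurable]: "f \<in> borel_measurable borel" and eq: "AE x in lborel. u x = f x"
  shows "lip_const f \<le> Linf_norm_deriv UNIV u"
proof (cases "Linf_norm_deriv UNIV u = \<infinity>")
  case False
  then have wd: "weakly_diff 1 UNIV u" and fin: "Linf_norm UNIV (weak_deriv 1 UNIV u) \<noteq> \<infinity>"
    by (auto simp: Linf_norm_deriv_def split: if_splits)
  define d where "d = weak_deriv 1 UNIV u"
  have d: "is_weak_deriv 1 UNIV u d"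
    using wd unfolding d_def weak_deriv_def weakly_diff_def by (rule someI_ex)
  define N where "N = enn2real (Linf_norm_deriv UNIV u)"
  have N: "Linf_norm UNIV d = ennreal N"
    using fin wd by (simp add: N_def Linf_norm_deriv_def d_def less_top)
  have "AE x in lebesgue. ennreal \<bar>d x\<bar> \<le> ennreal N"
    using esssup_AE[of "\<lambda>x. ennreal \<bar>d x\<bar>" "lebesgue_on UNIV"]
    unfolding N[symmetric] Linf_norm_def lebesgue_on_UNIV_eq .
  then have dN: "AE x in lebesgue. \<bar>d x\<bar> \<le> N"
    by eventually_elim (simp add: N_def)
  have uf: "(LINT y:{a<..b}|lebesgue. u y) = (LINT y:{a<..b}|lborel. f y)" for a b
  proof -
    have "set_integrable lebesgue {a..b} u"
      using d unfolding is_weak_deriv_def loc_integrable_def by simp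
    then have "set_integrable lebesgue {a<..b} u" by (rule set_integrable_subset) auto
    then have "(LINT y:{a<..b}|lebesgue. u y) = (LINT y|lebesgue. indicator {a<..b} y *\<^sub>R f y)"
      unfolding set_lebesgue_integral_def set_integrable_def
    proof (intro integral_cong_AE)
      show "AE y in lebesgue. indicator {a<..b} y *\<^sub>R u y = indicator {a<..b} y *\<^sub>R f y"
        using AE_completion[OF eq] by eventually_elim simp
      show "(\<lambda>y. indicator {a<..b} y *\<^sub>R f y) \<in> borel_measurable lebesgue"
        by (intro measurable_completion) simp
    qed (rule borel_measurable_integrable)
    also have "\<dots> = (LINT y:{a<..b}|lborel. f y)"
      unfolding set_lebesgue_integral_def by (rule integral_completion) simp
    finally show ?thesis .
  qed
  have "lip_const f \<le> ennreal N"
    unfolding lip_const_le_iff[OF enn2real_nonneg[of "Linf_norm_deriv UNIV u", folded N_def]]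
  proof (intro allI impI)
    fix a h r :: real assume "0 < h" "0 < r"
    then show "\<bar>(LINT y:{a + h<..a + h + r}|lborel. f y) - (LINT y:{a<..a + r}|lborel. f y)\<bar> \<le> N * h * r"
      using weak_deriv_bounded_second_difference[OF d dN, of h r a] unfolding uf by simp
  qed
  then show ?thesis using N wd by (simp add: Linf_norm_deriv_def d_def)
qed simp

subsection \<open>Vacuum and the velocity gradient\<close>

lemma AE_lborel_ex:
  fixes a b :: real
  assumes "AE t in lborel. P t" "a < b"
  shows "\<exists>t. a < t \<and> t < b \<and> P t"
proof (rule ccontr)
  assume no: "\<not> (\<exists>t. a < t \<and> t < b \<and> P t)"
  have "AE t in lborel. t \<notin> {a<..<b}"
    using assms(1) by eventually_elim (use no in auto)
  then have "{a<..<b} \<in> null_sets lborel"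
    by (subst (asm) AE_iff_null_sets[symmetric]) auto
  then show False using assms(2) by (simp add: null_sets_def)
qed

locale vacuum_solution = rarefaction_wave \<gamma> S w rbar ubar
  for \<gamma> S :: real and w rbar ubar :: "real \<times> real \<Rightarrow> real" +
  fixes \<rho> u :: "real \<times> real \<Rightarrow> real" and C T0 T1 \<rho>1 :: real
  assumes mass_weak: "weak_mass rbar ubar \<rho> u"
    and \<rho>_cont: "continuous_on ({0..T0} \<times> UNIV) \<rho>"
    and \<rho>_nonneg: "0 \<le> t \<Longrightarrow> t \<le> T0 \<Longrightarrow> 0 \<le> \<rho> (t, x)"
    and \<rho>_le: "0 \<le> t \<Longrightarrow> t \<le> T0 \<Longrightarrow> \<rho> (t, x) \<le> C"
    and wvel_measurable: "wvel ubar \<rho> u \<in> borel_measurable (lebesgue_on (strip T0))"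
    and energy: "AE t in lborel. t \<in> {0<..<T0} \<longrightarrow> (\<integral>\<^sup>+x. ennreal ((wvel ubar \<rho> u (t, x))\<^sup>2) \<partial>lborel) \<le> ennreal C"
    and potential: "AE t in lborel. t \<in> {0<..<T0} \<longrightarrow> (\<integral>\<^sup>+x. ennreal (rel_potential \<gamma> (\<rho> (t, x)) (rbar (t, x))) \<partial>lborel) \<le> ennreal C"
    and \<rho>1_pos: "0 < \<rho>1" and rbar_ge: "0 \<le> t \<Longrightarrow> \<rho>1 \<le> rbar (t, x)"
    and T1: "0 \<le> T1" "T1 < T0"
    and \<rho>_pos: "T1 < t \<Longrightarrow> t \<le> T0 \<Longrightarrow> 0 < \<rho> (t, x)"
begin

lemma C_nonneg: "0 \<le> C"
  using \<rho>_nonneg[of T1 0] \<rho>_le[of T1 0] T1 by simp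

text \<open>With q = \<gamma>/(\<gamma> - 1) the potential is a non-negative multiple of r^\<gamma>
  plus s^(\<gamma> - 1) (s - q r). The threshold on \<open>r\<close> is \<rho>1/(2q), so that s - q
  r is at least \<rho>1/2.\<close>

lemma rel_potential_near_vacuum:
  assumes "0 \<le> r" "r \<le> (\<gamma> - 1) / (2 * \<gamma>) * \<rho>1" "\<rho>1 \<le> s"
  shows "\<rho>1 powr (\<gamma> - 1) * (\<rho>1 / 2) \<le> rel_potential \<gamma> r s"
proof -
  have s: "0 < s" using assms(3) \<rho>1_pos by simp
  define q where "q = \<gamma> / (\<gamma> - 1)"
  have "q * r \<le> q * ((\<gamma> - 1) / (2 * \<gamma>) * \<rho>1)"
    using assms gamma by (intro mult_left_mono) (auto simp: q_def)
  also have "\<dots> = \<rho>1 / 2" using gamma by (simp add: q_def)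
  finally have "\<rho>1 / 2 \<le> s - q * r" using assms(3) by linarith
  then have "\<rho>1 powr (\<gamma> - 1) * (\<rho>1 / 2) \<le> s powr (\<gamma> - 1) * (s - q * r)"
    using assms \<rho>1_pos gamma by (intro mult_mono powr_mono2) auto
  also have "s powr (\<gamma> - 1) * (s - q * r) = s powr (\<gamma> - 1) * s - q * r * s powr (\<gamma> - 1)"
    by (simp add: algebra_simps)
  also have "s powr (\<gamma> - 1) * s = s powr \<gamma>" using s by (simp add: powr_diff)
  also have "s powr \<gamma> - q * r * s powr (\<gamma> - 1) \<le> 1 / (\<gamma> - 1) * r powr \<gamma> + (s powr \<gamma> - q * r * s powr (\<gamma> - 1))"
    using gamma by simp
  also have "\<dots> = rel_potential \<gamma> r s"
  proof -
    have "s powr (\<gamma> - 1) * s = s powr \<gamma>" using s by (simp add: powr_diff)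
    then have "rel_potential \<gamma> r s = 1 / (\<gamma> - 1) * (r powr \<gamma> - s powr \<gamma> - \<gamma> * r * s powr (\<gamma> - 1) + \<gamma> * s powr \<gamma>)"
      unfolding rel_potential_def by (simp add: algebra_simps)
    also have "\<dots> = 1 / (\<gamma> - 1) * r powr \<gamma> + ((\<gamma> - 1) * s powr \<gamma> - \<gamma> * r * s powr (\<gamma> - 1)) / (\<gamma> - 1)"
      by (simp add: add_divide_distrib diff_divide_distrib algebra_simps)
    also have "((\<gamma> - 1) * s powr \<gamma> - \<gamma> * r * s powr (\<gamma> - 1)) / (\<gamma> - 1) = s powr \<gamma> - q * r * s powr (\<gamma> - 1)"
      using gamma by (simp add: q_def diff_divide_distrib)
    finally show ?thesis by simp
  qed
  finally show ?thesis .
qed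

text \<open>If the density vanished identically at time \<open>T1\<close>, then by continuity the relative potential would
  be bounded below on arbitrarily long intervals at later times.\<close>

lemma positive_density_at_T1: "\<exists>x. 0 < \<rho> (T1, x)"
proof (rule ccontr)
  assume "\<not> (\<exists>x. 0 < \<rho> (T1, x))"
  then have vac: "\<rho> (T1, x) = 0" for x using \<rho>_nonneg[of T1 x] T1 by (metis less_le)
  define \<kappa>' where "\<kappa>' = \<rho>1 powr (\<gamma> - 1) * (\<rho>1 / 2)"
  define e where "e = (\<gamma> - 1) / (2 * \<gamma>) * \<rho>1"
  have \<kappa>': "0 < \<kappa>'" using \<rho>1_pos by (simp add: \<kappa>'_def)
  have e: "0 < e" using \<rho>1_pos gamma by (simp add: e_def)
  \<comment> \<open>Chosen so that the lower bound \<open>\<kappa>'\<close> on an interval of length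
    2K already exceeds the energy bound \<open>C\<close>.\<close>
  define K where "K = (C + 1) / (2 * \<kappa>')"
  have K: "0 < K" using C_nonneg \<kappa>' by (simp add: K_def)
  have "uniformly_continuous_on ({0..T0} \<times> {-K..K}) \<rho>"
    by (rule compact_uniformly_continuous[OF continuous_on_subset[OF \<rho>_cont]]) (auto intro: compact_Times)
  then obtain d where d: "0 < d" and unif: "\<And>z z'. z \<in> {0..T0} \<times> {-K..K} \<Longrightarrow> z' \<in> {0..T0} \<times> {-K..K} \<Longrightarrow>
      dist z' z < d \<Longrightarrow> dist (\<rho> z') (\<rho> z) < e"
    using e unfolding uniformly_continuous_on_def by metis
  \<comment> \<open>The energy bound is available at almost every time, possibly not at
    \<open>T1\<close> itself.\<close>
  obtain t where t: "T1 < t" "t < min T0 (T1 + d)"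
    and pt: "t \<in> {0<..<T0} \<longrightarrow> (\<integral>\<^sup>+x. ennreal (rel_potential \<gamma> (\<rho> (t, x)) (rbar (t, x))) \<partial>lborel) \<le> ennreal C"
    using AE_lborel_ex[OF potential, of T1 "min T0 (T1 + d)"] T1 d by auto
  have low: "\<kappa>' \<le> rel_potential \<gamma> (\<rho> (t, x)) (rbar (t, x))" if x: "x \<in> {-K..K}" for x
  proof -
    have "dist (\<rho> (t, x)) (\<rho> (T1, x)) < e"
      by (rule unif) (use t T1 x in \<open>auto simp: dist_Pair_Pair dist_real_def\<close>)
    then have "\<rho> (t, x) \<le> e" using vac[of x] by (auto simp: dist_real_def)
    then show ?thesis
      unfolding \<kappa>'_def using \<rho>_nonneg[of t x] rbar_ge[of t x] t T1
      by (intro rel_potential_near_vacuum) (auto simp: e_def)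
  qed
  have "2 * K * \<kappa>' = C + 1" using \<kappa>' by (simp add: K_def field_simps)
  then have "ennreal (C + 1) = ennreal (2 * K * \<kappa>')" by simp
  also have "\<dots> = (\<integral>\<^sup>+x. ennreal \<kappa>' * indicator {-K..K} x \<partial>lborel)"
    using K \<kappa>' by (simp add: nn_integral_cmult_indicator ennreal_mult'[symmetric] mult.commute)
  also have "\<dots> \<le> (\<integral>\<^sup>+x. ennreal (rel_potential \<gamma> (\<rho> (t, x)) (rbar (t, x))) \<partial>lborel)"
    by (rule nn_integral_mono) (auto simp: low ennreal_leI split: split_indicator)
  also have "\<dots> \<le> ennreal C" using pt t T1 by auto
  finally show False using C_nonneg by (simp add: ennreal_le_iff)
qed

end

text \<open>\<open>wb\<close> is a Borel version of the Lebesgue measurable function \<open>sqrt \<rho> (u - ubar)\<close>; it is needed for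
  measurability with respect to product measures.\<close>

locale vacuum_solution_borel = vacuum_solution +
  fixes wb :: "real \<times> real \<Rightarrow> real"
  assumes wb_borel [measurable]: "wb \<in> borel_measurable borel"
    and wb_eq: "AE z in lborel. indicator (strip T0) z * wvel ubar \<rho> u z = wb z"
begin

text \<open>Extension by 0 turns functions continuous on the closed strip into Borel functions on
  the whole plane, and gives the density its bounds at every point.\<close>

definition cut :: "(real \<times> real \<Rightarrow> real) \<Rightarrow> real \<times> real \<Rightarrow> real" where
  "cut f z = indicator ({0..T0} \<times> UNIV) z * f z"

text \<open>A jointly Borel substitute for \<open>u\<close>, obtained by solving wb = sqrt \<rho> (u
  - ubar) for \<open>u\<close>. It agrees with \<open>u\<close> for almost all points at almost all
  times in (T1, T0), where the density is positive; at vacuum points the quotient is 0 by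
  convention.\<close>

definition vel :: "real \<times> real \<Rightarrow> real" where
  "vel z = cut ubar z + wb z / sqrt (cut \<rho> z)"

lemma cut_eq: "0 \<le> t \<Longrightarrow> t \<le> T0 \<Longrightarrow> cut f (t, x) = f (t, x)"
  by (simp add: cut_def)

lemma cut_borel: "continuous_on ({0..T0} \<times> UNIV) f \<Longrightarrow> cut f \<in> borel_measurable borel"
  unfolding cut_def
  using borel_measurable_continuous_on_indicator[of "{0..T0} \<times> UNIV" f]
  by (simp add: borel_Times closed_Times borel_closed)

lemma wave_cont: "continuous_on ({0..T0} \<times> UNIV) rbar" "continuous_on ({0..T0} \<times> UNIV) ubar"
  by (rule continuous_on_subset[OF rbar_cont] continuous_on_subset[OF ubar_cont]; auto)+

lemma cut_measurable [measurable]: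
  "cut \<rho> \<in> borel_measurable borel" "cut rbar \<in> borel_measurable borel" "cut ubar \<in> borel_measurable borel"
  by (intro cut_borel \<rho>_cont wave_cont)+

lemma vel_borel [measurable]: "vel \<in> borel_measurable borel"
  unfolding vel_def[abs_def] by measurable

lemma slice_cont:
  assumes "continuous_on ({0..T0} \<times> UNIV) f" "0 \<le> t" "t \<le> T0"
  shows "continuous_on X (\<lambda>x. f (t, x))"
  by (rule continuous_on_compose2[OF assms(1)]) (use assms in \<open>auto intro!: continuous_intros\<close>)

lemma wb_slice: "AE t in lborel. t \<in> {0<..<T0} \<longrightarrow> (AE x in lborel. wvel ubar \<rho> u (t, x) = wb (t, x))"
proof -
  have "AE z in lborel \<Otimes>\<^sub>M lborel. indicator (strip T0) z * wvel ubar \<rho> u z = wb z"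
    unfolding lborel_prod by (rule wb_eq)
  then have "AE t in lborel. AE x in lborel. indicator (strip T0) (t, x) * wvel ubar \<rho> u (t, x) = wb (t, x)"
    by (rule lborel_pair.AE_pair)
  then show ?thesis
    by eventually_elim (auto simp: indicator_def)
qed

lemma wb_energy: "AE t in lborel. t \<in> {0<..<T0} \<longrightarrow> (\<integral>\<^sup>+x. ennreal ((wb (t, x))\<^sup>2) \<partial>lborel) \<le> ennreal C"
  using wb_slice energy
proof eventually_elim
  case (elim t)
  show ?case
  proof
    assume t: "t \<in> {0<..<T0}"
    then have "AE x in lborel. wvel ubar \<rho> u (t, x) = wb (t, x)" using elim by simp
    then have "(\<integral>\<^sup>+x. ennreal ((wb (t, x))\<^sup>2) \<partial>lborel) = (\<integral>\<^sup>+x. ennreal ((wvel ubar \<rho> u (t, x))\<^sup>2) \<partial>lborel)"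
      by (intro nn_integral_cong_AE) (auto elim: eventually_mono)
    then show "(\<integral>\<^sup>+x. ennreal ((wb (t, x))\<^sup>2) \<partial>lborel) \<le> ennreal C" using elim t by simp
  qed
qed

lemma u_eq_vel: "AE t in lborel. t \<in> {T1<..<T0} \<longrightarrow> (AE x in lborel. u (t, x) = vel (t, x))"
  using wb_slice
proof eventually_elim
  case (elim t)
  show ?case
  proof
    assume t: "t \<in> {T1<..<T0}"
    then have "AE x in lborel. wvel ubar \<rho> u (t, x) = wb (t, x)" using elim T1 by simp
    then show "AE x in lborel. u (t, x) = vel (t, x)"
    proof eventually_elim
      case (elim x)
      have "0 < \<rho> (t, x)" using \<rho>_pos[of t x] t by simp
      then show ?case
        using elim t T1 by (simp add: vel_def cut_eq wvel_def flip: elim)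
    qed
  qed
qed

lemma wb_square_int: "AE t in lborel. t \<in> {0<..<T0} \<longrightarrow> integrable lborel (\<lambda>x. (wb (t, x))\<^sup>2) \<and> (LINT x|lborel. (wb (t, x))\<^sup>2) \<le> C"
  using wb_energy
proof eventually_elim
  case (elim t)
  show ?case
  proof
    assume t: "t \<in> {0<..<T0}"
    then have le: "(\<integral>\<^sup>+x. ennreal ((wb (t, x))\<^sup>2) \<partial>lborel) \<le> ennreal C" using elim by simp
    then have "(\<integral>\<^sup>+x. ennreal ((wb (t, x))\<^sup>2) \<partial>lborel) < \<infinity>"
      by (metis ennreal_less_top infinity_ennreal_def le_less_trans)
    then have "integrable lborel (\<lambda>x. (wb (t, x))\<^sup>2)" by (intro integrableI_nonneg) auto
    moreover have "(LINT x|lborel. (wb (t, x))\<^sup>2) \<le> C"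
      using le C_nonneg by (subst integral_eq_nn_integral) (auto intro: enn2real_leI)
    ultimately show "integrable lborel (\<lambda>x. (wb (t, x))\<^sup>2) \<and> (LINT x|lborel. (wb (t, x))\<^sup>2) \<le> C" ..
  qed
qed

text \<open>Bounding |w| by 1 + w^2 makes the kinetic energy directly usable as an integrable
  majorant.\<close>

lemma abs_vel_le:
  assumes "0 < c" "c \<le> \<rho> (t, x)" "0 \<le> t" "t \<le> T0"
  shows "\<bar>vel (t, x)\<bar> \<le> \<bar>ubar (t, x)\<bar> + (1 + (wb (t, x))\<^sup>2) / sqrt c"
proof -
  have "\<bar>wb (t, x)\<bar> \<le> 1 + (wb (t, x))\<^sup>2"
  proof (cases "\<bar>wb (t, x)\<bar> \<le> 1")
    case False
    then have "\<bar>wb (t, x)\<bar> * 1 \<le> \<bar>wb (t, x)\<bar> * \<bar>wb (t, x)\<bar>" by (intro mult_left_mono) auto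
    then show ?thesis by (simp add: power2_eq_square)
  qed (simp add: add_increasing2)
  then have "\<bar>wb (t, x)\<bar> / sqrt (\<rho> (t, x)) \<le> (1 + (wb (t, x))\<^sup>2) / sqrt c"
    using assms by (intro frac_le) auto
  moreover have "\<bar>vel (t, x)\<bar> \<le> \<bar>ubar (t, x)\<bar> + \<bar>wb (t, x)\<bar> / sqrt (\<rho> (t, x))"
    using assms by (simp add: vel_def cut_eq order_trans[OF abs_triangle_ineq])
  ultimately show ?thesis by linarith
qed

text \<open>On a compact interval the continuous positive density has a positive minimum, and there
  the kinetic energy controls the velocity.\<close>

lemma vel_int: "AE t in lborel. t \<in> {T1<..<T0} \<longrightarrow> (\<forall>a b. set_integrable lborel {a<..b} (\<lambda>x. vel (t, x)))"
  using wb_square_int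
proof eventually_elim
  case (elim t)
  show ?case
  proof (intro impI allI)
    fix a b assume t: "t \<in> {T1<..<T0}"
    then have w2: "integrable lborel (\<lambda>x. (wb (t, x))\<^sup>2)" and t0: "0 \<le> t" "t \<le> T0" using elim T1 by auto
    show "set_integrable lborel {a<..b} (\<lambda>x. vel (t, x))"
    proof (cases "a \<le> b")
      case True
      obtain xm where xm: "xm \<in> {a..b}" "\<And>x. x \<in> {a..b} \<Longrightarrow> \<rho> (t, xm) \<le> \<rho> (t, x)"
        using continuous_attains_inf[OF compact_Icc _ slice_cont[OF \<rho>_cont t0], of a b] True by auto
      have c: "0 < \<rho> (t, xm)" using \<rho>_pos[of t xm] t by simp
      let ?W = "\<lambda>x. indicator {a..b} x * \<bar>ubar (t, x)\<bar> + (indicator {a..b} x + (wb (t, x))\<^sup>2) / sqrt (\<rho> (t, xm))"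
      show ?thesis
        unfolding set_integrable_def
      proof (rule Bochner_Integration.integrable_bound[where f = ?W])
        have "set_integrable lborel {a..b} (\<lambda>x. \<bar>ubar (t, x)\<bar>)"
          by (intro borel_integrable_atLeastAtMost' continuous_intros slice_cont[OF wave_cont(2) t0])
        then have "integrable lborel (\<lambda>x. indicator {a..b} x * \<bar>ubar (t, x)\<bar>)" by (simp add: set_integrable_def)
        moreover have "integrable lborel (\<lambda>x. indicator {a..b} x :: real)"
          by (rule integrable_real_indicator) (use True in auto)
        ultimately show "integrable lborel ?W"
          by (intro Bochner_Integration.integrable_add integrable_divide w2)
        show "AE x in lborel. norm (indicator {a<..b} x *\<^sub>R vel (t, x)) \<le> norm (?W x)"
        proof (rule AE_I2)
          fix x
          have W0: "0 \<le> ?W x" by (intro add_nonneg_nonneg divide_nonneg_nonneg mult_nonneg_nonneg) (use c in auto)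
          show "norm (indicator {a<..b} x *\<^sub>R vel (t, x)) \<le> norm (?W x)"
          proof (cases "x \<in> {a<..b}")
            case True
            then have "\<bar>vel (t, x)\<bar> \<le> ?W x"
              using abs_vel_le[OF c xm(2) t0, of x] by auto
            then show ?thesis using True W0 by simp
          qed (use W0 in simp)
        qed
      qed measurable
    qed (simp add: set_integrable_def)
  qed
qed

section \<open>The continuity equation for the density alone, as an iterated integral\<close>

lemma weak_mass_slice:
  assumes st: "0 \<le> s" "s < t" "t \<le> T0" and lu: "l \<le> u'"
    and \<phi>: "\<And>x. (\<phi> has_real_derivative \<phi>' x) (at x)" and \<phi>'_cont: "continuous_on UNIV \<phi>'"
    and out: "\<And>x. x \<notin> {l<..<u'} \<Longrightarrow> \<phi> x = 0 \<and> \<phi>' x = 0"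
  shows "(LINT x:{l..u'}|lborel. (\<rho> (t, x) - rbar (t, x)) * \<phi> x) - (LINT x:{l..u'}|lborel. (\<rho> (s, x) - rbar (s, x)) * \<phi> x) =
    (LINT z:{s<..<t} \<times> UNIV|lebesgue. (mom ubar \<rho> u z - rbar z * ubar z) * \<phi>' (snd z))"
proof -
  \<comment> \<open>A test function constant in time is admissible because supports may reach the
    closed time ends of the slab; its time derivative drops out of the equation.\<close>
  define \<zeta> where "\<zeta> z = \<phi> (snd z)" for z :: "real \<times> real"
  have d\<zeta>: "(\<zeta> has_derivative (\<lambda>h. \<phi>' (snd z) * snd h)) (at z within X)" for z X
    unfolding \<zeta>_def
    by (rule has_derivative_compose[where g = \<phi> and f = snd])
      (auto intro!: derivative_eq_intros \<phi>[unfolded has_field_derivative_def])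
  have dir: "dir_deriv e \<zeta> z = \<phi>' (snd z) * snd e" for e z
    unfolding dir_deriv_def frechet_derivative_at[OF d\<zeta>, symmetric] ..
  have "Ck_on 1 ({s..t} \<times> UNIV) \<zeta>"
  proof -
    have "continuous_on ({s..t} \<times> UNIV) (\<lambda>z. \<phi>' (snd z) * snd e)" for e :: "real \<times> real"
      by (intro continuous_intros continuous_on_compose2[OF \<phi>'_cont]) auto
    then show ?thesis
      unfolding One_nat_def Ck_on.simps
      by (intro exI[of _ "\<lambda>z h. \<phi>' (snd z) * snd h"] conjI ballI allI d\<zeta>)
  qed
  moreover have "compact_supp_in ({s..t} \<times> UNIV) \<zeta>"
    unfolding compact_supp_in_def
  proof (intro exI[of _ "{s..t} \<times> {l..u'}"] conjI ballI)
    fix z assume "z \<in> {s..t} \<times> UNIV - {s..t} \<times> {l..u'}"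
    then have "snd z \<notin> {l<..<u'}" by auto
    then show "\<zeta> z = 0" using out unfolding \<zeta>_def by blast
  qed (auto intro: compact_Times)
  ultimately have "test_Ck 1 ({s..t} \<times> UNIV) \<zeta>" by (simp add: test_Ck_def)
  with mass_weak st have
    "(LINT x|lebesgue. (\<rho> (t, x) - rbar (t, x)) * \<zeta> (t, x)) - (LINT x|lebesgue. (\<rho> (s, x) - rbar (s, x)) * \<zeta> (s, x)) =
     (LINT z:{s<..<t} \<times> UNIV|lebesgue. (\<rho> z - rbar z) * dt \<zeta> z + (mom ubar \<rho> u z - rbar z * ubar z) * dx \<zeta> z)"
    unfolding weak_mass_def by simp
  moreover have "(LINT x|lebesgue. (\<rho> (r, x) - rbar (r, x)) * \<zeta> (r, x)) =
    (LINT x:{l..u'}|lborel. (\<rho> (r, x) - rbar (r, x)) * \<phi> x)" if r: "0 \<le> r" "r \<le> T0" for r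
  proof -
    let ?f = "\<lambda>x. indicator {l..u'} x *\<^sub>R ((\<rho> (r, x) - rbar (r, x)) * \<phi> x)"
    have \<phi>c: "continuous_on X \<phi>" for X
      by (rule DERIV_continuous_on[of X \<phi> \<phi>']) (auto intro: has_field_derivative_at_within \<phi>)
    have "(LINT x|lebesgue. (\<rho> (r, x) - rbar (r, x)) * \<zeta> (r, x)) = (LINT x|lebesgue. ?f x)"
      using out by (intro Bochner_Integration.integral_cong) (auto simp: \<zeta>_def split: split_indicator)
    also have "\<dots> = (LINT x|lborel. ?f x)"
    proof (rule integral_completion)
      have "?f \<in> borel_measurable borel"
        by (rule borel_measurable_continuous_on_indicator)
          (auto intro!: continuous_intros slice_cont[OF \<rho>_cont r] slice_cont[OF wave_cont(1) r] \<phi>c)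
      then show "?f \<in> borel_measurable lborel" by simp
    qed
    finally show ?thesis by (simp add: set_lebesgue_integral_def)
  qed
  ultimately show ?thesis using st by (simp add: dir)
qed

lemma cut_momentum_bound:
  obtains K where "\<And>r x. x \<in> {l..u'} \<Longrightarrow> \<bar>cut \<rho> (r, x) * cut ubar (r, x) - cut rbar (r, x) * cut ubar (r, x)\<bar> \<le> K"
proof -
  have comp: "compact ((\<lambda>z. \<rho> z * ubar z - rbar z * ubar z) ` ({0..T0} \<times> {l..u'}))"
    by (intro compact_continuous_image compact_Times continuous_intros continuous_on_subset[OF \<rho>_cont]
      continuous_on_subset[OF wave_cont(1)] continuous_on_subset[OF wave_cont(2)]) auto
  then obtain K where K: "\<forall>y \<in> (\<lambda>z. \<rho> z * ubar z - rbar z * ubar z) ` ({0..T0} \<times> {l..u'}). norm y \<le> K"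
    using compact_imp_bounded[OF comp] unfolding bounded_iff by blast
  show ?thesis
  proof (rule that[of "max K 0"])
    show "\<bar>cut \<rho> (r, x) * cut ubar (r, x) - cut rbar (r, x) * cut ubar (r, x)\<bar> \<le> max K 0" if "x \<in> {l..u'}" for r x
    proof (cases "r \<in> {0..T0}")
      case True
      then have "\<bar>\<rho> (r, x) * ubar (r, x) - rbar (r, x) * ubar (r, x)\<bar> \<le> K"
        using K that by force
      then show ?thesis using True by (simp add: cut_eq)
    qed (simp add: cut_def)
  qed
qed

text \<open>Fubini turns the space-time flux into an iterated integral, and the balance for the wave
  is added to remove it from the equation. Starting at \<open>T1\<close> or later keeps the density
  positive on the open time interval, so there sqrt \<rho> times \<open>wb\<close> is \<rho> times
  the relative velocity.\<close>

lemma iterated_weak_mass: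
  assumes st: "T1 \<le> s" "s \<le> t" "t < T0" and lu: "l \<le> u'"
    and \<phi>: "\<And>x. (\<phi> has_real_derivative \<phi>' x) (at x)" and \<phi>'_cont: "continuous_on UNIV \<phi>'"
    and out: "\<And>x. x \<notin> {l<..<u'} \<Longrightarrow> \<phi> x = 0 \<and> \<phi>' x = 0"
  shows "(LINT x:{l..u'}|lborel. \<rho> (t, x) * \<phi> x) - (LINT x:{l..u'}|lborel. \<rho> (s, x) * \<phi> x) =
    (LINT r:{s<..t}|lborel. LINT x:{l..u'}|lborel. \<rho> (r, x) * vel (r, x) * \<phi>' x)"
proof (cases "s = t")
  case True
  then show ?thesis by (simp add: set_lebesgue_integral_def)
next
  case False
  then have s_t: "s < t" using st by simp
  have s0: "0 \<le> s" "0 \<le> t" "s \<le> T0" "t \<le> T0" using st T1 by auto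
  have [measurable]: "\<phi>' \<in> borel_measurable borel" by (rule borel_measurable_continuous_onI[OF \<phi>'_cont])
  have \<phi>c: "continuous_on X \<phi>" for X
    by (rule DERIV_continuous_on[of X \<phi> \<phi>']) (auto intro: has_field_derivative_at_within \<phi>)
  have \<phi>'c: "continuous_on X \<phi>'" for X using \<phi>'_cont continuous_on_subset by blast
  define box where "box = {s<..<t} \<times> {l..u'}"
  \<comment> \<open>The flux integrand with the relative velocity as parameter: it is used with the
    given \<open>wvel\<close> and with its Borel version \<open>wb\<close>. The box confines space
    to the interval carrying the test function.\<close>
  define Q where "Q W z = indicator box z * ((sqrt (cut \<rho> z) * W z + (cut \<rho> z * cut ubar z - cut rbar z * cut ubar z)) * \<phi>' (snd z))"
    for W :: "real \<times> real \<Rightarrow> real" and z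
  have [measurable]: "(snd :: real \<times> real \<Rightarrow> real) \<in> borel_measurable borel"
    by (intro borel_measurable_continuous_onI continuous_intros)
  have box_borel [measurable]: "box \<in> sets borel"
    unfolding box_def by (intro borel_Times) auto
  have Q_borel [measurable]: "Q wb \<in> borel_measurable borel" unfolding Q_def[abs_def] by measurable
  have flux: "(LINT z:{s<..<t} \<times> UNIV|lebesgue. (mom ubar \<rho> u z - rbar z * ubar z) * \<phi>' (snd z)) = (LINT z|lborel. Q wb z)"
  proof -
    let ?w = "\<lambda>z. indicator (strip T0) z * wvel ubar \<rho> u z"
    have w_meas: "?w \<in> borel_measurable lebesgue"
      using wvel_measurable by (subst (asm) borel_measurable_restrict_space_iff) (auto simp: open_Times)
    have "(LINT z:{s<..<t} \<times> UNIV|lebesgue. (mom ubar \<rho> u z - rbar z * ubar z) * \<phi>' (snd z)) = (LINT z|lebesgue. Q ?w z)"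
      unfolding set_lebesgue_integral_def
    proof (rule Bochner_Integration.integral_cong)
      fix z :: "real \<times> real"
      obtain r x where z: "z = (r, x)" by (cases z)
      show "indicator ({s<..<t} \<times> UNIV) z *\<^sub>R ((mom ubar \<rho> u z - rbar z * ubar z) * \<phi>' (snd z)) = Q ?w z"
      proof (cases "r \<in> {s<..<t} \<and> x \<in> {l..u'}")
        case True
        then have "r \<in> {0<..<T0}" using st T1 by auto
        then show ?thesis using True by (simp add: z Q_def box_def cut_eq mom_def indicator_def)
      next
        case False
        then show ?thesis using out[of x] by (auto simp: z Q_def box_def indicator_def)
      qed
    qed simp
    also have "\<dots> = (LINT z|lebesgue. Q wb z)"
    proof (rule integral_cong_AE)
      show "Q ?w \<in> borel_measurable lebesgue"
        unfolding Q_def[abs_def] by (intro borel_measurable_times borel_measurable_add w_meas measurable_completion) measurable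
      show "Q wb \<in> borel_measurable lebesgue" by (intro measurable_completion) simp
      show "AE z in lebesgue. Q ?w z = Q wb z"
        using AE_completion[OF wb_eq] by eventually_elim (simp add: Q_def)
    qed
    also have "\<dots> = (LINT z|lborel. Q wb z)" by (rule integral_completion) simp
    finally show ?thesis .
  qed
  have Q_int: "integrable lborel (Q wb)"
  proof -
    obtain K where K: "\<And>r x. x \<in> {l..u'} \<Longrightarrow> \<bar>cut \<rho> (r, x) * cut ubar (r, x) - cut rbar (r, x) * cut ubar (r, x)\<bar> \<le> K"
      by (rule cut_momentum_bound) (rule that)
    have comp: "compact (\<phi>' ` {l..u'})" by (intro compact_continuous_image \<phi>'c) simp
    then obtain P where "\<forall>y \<in> \<phi>' ` {l..u'}. norm y \<le> P"
      using compact_imp_bounded[OF comp] unfolding bounded_iff by blast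
    then have P: "\<bar>\<phi>' x\<bar> \<le> P" if "x \<in> {l..u'}" for x using that by simp
    have P0: "0 \<le> P" using P[of l] lu by force
    have K0: "0 \<le> K" using K[of l] lu by force
    \<comment> \<open>Tonelli together with the energy bound at almost every time gives square
      integrability over a strip of finite duration.\<close>
    have sq: "integrable lborel (\<lambda>z. indicator ({s<..<t} \<times> UNIV) z * (wb z)\<^sup>2)"
    proof (rule integrableI_nonneg)
      have [measurable]: "{s<..<t} \<times> UNIV \<in> sets (borel :: (real \<times> real) measure)" by (intro borel_Times) auto
      show m: "(\<lambda>z. indicator ({s<..<t} \<times> UNIV) z * (wb z)\<^sup>2) \<in> borel_measurable lborel" by measurable
      have "(\<integral>\<^sup>+z. ennreal (indicator ({s<..<t} \<times> UNIV) z * (wb z)\<^sup>2) \<partial>lborel) =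
        (\<integral>\<^sup>+r. \<integral>\<^sup>+x. ennreal (indicator ({s<..<t} \<times> UNIV) (r, x) * (wb (r, x))\<^sup>2) \<partial>lborel \<partial>lborel)"
        unfolding lborel_prod[symmetric]
        by (rule lborel.nn_integral_fst[symmetric]) (use m in \<open>simp add: lborel_prod\<close>)
      also have "\<dots> \<le> (\<integral>\<^sup>+r. ennreal C * indicator {s<..<t} r \<partial>lborel)"
      proof (rule nn_integral_mono_AE)
        show "AE r in lborel. (\<integral>\<^sup>+x. ennreal (indicator ({s<..<t} \<times> UNIV) (r, x) * (wb (r, x))\<^sup>2) \<partial>lborel) \<le> ennreal C * indicator {s<..<t} r"
          using wb_energy
        proof eventually_elim
          case (elim r)
          then show ?case using st T1 by (cases "r \<in> {s<..<t}") (auto simp: indicator_def)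
        qed
      qed
      also have "\<dots> = ennreal C * ennreal (t - s)" using s_t by (simp add: nn_integral_cmult_indicator)
      also have "\<dots> < \<infinity>" by (simp add: ennreal_mult_less_top)
      finally show "(\<integral>\<^sup>+z. ennreal (indicator ({s<..<t} \<times> UNIV) z * (wb z)\<^sup>2) \<partial>lborel) < \<infinity>" .
    qed simp
    have bx: "integrable lborel (indicator box :: real \<times> real \<Rightarrow> real)"
    proof (rule integrable_real_indicator)
      have "bounded box" unfolding box_def by (intro bounded_Times) auto
      then show "emeasure lborel box < \<infinity>" by (rule emeasure_bounded_finite)
    qed simp
    let ?M = "\<lambda>z. P * (sqrt C * (indicator box z + indicator ({s<..<t} \<times> UNIV) z * (wb z)\<^sup>2) + K * indicator box z)"
    show ?thesis
    proof (rule Bochner_Integration.integrable_bound[where f = ?M])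
      show "integrable lborel ?M"
        by (intro integrable_mult_right Bochner_Integration.integrable_add sq bx)
      show "AE z in lborel. norm (Q wb z) \<le> norm (?M z)"
      proof (rule AE_I2)
        fix z :: "real \<times> real"
        obtain r x where z: "z = (r, x)" by (cases z)
        have M0: "0 \<le> ?M z" using P0 K0 C_nonneg by simp
        show "norm (Q wb z) \<le> norm (?M z)"
        proof (cases "z \<in> box")
          case True
          then have r: "r \<in> {s<..<t}" "x \<in> {l..u'}" by (auto simp: z box_def)
          have w1: "\<bar>wb z\<bar> \<le> 1 + (wb z)\<^sup>2"
          proof -
            have "2 * 1 * \<bar>wb z\<bar> \<le> 1\<^sup>2 + \<bar>wb z\<bar>\<^sup>2" by (rule sum_squares_bound)
            then have "2 * \<bar>wb z\<bar> \<le> 1 + (wb z)\<^sup>2" by simp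
            then show ?thesis by linarith
          qed
          have "\<bar>sqrt (cut \<rho> z) * wb z\<bar> \<le> sqrt C * (1 + (wb z)\<^sup>2)"
            unfolding abs_mult using w1 \<rho>_nonneg[of r x] \<rho>_le[of r x] r s0 C_nonneg
            by (intro mult_mono) (auto simp: z cut_eq)
          moreover have "\<bar>cut \<rho> z * cut ubar z - cut rbar z * cut ubar z\<bar> \<le> K" using K[OF r(2), of r] by (simp add: z)
          ultimately have "\<bar>sqrt (cut \<rho> z) * wb z + (cut \<rho> z * cut ubar z - cut rbar z * cut ubar z)\<bar> \<le> sqrt C * (1 + (wb z)\<^sup>2) + K"
            by linarith
          then have "\<bar>sqrt (cut \<rho> z) * wb z + (cut \<rho> z * cut ubar z - cut rbar z * cut ubar z)\<bar> * \<bar>\<phi>' (snd z)\<bar> \<le>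
              (sqrt C * (1 + (wb z)\<^sup>2) + K) * P"
            using P[OF r(2)] C_nonneg K0 by (intro mult_mono) (auto simp: z)
          then have "\<bar>Q wb z\<bar> \<le> ?M z"
            using True r by (simp add: Q_def abs_mult z mult.commute)
          then show ?thesis using M0 by simp
        next
          case False
          then show ?thesis using M0 by (simp add: Q_def)
        qed
      qed
    qed simp
  qed
  define Fl where "Fl r = (LINT x:{l..u'}|lborel. \<rho> (r, x) * vel (r, x) * \<phi>' x)" for r
  define Fb where "Fb r = (LINT x:{l..u'}|lborel. rbar (r, x) * ubar (r, x) * \<phi>' x)" for r
  have slice: "AE r in lborel. (LINT x|lborel. Q wb (r, x)) = indicator {s<..<t} r *\<^sub>R (Fl r - Fb r)"
  proof -
    have "AE r in lborel. integrable lborel (\<lambda>x. Q wb (r, x))"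
      using Q_int unfolding lborel_prod[symmetric] by (rule lborel_pair.AE_integrable_fst')
    then show ?thesis
    proof eventually_elim
      case (elim r)
      show ?case
      proof (cases "r \<in> {s<..<t}")
        case True
        then have r: "0 \<le> r" "r \<le> T0" "0 < \<rho> (r, x)" for x using st T1 \<rho>_pos[of r x] by auto
        have Qe: "Q wb (r, x) = indicator {l..u'} x *\<^sub>R (\<rho> (r, x) * vel (r, x) * \<phi>' x - rbar (r, x) * ubar (r, x) * \<phi>' x)" for x
        proof -
          have "\<rho> (r, x) * (wb (r, x) / sqrt (\<rho> (r, x))) = sqrt (\<rho> (r, x)) * wb (r, x)"
          proof -
            have "\<rho> (r, x) / sqrt (\<rho> (r, x)) = sqrt (\<rho> (r, x))"
              using r(3)[of x] by (intro real_div_sqrt) simp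
            then show ?thesis by (metis times_divide_eq_left times_divide_eq_right)
          qed
          then have "\<rho> (r, x) * vel (r, x) = sqrt (\<rho> (r, x)) * wb (r, x) + \<rho> (r, x) * ubar (r, x)"
            using r by (simp add: vel_def cut_eq distrib_left)
          then show ?thesis
            using True r by (simp add: Q_def box_def cut_eq indicator_def left_diff_distrib distrib_right)
        qed
        have i1: "set_integrable lborel {l..u'} (\<lambda>x. \<rho> (r, x) * vel (r, x) * \<phi>' x - rbar (r, x) * ubar (r, x) * \<phi>' x)"
          using elim unfolding Qe set_integrable_def .
        have i2: "set_integrable lborel {l..u'} (\<lambda>x. rbar (r, x) * ubar (r, x) * \<phi>' x)"
          by (intro borel_integrable_atLeastAtMost' continuous_intros slice_cont[OF wave_cont(1) r(1,2)]
            slice_cont[OF wave_cont(2) r(1,2)] \<phi>'c)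
        \<comment> \<open>Fubini provides integrability of the difference only; adding the
          continuous wave flux recovers that of the density flux.\<close>
        have "set_integrable lborel {l..u'} (\<lambda>x. \<rho> (r, x) * vel (r, x) * \<phi>' x)"
          using set_integral_add(1)[OF i1 i2] by simp
        from set_integral_diff(2)[OF this i2] True show ?thesis
          unfolding Qe Fl_def Fb_def by (simp add: set_lebesgue_integral_def)
      next
        case False
        then have "Q wb (r, x) = 0" for x by (auto simp: Q_def box_def indicator_def)
        then show ?thesis using False by simp
      qed
    qed
  qed
  have ends: "\<phi> l = 0" "\<phi> u' = 0" using out[of l] out[of u'] by auto
  have bal: "(LINT x:{l..u'}|lborel. rbar (t, x) * \<phi> x) - (LINT x:{l..u'}|lborel. rbar (s, x) * \<phi> x) = (LINT r:{s..t}|lborel. Fb r)"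
    unfolding Fb_def by (rule mass_balance(1)[OF s0(1) st(2) lu \<phi> \<phi>'_cont ends])
  have Fb_int: "set_integrable lborel {s..t} Fb"
    unfolding Fb_def by (rule mass_balance(2)[OF s0(1) st(2) lu \<phi> \<phi>'_cont ends])
  have Fb_int': "integrable lborel (\<lambda>r. indicator {s<..<t} r *\<^sub>R Fb r)"
    unfolding set_integrable_def[symmetric] by (rule set_integrable_subset[OF Fb_int]) auto
  have Fl_borel [measurable]: "(\<lambda>r. indicator {s<..<t} r *\<^sub>R Fl r) \<in> borel_measurable lborel"
  proof -
    have "(\<lambda>r. indicator {s<..<t} r *\<^sub>R Fl r) =
        (\<lambda>r. indicator {s<..<t} r *\<^sub>R (LINT x|lborel. indicator {l..u'} x *\<^sub>R (cut \<rho> (r, x) * vel (r, x) * \<phi>' x)))"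
      using s0 by (intro ext) (auto simp: Fl_def set_lebesgue_integral_def cut_eq split: split_indicator)
    then show ?thesis by (simp only:) measurable
  qed
  have diff_int: "integrable lborel (\<lambda>r. indicator {s<..<t} r *\<^sub>R (Fl r - Fb r))"
  proof (rule integrable_cong_AE_imp[OF _ _ slice])
    show "integrable lborel (\<lambda>r. LINT x|lborel. Q wb (r, x))"
      using Q_int unfolding lborel_prod[symmetric] by (rule lborel_pair.integrable_fst')
    show "(\<lambda>r. indicator {s<..<t} r *\<^sub>R (Fl r - Fb r)) \<in> borel_measurable lborel"
      unfolding scaleR_diff_right
      by (intro borel_measurable_diff Fl_borel borel_measurable_integrable[OF Fb_int'])
  qed
  \<comment> \<open>The same recovery, now in time: the difference is integrable by Fubini and
    \<open>Fb\<close> by the balance for the wave.\<close>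
  have Fl_int: "integrable lborel (\<lambda>r. indicator {s<..<t} r *\<^sub>R Fl r)"
    using Bochner_Integration.integrable_add[OF diff_int Fb_int'] by (simp flip: distrib_left)
  have "(LINT z|lborel. Q wb z) = (LINT r|lborel. LINT x|lborel. Q wb (r, x))"
    using Q_int unfolding lborel_prod[symmetric] by (rule lborel_pair.integral_fst'[symmetric])
  also have "\<dots> = (LINT r|lborel. indicator {s<..<t} r *\<^sub>R (Fl r - Fb r))"
  proof (rule integral_cong_AE[OF _ _ slice])
    show "(\<lambda>r. LINT x|lborel. Q wb (r, x)) \<in> borel_measurable lborel" by measurable
  qed (rule borel_measurable_integrable[OF diff_int])
  also have "\<dots> = (LINT r:{s<..<t}|lborel. Fl r) - (LINT r:{s<..<t}|lborel. Fb r)"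
    unfolding scaleR_diff_right set_lebesgue_integral_def
    by (rule Bochner_Integration.integral_diff[OF Fl_int Fb_int'])
  also have "(LINT r:{s<..<t}|lborel. Fl r) = (LINT r:{s<..t}|lborel. Fl r)"
    using st(2) interval_integral_Ioo[of s t Fl] interval_integral_Ioc[of s t Fl] by simp
  also have "(LINT r:{s<..<t}|lborel. Fb r) = (LINT r:{s..t}|lborel. Fb r)"
    using st(2) interval_integral_Ioo[of s t Fb] interval_integral_Icc[of s t Fb] by simp
  finally have main: "(LINT z|lborel. Q wb z) = (LINT r:{s<..t}|lborel. Fl r) - (LINT r:{s..t}|lborel. Fb r)" .
  have lhs: "(LINT x:{l..u'}|lborel. (\<rho> (r, x) - rbar (r, x)) * \<phi> x) =
      (LINT x:{l..u'}|lborel. \<rho> (r, x) * \<phi> x) - (LINT x:{l..u'}|lborel. rbar (r, x) * \<phi> x)" if r: "0 \<le> r" "r \<le> T0" for r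
    unfolding left_diff_distrib
    by (rule set_integral_diff(2); intro borel_integrable_atLeastAtMost' continuous_intros slice_cont[OF \<rho>_cont r]
      slice_cont[OF wave_cont(1) r] \<phi>c)
  show ?thesis
    using weak_mass_slice[OF s0(1) s_t s0(4) lu \<phi> \<phi>'_cont out] flux main bal lhs[OF s0(1,3)] lhs[OF s0(2,4)]
    unfolding Fl_def by linarith
qed

section \<open>A space-Lipschitz version of the velocity and its integrability in time\<close>

text \<open>Given by one explicit limit of averages at all points, so that it is jointly Borel; it
  is Lipschitz and equal to \<open>vel\<close> almost everywhere in space at the times when
  \<open>lip\<close> is finite and \<open>vel\<close> is locally integrable.\<close>

definition vhat :: "real \<times> real \<Rightarrow> real" where
  "vhat z = lim (\<lambda>n. real (Suc n) * (LINT y:{snd z<..snd z + 1 / real (Suc n)}|lborel. vel (fst z, y)))"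

definition lip :: "real \<Rightarrow> ennreal" where
  "lip t = lip_const (\<lambda>x. vel (t, x))"

lemma lip_borel [measurable]: "lip \<in> borel_measurable borel"
  unfolding lip_def[abs_def] by (rule borel_measurable_lip_const) simp

lemma vhat_borel [measurable]: "vhat \<in> borel_measurable borel"
proof -
  have [measurable]: "(fst :: real \<times> real \<Rightarrow> real) \<in> borel_measurable borel" "(snd :: real \<times> real \<Rightarrow> real) \<in> borel_measurable borel"
    by (intro borel_measurable_continuous_onI continuous_intros)+
  have "(\<lambda>z. LINT y:{snd z<..snd z + c}|lborel. vel (fst z, y)) \<in> borel_measurable borel" for c
  proof -
    \<comment> \<open>The interval of integration depends on \<open>z\<close>; a conditional exposes
      the integrand as a jointly measurable function.\<close>
    have "(\<lambda>z. LINT y|lborel. (if snd z < y \<and> y \<le> snd z + c then vel (fst z, y) else 0)) \<in> borel_measurable borel"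
      by (rule lborel.borel_measurable_lebesgue_integral) measurable
    moreover have "(LINT y|lborel. (if snd z < y \<and> y \<le> snd z + c then vel (fst z, y) else 0)) =
      (LINT y:{snd z<..snd z + c}|lborel. vel (fst z, y))" for z
      unfolding set_lebesgue_integral_def by (rule Bochner_Integration.integral_cong) (auto split: split_indicator)
    ultimately show ?thesis by simp
  qed
  then show ?thesis
    unfolding vhat_def[abs_def] by (intro borel_measurable_lim_metric borel_measurable_times borel_measurable_const)
qed

lemma vhat_properties:
  assumes int: "\<And>a b. set_integrable lborel {a<..b} (\<lambda>x. vel (t, x))" and fin: "lip t < \<infinity>"
  shows "\<bar>vhat (t, x) - real (Suc n) * (LINT y:{x<..x + 1 / real (Suc n)}|lborel. vel (t, y))\<bar> \<le> enn2real (lip t) / real (Suc n)"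
    and "\<bar>vhat (t, x) - vhat (t, y)\<bar> \<le> enn2real (lip t) * \<bar>x - y\<bar>"
    and "AE x in lborel. vel (t, x) = vhat (t, x)"
proof -
  have "lip_const (\<lambda>x. vel (t, x)) \<le> ennreal (enn2real (lip t))"
    using fin by (simp add: lip_def)
  then have sd: "\<bar>(LINT y:{a + h<..a + h + r}|lborel. vel (t, y)) - (LINT y:{a<..a + r}|lborel. vel (t, y))\<bar> \<le> enn2real (lip t) * h * r"
    if "a \<in> \<rat>" "h \<in> \<rat>" "r \<in> \<rat>" "0 < h" "0 < r" for a h r
    using that by (simp add: lip_const_le_iff)
  show "\<bar>vhat (t, x) - real (Suc n) * (LINT y:{x<..x + 1 / real (Suc n)}|lborel. vel (t, y))\<bar> \<le> enn2real (lip t) / real (Suc n)"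
    unfolding vhat_def fst_conv snd_conv by (rule second_difference_imp_lipschitz(2)[OF int sd])
  show "\<bar>vhat (t, x) - vhat (t, y)\<bar> \<le> enn2real (lip t) * \<bar>x - y\<bar>"
    unfolding vhat_def fst_conv snd_conv by (rule second_difference_imp_lipschitz(3)[OF int sd])
  show "AE x in lborel. vel (t, x) = vhat (t, x)"
    unfolding vhat_def fst_conv snd_conv by (rule second_difference_imp_lipschitz(4)[OF int sd])
qed

text \<open>Away from vacuum the kinetic energy bounds a spatial average of the velocity uniformly
  in time. This anchors the Lipschitz representative, whose oscillation alone is controlled by
  \<open>lip\<close>.\<close>

lemma average_velocity_bound:
  assumes c: "0 < c" and \<rho>c: "\<And>t x. T1 \<le> t \<Longrightarrow> t \<le> T2 \<Longrightarrow> x1 \<le> x \<Longrightarrow> x \<le> x1 + d \<Longrightarrow> c \<le> \<rho> (t, x)"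
    and T2: "T2 < T0" and d: "0 \<le> d"
  shows "\<exists>K. AE t in lborel. t \<in> {T1<..T2} \<longrightarrow> \<bar>LINT y:{x1<..x1 + d}|lborel. vel (t, y)\<bar> \<le> K"
proof -
  have comp: "compact (ubar ` ({0..T0} \<times> {x1..x1 + d}))"
    by (intro compact_continuous_image compact_Times continuous_on_subset[OF wave_cont(2)]) auto
  then obtain U where U: "\<forall>y \<in> ubar ` ({0..T0} \<times> {x1..x1 + d}). norm y \<le> U"
    using compact_imp_bounded[OF comp] unfolding bounded_iff by blast
  define K where "K = (\<bar>U\<bar> + 1 / sqrt c) * d + C / sqrt c"
  have "AE t in lborel. t \<in> {T1<..T2} \<longrightarrow> \<bar>LINT y:{x1<..x1 + d}|lborel. vel (t, y)\<bar> \<le> K"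
    using wb_square_int
  proof eventually_elim
    case (elim t)
    show ?case
    proof
      assume t: "t \<in> {T1<..T2}"
      then have w2: "integrable lborel (\<lambda>x. (wb (t, x))\<^sup>2)" and wC: "(LINT x|lborel. (wb (t, x))\<^sup>2) \<le> C"
        and t0: "0 \<le> t" "t \<le> T0" using elim T1 T2 by auto
      define G where "G y = indicator {x1<..x1 + d} y * (\<bar>U\<bar> + 1 / sqrt c) + (wb (t, y))\<^sup>2 / sqrt c" for y
      have G1: "integrable lborel (\<lambda>y. indicator {x1<..x1 + d} y * (\<bar>U\<bar> + 1 / sqrt c))"
        by (intro integrable_mult_left integrable_real_indicator) (use d in auto)
      have G2: "integrable lborel (\<lambda>y. (wb (t, y))\<^sup>2 / sqrt c)" by (intro integrable_divide w2)
      have G: "integrable lborel G" unfolding G_def by (intro Bochner_Integration.integrable_add G1 G2)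
      have "\<bar>LINT y:{x1<..x1 + d}|lborel. vel (t, y)\<bar> \<le> (LINT y:{x1<..x1 + d}|lborel. G y)"
      proof (rule abs_set_integral_le[OF G])
        fix y assume y: "y \<in> {x1<..x1 + d}"
        have "\<bar>vel (t, y)\<bar> \<le> \<bar>ubar (t, y)\<bar> + (1 + (wb (t, y))\<^sup>2) / sqrt c"
          using t y by (intro abs_vel_le c \<rho>c t0) auto
        moreover have "\<bar>ubar (t, y)\<bar> \<le> \<bar>U\<bar>"
        proof -
          have "(t, y) \<in> {0..T0} \<times> {x1..x1 + d}" using y t0 by auto
          then have "norm (ubar (t, y)) \<le> U" using U by blast
          then show ?thesis by simp
        qed
        ultimately show "\<bar>vel (t, y)\<bar> \<le> G y" using y by (simp add: G_def add_divide_distrib)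
      qed simp
      also have "\<dots> \<le> (LINT y|lborel. G y)"
        by (rule set_integral_le_integral[OF G]) (use c in \<open>auto simp: G_def\<close>)
      also have "\<dots> = (LINT y|lborel. indicator {x1<..x1 + d} y * (\<bar>U\<bar> + 1 / sqrt c)) + (LINT y|lborel. (wb (t, y))\<^sup>2 / sqrt c)"
        unfolding G_def by (rule Bochner_Integration.integral_add[OF G1 G2])
      also have "(LINT y|lborel. indicator {x1<..x1 + d} y * (\<bar>U\<bar> + 1 / sqrt c)) = (\<bar>U\<bar> + 1 / sqrt c) * d"
        using d by simp
      also have "(LINT y|lborel. (wb (t, y))\<^sup>2 / sqrt c) = (LINT y|lborel. (wb (t, y))\<^sup>2) / sqrt c" by simp
      also have "(\<bar>U\<bar> + 1 / sqrt c) * d + (LINT y|lborel. (wb (t, y))\<^sup>2) / sqrt c \<le> K"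
        unfolding K_def using wC c by (intro add_left_mono divide_right_mono) auto
      finally show "\<bar>LINT y:{x1<..x1 + d}|lborel. vel (t, y)\<bar> \<le> K" .
    qed
  qed
  then show ?thesis ..
qed

text \<open>The bounds over {t..T2} with t > T1 are transferred to the measurable minorant
  \<open>lip\<close>, and Fatou's lemma lets t decrease to \<open>T1\<close>. No limit theorem is
  applied to the derivative norm itself.\<close>

lemma lip_integral_bound:
  assumes M: "\<And>t. T1 < t \<Longrightarrow> (\<integral>\<^sup>+s\<in>{t..T2}. Linf_norm_deriv UNIV (\<lambda>x. u (s, x)) \<partial>lebesgue) \<le> M"
    and b: "b \<le> T2" "b < T0"
  shows "(\<integral>\<^sup>+s\<in>{T1<..b}. lip s \<partial>lborel) \<le> M"
proof -
  have lip_le: "AE s in lborel. s \<in> {T1<..<T0} \<longrightarrow> lip s \<le> Linf_norm_deriv UNIV (\<lambda>x. u (s, x))"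
    using u_eq_vel
    by eventually_elim (auto simp: lip_def intro!: lip_const_le_Linf_norm_deriv)
  define f where "f n s = lip s * indicator {T1 + 1 / real (Suc n)..b} s" for n s
  have f_le: "(\<integral>\<^sup>+s. f n s \<partial>lborel) \<le> M" for n
  proof -
    have "(\<integral>\<^sup>+s. f n s \<partial>lborel) \<le>
      (\<integral>\<^sup>+s. Linf_norm_deriv UNIV (\<lambda>x. u (s, x)) * indicator {T1 + 1 / real (Suc n)..T2} s \<partial>lborel)"
    proof (rule nn_integral_mono_AE)
      show "AE s in lborel. f n s \<le> Linf_norm_deriv UNIV (\<lambda>x. u (s, x)) * indicator {T1 + 1 / real (Suc n)..T2} s"
        using lip_le
      proof eventually_elim
        case (elim s)
        have "0 < 1 / real (Suc n)" by simp
        then have "s \<in> {T1 + 1 / real (Suc n)..b} \<Longrightarrow> s \<in> {T1<..<T0} \<and> s \<in> {T1 + 1 / real (Suc n)..T2}"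
          using b unfolding atLeastAtMost_iff greaterThanLessThan_iff by linarith
        then show ?case using elim by (auto simp: f_def simp del: of_nat_Suc split: split_indicator)
      qed
    qed
    also have "\<dots> \<le> M"
      using M[of "T1 + 1 / real (Suc n)"] by (simp add: nn_integral_completion del: of_nat_Suc)
    finally show ?thesis .
  qed
  have lim: "(\<lambda>n. f n s) \<longlonglongrightarrow> lip s * indicator {T1<..b} s" for s
  proof (cases "T1 < s")
    case True
    obtain N :: nat where N: "1 / (s - T1) < real N" using reals_Archimedean2 by blast
    have "\<forall>n\<ge>N. f n s = lip s * indicator {T1<..b} s"
    proof (intro allI impI)
      fix n assume "n \<ge> N"
      then have "1 / (s - T1) \<le> real (Suc n)" using N by simp
      then have "1 / real (Suc n) \<le> s - T1" using True by (simp add: field_simps del: of_nat_Suc)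
      then show "f n s = lip s * indicator {T1<..b} s" using True by (auto simp: f_def simp del: of_nat_Suc split: split_indicator)
    qed
    then have "\<forall>\<^sub>F n in sequentially. f n s = lip s * indicator {T1<..b} s"
      unfolding eventually_sequentially by blast
    then show ?thesis by (rule tendsto_eventually)
  next
    case False
    have "\<not> T1 + 1 / real (Suc n) \<le> s" for n
    proof -
      have "0 < 1 / real (Suc n)" by simp
      then show ?thesis using False by linarith
    qed
    then have "f n s = lip s * indicator {T1<..b} s" for n
      using False by (simp add: f_def del: of_nat_Suc)
    then show ?thesis by simp
  qed
  have [measurable]: "f n \<in> borel_measurable lborel" for n unfolding f_def[abs_def] by measurable
  have "(\<integral>\<^sup>+s\<in>{T1<..b}. lip s \<partial>lborel) = (\<integral>\<^sup>+s. liminf (\<lambda>n. f n s) \<partial>lborel)"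
    using lim_imp_Liminf[OF sequentially_bot lim] by simp
  also have "\<dots> \<le> liminf (\<lambda>n. \<integral>\<^sup>+s. f n s \<partial>lborel)" by (rule nn_integral_liminf) simp
  also have "\<dots> \<le> limsup (\<lambda>n. \<integral>\<^sup>+s. f n s \<partial>lborel)" by (rule Liminf_le_Limsup) simp
  also have "\<dots> \<le> M" by (rule Limsup_bounded) (simp add: f_le)
  finally show ?thesis .
qed

theorem no_lipschitz_control_after_vacuum:
  assumes vac: "\<rho> (T1, x0) = 0" and T2: "T1 < T2" and fin: "M < \<infinity>"
    and M: "\<And>t. T1 < t \<Longrightarrow> (\<integral>\<^sup>+s\<in>{t..T2}. Linf_norm_deriv UNIV (\<lambda>x. u (s, x)) \<partial>lebesgue) \<le> M"
  shows False
proof -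
  define b0 where "b0 = min T2 ((T1 + T0) / 2)"
  have b0: "T1 < b0" "b0 \<le> T2" "b0 < T0" using T1 T2 by (auto simp: b0_def min_def field_simps)
  have lip_fin: "(\<integral>\<^sup>+s\<in>{T1<..b0}. lip s \<partial>lborel) < \<infinity>"
    using lip_integral_bound[OF M b0(2,3)] fin by (rule le_less_trans)
  have AE_fin: "AE s in lborel. s \<in> {T1<..b0} \<longrightarrow> lip s < \<infinity>"
  proof -
    have "AE s in lborel. lip s * indicator {T1<..b0} s \<noteq> \<infinity>"
      using lip_fin by (intro nn_integral_PInf_AE) auto
    then show ?thesis by eventually_elim (auto simp: less_top)
  qed
  \<comment> \<open>\<open>enn2real\<close> turns the value infinity into 0; by
    \<open>AE_fin\<close> this affects only a null set of times.\<close>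
  define \<Lambda> where "\<Lambda> s = indicator {T1<..b0} s * enn2real (lip s)" for s
  have \<Lambda>_nn: "0 \<le> \<Lambda> s" for s by (simp add: \<Lambda>_def)
  have \<Lambda>_int: "integrable lborel \<Lambda>"
  proof (rule integrableI_nonneg)
    show "\<Lambda> \<in> borel_measurable lborel" unfolding \<Lambda>_def[abs_def] by measurable
    have "(\<integral>\<^sup>+s. ennreal (\<Lambda> s) \<partial>lborel) \<le> (\<integral>\<^sup>+s\<in>{T1<..b0}. lip s \<partial>lborel)"
      by (rule nn_integral_mono) (auto simp: \<Lambda>_def ennreal_enn2real_if split: split_indicator)
    then show "(\<integral>\<^sup>+s. ennreal (\<Lambda> s) \<partial>lborel) < \<infinity>" using lip_fin by (rule le_less_trans)
  qed (simp add: \<Lambda>_nn)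
  obtain x1 where x1: "0 < \<rho> (T1, x1)" using positive_density_at_T1 by blast
  define c where "c = \<rho> (T1, x1) / 2"
  have c: "0 < c" using x1 by (simp add: c_def)
  obtain d where d: "0 < d" and near: "\<And>z. z \<in> {0..T0} \<times> UNIV \<Longrightarrow> dist z (T1, x1) < d \<Longrightarrow> dist (\<rho> z) (\<rho> (T1, x1)) < c"
    using \<rho>_cont T1 c unfolding continuous_on_iff by (metis (no_types, lifting) UNIV_I atLeastAtMost_iff less_imp_le mem_Sigma_iff)
  \<comment> \<open>Allowing d/3 in each coordinate keeps the distance to (T1, x1) below
    \<open>d\<close>.\<close>
  have box: "c \<le> \<rho> (t, x)" if "T1 \<le> t" "t \<le> T0" "t \<le> T1 + d / 3" "x1 \<le> x" "x \<le> x1 + d / 3" for t x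
  proof -
    have "dist (t, x) (T1, x1) \<le> \<bar>t - T1\<bar> + \<bar>x - x1\<bar>"
      unfolding dist_Pair_Pair dist_real_def by (simp add: sqrt_sum_squares_le_sum_abs)
    then have "dist (t, x) (T1, x1) < d" using that d by linarith
    then have "dist (\<rho> (t, x)) (\<rho> (T1, x1)) < c" using that T1 by (intro near) auto
    then show ?thesis unfolding dist_real_def c_def by linarith
  qed
  obtain n :: nat where n: "1 / (d / 3) < real n" using reals_Archimedean2 by blast
  \<comment> \<open>The length has the form 1/(n + 1) so that the average over it is one of those
    defining \<open>vhat\<close>.\<close>
  define \<delta> where "\<delta> = 1 / real (Suc n)"
  have \<delta>: "0 < \<delta>" "\<delta> \<le> d / 3"
  proof -
    have "1 / (d / 3) < real (Suc n)" using n by simp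
    then have "1 < real (Suc n) * (d / 3)" using pos_divide_less_eq[of "d / 3" 1] d by simp
    then show "\<delta> \<le> d / 3" unfolding \<delta>_def using pos_divide_le_eq[of "real (Suc n)" 1 "d / 3"] by (simp add: mult.commute)
  qed (simp add: \<delta>_def)
  have "isCont (\<lambda>t. LINT s:{T1<..t}|lborel. \<Lambda> s) T1"
    using continuous_on_integral_Ioc[OF \<Lambda>_int] by (simp add: continuous_on_eq_continuous_at)
  then have "\<exists>d>0. \<forall>t. dist t T1 < d \<longrightarrow> dist (LINT s:{T1<..t}|lborel. \<Lambda> s) (LINT s:{T1<..T1}|lborel. \<Lambda> s) < 1 / 4"
    unfolding continuous_at_eps_delta by (elim allE[of _ "1 / 4"]) simp
  then obtain d' where d': "0 < d'" and small: "\<And>t. dist t T1 < d' \<Longrightarrow>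
      dist (LINT s:{T1<..t}|lborel. \<Lambda> s) (LINT s:{T1<..T1}|lborel. \<Lambda> s) < 1 / 4"
    by blast
  \<comment> \<open>Short enough for the density to stay above \<open>c\<close> near
    \<open>x1\<close> and for the Lipschitz constant to have integral at most 1/4.\<close>
  define b where "b = min b0 (min (T1 + d / 3) (T1 + d' / 2))"
  have b: "T1 < b" "b \<le> b0" "b \<le> T1 + d / 3" "b < T0" "dist b T1 < d'"
    using b0 d d' by (auto simp: b_def dist_real_def)
  have \<Lambda>_small: "(LINT s:{T1<..b}|lborel. \<Lambda> s) \<le> 1 / 4"
    using small[OF b(5)] by (simp add: dist_real_def set_lebesgue_integral_def)
  have "\<exists>K. AE t in lborel. t \<in> {T1<..b} \<longrightarrow> \<bar>LINT y:{x1<..x1 + \<delta>}|lborel. vel (t, y)\<bar> \<le> K"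
    by (rule average_velocity_bound[OF c box b(4)]) (use b \<delta> in auto)
  then obtain K where K: "AE t in lborel. t \<in> {T1<..b} \<longrightarrow> \<bar>LINT y:{x1<..x1 + \<delta>}|lborel. vel (t, y)\<bar> \<le> K"
    by blast
  \<comment> \<open>Good times are those at which the representative is Lipschitz and its anchoring
    average is bounded. A Borel null set outside which this holds is removed, and the field is set
    to 0 at the removed times.\<close>
  define good where "good t \<longleftrightarrow> (\<forall>a b. set_integrable lborel {a<..b} (\<lambda>x. vel (t, x))) \<and> lip t < \<infinity> \<and>
      \<bar>LINT y:{x1<..x1 + \<delta>}|lborel. vel (t, y)\<bar> \<le> K" for t
  have "AE t in lborel. t \<in> {T1<..b} \<longrightarrow> good t"
    using K vel_int AE_fin by eventually_elim (use b in \<open>auto simp: good_def\<close>)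
  then obtain N where goodN: "\<And>t. t \<in> space lborel - N \<Longrightarrow> t \<in> {T1<..b} \<longrightarrow> good t" and N: "N \<in> null_sets lborel"
    by (rule AE_E3) (rule that)
  have good: "\<And>a b. set_integrable lborel {a<..b} (\<lambda>x. vel (t, x))" "lip t < \<infinity>"
    "\<bar>LINT y:{x1<..x1 + \<delta>}|lborel. vel (t, y)\<bar> \<le> K" if "t \<notin> N" "t \<in> {T1<..b}" for t
    using goodN[of t] that by (auto simp: good_def)
  define G where "G = {T1<..b} - N"
  have G_borel [measurable]: "G \<in> sets borel" using N by (auto simp: G_def null_sets_def)
  have G_sub: "t \<in> G \<Longrightarrow> T1 < t \<and> t \<le> b" for t by (simp add: G_def)
  define L where "L t = indicator G t * enn2real (lip t)" for t
  define v where "v z = indicator (G \<times> UNIV) z * vhat z" for z :: "real \<times> real"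
  \<comment> \<open>The scaled average is at most (n + 1) K; passing from it to the value at
    \<open>x1\<close> costs at most \<open>L t\<close>, and moving from \<open>x1\<close> to 0 costs
    another \<open>L t * \<bar>x1\<bar>\<close>.\<close>
  define g where "g t = indicator G t * (real (Suc n) * K) + L t * (1 + \<bar>x1\<bar>)" for t
  have vG: "v (t, x) = vhat (t, x)" if "t \<in> G" for t x using that by (simp add: v_def)
  have v0: "v (t, x) = 0" if "t \<notin> G" for t x using that by (simp add: v_def)
  have LL: "L t \<le> \<Lambda> t * indicator {T1<..b} t" "L t \<le> \<Lambda> t" for t
    using G_sub[of t] b by (auto simp: L_def \<Lambda>_def split: split_indicator)
  have L_nn: "0 \<le> L t" for t by (simp add: L_def)
  have L_int: "integrable lborel L"
  proof (rule Bochner_Integration.integrable_bound[OF \<Lambda>_int])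
    show "L \<in> borel_measurable lborel" unfolding L_def[abs_def] by measurable
    show "AE t in lborel. norm (L t) \<le> norm (\<Lambda> t)" using LL(2) L_nn \<Lambda>_nn by simp
  qed
  interpret F: lipschitz_field v L g
  proof
    have [measurable]: "G \<times> UNIV \<in> sets (borel :: (real \<times> real) measure)" by (intro borel_Times) auto
    show "v \<in> borel_measurable borel" unfolding v_def[abs_def] by measurable
    show "\<bar>v (t, x) - v (t, y)\<bar> \<le> L t * \<bar>x - y\<bar>" for t x y
    proof (cases "t \<in> G")
      case True
      then show ?thesis
        using vhat_properties(2)[OF good(1,2), of t x y] by (simp add: vG L_def G_def)
    qed (simp add: v0 L_def)
    show "\<bar>v (t, 0)\<bar> \<le> g t" for t
    proof (cases "t \<in> G")
      case True
      then have tN: "t \<notin> N" "t \<in> {T1<..b}" by (auto simp: G_def)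
      note t = good[OF tN]
      have "\<bar>vhat (t, 0) - vhat (t, x1)\<bar> \<le> enn2real (lip t) * \<bar>x1\<bar>"
        using vhat_properties(2)[OF t(1,2), of 0 x1] by simp
      moreover have "\<bar>vhat (t, x1) - real (Suc n) * (LINT y:{x1<..x1 + \<delta>}|lborel. vel (t, y))\<bar> \<le> enn2real (lip t) / real (Suc n)"
        unfolding \<delta>_def by (rule vhat_properties(1)[OF t(1,2)])
      moreover have "enn2real (lip t) / real (Suc n) \<le> enn2real (lip t)"
        using divide_left_mono[of 1 "real (Suc n)" "enn2real (lip t)"] by simp
      moreover have "\<bar>real (Suc n) * (LINT y:{x1<..x1 + \<delta>}|lborel. vel (t, y))\<bar> \<le> real (Suc n) * K"
        unfolding abs_mult abs_of_nat by (intro mult_left_mono t(3)) simp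
      ultimately have "\<bar>vhat (t, 0)\<bar> \<le> real (Suc n) * K + (enn2real (lip t) + enn2real (lip t) * \<bar>x1\<bar>)"
        by linarith
      then show ?thesis using True by (simp add: vG g_def L_def distrib_left del: of_nat_Suc)
    qed (simp add: v0 g_def L_def)
    show "integrable lborel L" by (rule L_int)
    have "emeasure lborel G \<le> emeasure lborel {T1<..b}" using G_sub by (intro emeasure_mono) auto
    also have "\<dots> < \<infinity>" using b by simp
    finally have G_fin: "emeasure lborel G < \<infinity>" .
    show "integrable lborel g"
      unfolding g_def
      by (intro Bochner_Integration.integrable_add integrable_mult_left integrable_real_indicator L_int G_fin) simp
    have "(LINT t|lborel. L t) \<le> (LINT t|lborel. indicator {T1<..b} t *\<^sub>R \<Lambda> t)"
    proof (rule integral_mono[OF L_int])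
      show "integrable lborel (\<lambda>t. indicator {T1<..b} t *\<^sub>R \<Lambda> t)"
        using integrable_imp_set_integrable[OF \<Lambda>_int, of "{T1<..b}"] by (simp add: set_integrable_def)
      show "L t \<le> indicator {T1<..b} t *\<^sub>R \<Lambda> t" for t using LL(1)[of t] by (simp add: mult.commute)
    qed
    also have "\<dots> \<le> 1 / 4" using \<Lambda>_small by (simp only: set_lebesgue_integral_def)
    finally show "(LINT t|lborel. L t) \<le> 1 / 4" .
  qed
  have cut_bound: "0 \<le> cut \<rho> z" "cut \<rho> z \<le> C" for z
    using \<rho>_nonneg[of "fst z" "snd z"] \<rho>_le[of "fst z" "snd z"] C_nonneg
    by (cases z; auto simp: cut_def split: split_indicator)+
  have cut_cont: "continuous_on ({T1..b} \<times> UNIV) (cut \<rho>)"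
    by (rule continuous_on_eq[OF continuous_on_subset[OF \<rho>_cont]]) (use T1 b in \<open>auto simp: cut_eq\<close>)
  interpret Tr: mass_transport v L g "cut \<rho>" C T1 b
  proof
    show "T1 \<le> b" using b by simp
    fix s t x y :: real assume st: "T1 \<le> s" "s \<le> t" "t \<le> b" and xy: "x < y"
    show "(LINT z:{x<..y}|lborel. cut \<rho> (t, z)) - (LINT z:{x<..y}|lborel. cut \<rho> (s, z)) =
      - (LINT r:{s<..t}|lborel. cut \<rho> (r, y) * v (r, y) - cut \<rho> (r, x) * v (r, x))"
    proof (rule F.weak_form_imp_flux_balance[OF cut_measurable(1) cut_cont cut_bound st xy])
      fix \<phi> \<phi>' :: "real \<Rightarrow> real" and l u' :: real
      assume lu: "l \<le> u'" and \<phi>: "\<And>x. (\<phi> has_real_derivative \<phi>' x) (at x)" and \<phi>'_cont: "continuous_on UNIV \<phi>'"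
        and out: "\<And>x. x \<notin> {l<..<u'} \<Longrightarrow> \<phi> x = 0 \<and> \<phi>' x = 0"
      have [measurable]: "\<phi>' \<in> borel_measurable borel" by (rule borel_measurable_continuous_onI[OF \<phi>'_cont])
      have r0: "0 \<le> r" "r \<le> T0" if "s \<le> r" "r \<le> t" for r using that st T1 b by auto
      have c1: "(LINT x:{l..u'}|lborel. cut \<rho> (r, x) * \<phi> x) = (LINT x:{l..u'}|lborel. \<rho> (r, x) * \<phi> x)" if "r = s \<or> r = t" for r
        using r0[of r] that st by (auto simp: cut_eq)
      let ?J = "\<lambda>f r. indicator {s<..t} r *\<^sub>R (LINT x|lborel. indicator {l..u'} x *\<^sub>R (cut \<rho> (r, x) * f (r, x) * \<phi>' x))"
      have "(LINT r:{s<..t}|lborel. LINT x:{l..u'}|lborel. \<rho> (r, x) * vel (r, x) * \<phi>' x) =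
        (LINT r:{s<..t}|lborel. LINT x:{l..u'}|lborel. cut \<rho> (r, x) * vel (r, x) * \<phi>' x)"
        unfolding set_lebesgue_integral_def[of _ "{s<..t}"]
        by (rule Bochner_Integration.integral_cong) (auto simp: cut_eq r0 split: split_indicator)
      \<comment> \<open>At times outside \<open>N\<close> the field equals \<open>vel\<close> for
        almost every position, so no inner integral changes.\<close>
      also have "\<dots> = (LINT r:{s<..t}|lborel. LINT x:{l..u'}|lborel. cut \<rho> (r, x) * v (r, x) * \<phi>' x)"
        unfolding set_lebesgue_integral_def
      proof (rule integral_cong_AE)
        show "?J vel \<in> borel_measurable lborel"
          by measurable
        note F.v_borel [measurable]
        show "?J v \<in> borel_measurable lborel"
          by measurable
        have "AE r in lborel. r \<notin> N" using N by (rule AE_not_in)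
        then show "AE r in lborel. ?J vel r =
          ?J v r"
        proof eventually_elim
          case (elim r)
          show ?case
          proof (cases "r \<in> {s<..t}")
            case True
            then have rb: "r \<in> {T1<..b}" using st by auto
            then have rG: "r \<in> G" using elim by (simp add: G_def)
            have "AE x in lborel. vel (r, x) = v (r, x)"
              unfolding vG[OF rG] by (rule vhat_properties(3)[OF good(1,2)[OF elim rb]])
            then have "(LINT x|lborel. indicator {l..u'} x *\<^sub>R (cut \<rho> (r, x) * vel (r, x) * \<phi>' x)) =
              (LINT x|lborel. indicator {l..u'} x *\<^sub>R (cut \<rho> (r, x) * v (r, x) * \<phi>' x))"
              by (intro integral_cong_AE) (measurable, auto elim: eventually_mono)
            then show ?thesis by simp
          qed simp
        qed
      qed
      finally show "(LINT x:{l..u'}|lborel. cut \<rho> (t, x) * \<phi> x) - (LINT x:{l..u'}|lborel. cut \<rho> (s, x) * \<phi> x) =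
          (LINT r:{s<..t}|lborel. LINT x:{l..u'}|lborel. cut \<rho> (r, x) * v (r, x) * \<phi>' x)"
        using iterated_weak_mass[OF st(1,2) _ lu \<phi> \<phi>'_cont out] st(3) b(4) c1[of s] c1[of t] by simp
    qed
  qed (use cut_bound cut_cont cut_measurable(1) in auto)
  have "cut \<rho> (T1, x0) = 0" using vac T1 by (simp add: cut_eq)
  then obtain x where "cut \<rho> (b, x) = 0" using Tr.vacuum_transported by blast
  then show False using \<rho>_pos[of b x] b T1 by (simp add: cut_eq)
qed

end

section \<open>Convexity of the potential and the passage from the solution concept to
  blow-up\<close>

lemma rel_potential_nonneg:
  assumes \<gamma>: "1 < \<gamma>" and r: "0 \<le> r" and s: "0 < s"
  shows "0 \<le> rel_potential \<gamma> r s"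
proof -
  have "\<gamma> * s powr (\<gamma> - 1) * (r - s) \<le> r powr \<gamma> - s powr \<gamma>"
  \<comment> \<open>The tangent inequality for the convex power follows from the mean value theorem;
    vacuum is separate because the derivative of \<open>powr\<close> is used at positive points
    only.\<close>
  proof (cases "r = 0")
    case True
    have "s powr (\<gamma> - 1) * s = s powr \<gamma>" using s by (simp add: powr_diff)
    then have "\<gamma> * s powr (\<gamma> - 1) * (r - s) = - (\<gamma> * s powr \<gamma>)" using True by (simp add: mult.assoc)
    also have "\<dots> \<le> - (1 * s powr \<gamma>)" using \<gamma> by (intro le_imp_neg_le mult_right_mono) auto
    also have "\<dots> = r powr \<gamma> - s powr \<gamma>" using True by simp
    finally show ?thesis .
  next
    case False
    then have r0: "0 < r" using r by simp
    have d: "((\<lambda>x. x powr \<gamma>) has_real_derivative \<gamma> * x powr (\<gamma> - 1)) (at x)" if "0 < x" for x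
      using that by (rule has_real_derivative_powr)
    consider "s < r" | "r < s" | "r = s" by linarith
    then show ?thesis
    proof cases
      case 1
      then obtain z where z: "s < z" "z < r" "r powr \<gamma> - s powr \<gamma> = (r - s) * (\<gamma> * z powr (\<gamma> - 1))"
        using MVT2[OF 1, of "\<lambda>x. x powr \<gamma>" "\<lambda>x. \<gamma> * x powr (\<gamma> - 1)"] d s by force
      have "(r - s) * (\<gamma> * s powr (\<gamma> - 1)) \<le> (r - s) * (\<gamma> * z powr (\<gamma> - 1))"
        using z s \<gamma> 1 by (intro mult_left_mono powr_mono2) auto
      then show ?thesis using z by (simp add: mult.commute)
    next
      case 2
      then obtain z where z: "r < z" "z < s" "s powr \<gamma> - r powr \<gamma> = (s - r) * (\<gamma> * z powr (\<gamma> - 1))"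
        using MVT2[OF 2, of "\<lambda>x. x powr \<gamma>" "\<lambda>x. \<gamma> * x powr (\<gamma> - 1)"] d r0 by force
      have "(s - r) * (\<gamma> * z powr (\<gamma> - 1)) \<le> (s - r) * (\<gamma> * s powr (\<gamma> - 1))"
        using z r0 \<gamma> 2 by (intro mult_left_mono powr_mono2) auto
      moreover have "\<gamma> * s powr (\<gamma> - 1) * (r - s) = - ((s - r) * (\<gamma> * s powr (\<gamma> - 1)))" by (simp add: algebra_simps)
      ultimately show ?thesis using z by linarith
    qed simp
  qed
  then show ?thesis using \<gamma> by (simp add: rel_potential_def)
qed

text \<open>Phrased as unboundedness above each finite \<open>M\<close>, the form that yields both
  limits of the theorem. The proof extracts the separate kinetic and potential bounds from the
  combined energy and supplies the Borel version of the weighted velocity.\<close>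

lemma velocity_gradient_not_integrable:
  assumes \<gamma>: "1 < \<gamma>"
    and wave: "smooth_2_rarefaction \<gamma> q \<eta> \<rho>m um \<rho>p up rbar ubar"
    and sol: "weak_solution \<gamma> \<alpha> rbar ubar \<rho>0 m0 \<rho> u"
    and cont: "continuous_on ({0..T0} \<times> UNIV) \<rho>"
    and bounds: "uniform_bounds \<gamma> \<alpha> rbar ubar \<rho> u C"
    and \<rho>1: "0 < \<rho>1" "\<rho>1 < (INF z\<in>{0..} \<times> UNIV. rbar z)"
    and T1: "0 \<le> T1" "T1 < T0" and vac: "\<rho> (T1, x0) = 0"
    and pos: "\<And>t x. T1 < t \<Longrightarrow> t \<le> T0 \<Longrightarrow> 0 < \<rho> (t, x)"
    and T2: "T1 < T2" and M: "M < \<infinity>"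
  shows "\<exists>t>T1. M < (\<integral>\<^sup>+s\<in>{t..T2}. Linf_norm_deriv UNIV (\<lambda>x. u (s, x)) \<partial>lebesgue)"
proof (rule ccontr)
  assume "\<not> (\<exists>t>T1. M < (\<integral>\<^sup>+s\<in>{t..T2}. Linf_norm_deriv UNIV (\<lambda>x. u (s, x)) \<partial>lebesgue))"
  then have le_M: "(\<integral>\<^sup>+s\<in>{t..T2}. Linf_norm_deriv UNIV (\<lambda>x. u (s, x)) \<partial>lebesgue) \<le> M" if "T1 < t" for t
    using that by (meson not_less)
  obtain w where w: "burgers_solution q \<eta> (lambda2 \<gamma> \<rho>m um) (lambda2 \<gamma> \<rho>p up) w"
    and wb: "\<And>t x. 0 \<le> t \<Longrightarrow> rbar (t, x) > 0 \<and> lambda2 \<gamma> (rbar (t, x)) (ubar (t, x)) = w (1 + t, x) \<and>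
      Sigma2 \<gamma> (rbar (t, x)) (ubar (t, x)) = Sigma2 \<gamma> \<rho>m um"
    using wave unfolding smooth_2_rarefaction_def by metis
  have T0: "0 < T0" using T1 by simp
  have \<rho>_bounds: "0 \<le> \<rho> (t, x)" "\<rho> (t, x) \<le> C" if "0 \<le> t" "t \<le> T0" for t x
    using bounds T0 that unfolding uniform_bounds_def by auto
  have rbar_ge: "\<rho>1 \<le> rbar (t, x)" if "0 \<le> t" for t x
  proof -
    have "bdd_below (rbar ` ({0..} \<times> UNIV))"
      by (rule bdd_belowI[of _ 0]) (use wb in \<open>auto intro: less_imp_le\<close>)
    then have "(INF z\<in>{0..} \<times> UNIV. rbar z) \<le> rbar (t, x)"
      by (rule cINF_lower) (use that in simp)
    then show ?thesis using \<rho>1 by simp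
  qed
  let ?e = "\<lambda>t x. (wvel ubar \<rho> u (t, x))\<^sup>2 + (wdx (\<lambda>z. \<rho> z powr (\<alpha> - 1/2)) (t, x))\<^sup>2 + rel_potential \<gamma> (\<rho> (t, x)) (rbar (t, x))"
  let ?E = "\<lambda>t. \<integral>\<^sup>+x. ennreal (?e t x) \<partial>lebesgue"
  obtain Z where "esssup (lebesgue_on {0..T0}) ?E + Z \<le> ennreal C"
    using bounds T0 unfolding uniform_bounds_def by blast
  then have le_C: "esssup (lebesgue_on {0..T0}) ?E \<le> ennreal C"
    by (rule order_trans[OF add_increasing2[OF zero_le order_refl]])
  have "AE t in lebesgue_on {0..T0}. ?E t \<le> esssup (lebesgue_on {0..T0}) ?E"
    by (rule esssup_AE)
  then have "AE t in lebesgue_on {0..T0}. ?E t \<le> ennreal C"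
    by eventually_elim (rule order_trans[OF _ le_C])
  then have "AE t in lebesgue. t \<in> {0..T0} \<longrightarrow> ?E t \<le> ennreal C"
    by (subst (asm) AE_restrict_space_iff) auto
  then have E: "AE t in lborel. t \<in> {0..T0} \<longrightarrow> (\<integral>\<^sup>+x. ennreal (?e t x) \<partial>lborel) \<le> ennreal C"
    unfolding AE_completion_iff nn_integral_completion .
  have rp: "0 \<le> rel_potential \<gamma> (\<rho> (t, x)) (rbar (t, x))" if "0 \<le> t" "t \<le> T0" for t x
    by (rule rel_potential_nonneg[OF \<gamma>]) (use \<rho>_bounds that wb in auto)
  \<comment> \<open>A single summand of the energy is bounded by the sum because the other summands
    are non-negative, for the potential by convexity.\<close>
  have part: "AE t in lborel. t \<in> {0<..<T0} \<longrightarrow> (\<integral>\<^sup>+x. ennreal (f t x) \<partial>lborel) \<le> ennreal C"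
    if f: "\<And>t x. 0 \<le> t \<Longrightarrow> t \<le> T0 \<Longrightarrow> f t x \<le> ?e t x" for f
    using E
  proof eventually_elim
    case (elim t)
    show ?case
    proof
      assume t: "t \<in> {0<..<T0}"
      then have "(\<integral>\<^sup>+x. ennreal (f t x) \<partial>lborel) \<le> (\<integral>\<^sup>+x. ennreal (?e t x) \<partial>lborel)"
        by (intro nn_integral_mono ennreal_leI f) auto
      also have "\<dots> \<le> ennreal C" using elim t by auto
      finally show "(\<integral>\<^sup>+x. ennreal (f t x) \<partial>lborel) \<le> ennreal C" .
    qed
  qed
  have meas: "wvel ubar \<rho> u \<in> borel_measurable (lebesgue_on (strip T0))"
    using sol T0 unfolding weak_solution_def weak_regularity_def Linf_L2_def by blast
  interpret vacuum_solution \<gamma> "Sigma2 \<gamma> \<rho>m um" w rbar ubar \<rho> u C T0 T1 \<rho>1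
  proof
    show "smooth_on ({0..} \<times> UNIV) w" "\<And>z. z \<in> half_plane \<Longrightarrow> dt w z + w z * dx w z = 0"
      using w unfolding burgers_solution_def by blast+
    show "weak_mass rbar ubar \<rho> u" using sol unfolding weak_solution_def by blast
    show "AE t in lborel. t \<in> {0<..<T0} \<longrightarrow> (\<integral>\<^sup>+x. ennreal ((wvel ubar \<rho> u (t, x))\<^sup>2) \<partial>lborel) \<le> ennreal C"
      by (rule part) (simp add: rp)
    show "AE t in lborel. t \<in> {0<..<T0} \<longrightarrow> (\<integral>\<^sup>+x. ennreal (rel_potential \<gamma> (\<rho> (t, x)) (rbar (t, x))) \<partial>lborel) \<le> ennreal C"
      by (rule part) simp
  qed (use \<gamma> wb \<rho>_bounds rbar_ge meas cont \<rho>1 T1 pos in blast)+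
  have "(\<lambda>z. indicator (strip T0) z * wvel ubar \<rho> u z) \<in> borel_measurable lebesgue"
    using meas by (subst (asm) borel_measurable_restrict_space_iff) (auto simp: open_Times)
  then obtain W where W: "W \<in> borel_measurable lborel" "AE z in lborel. indicator (strip T0) z * wvel ubar \<rho> u z = W z"
    using completion_ex_borel_measurable_real by blast
  interpret vacuum_solution_borel \<gamma> "Sigma2 \<gamma> \<rho>m um" w rbar ubar \<rho> u C T0 T1 \<rho>1 W
    by unfold_locales (use W in simp_all)
  show False by (rule no_lipschitz_control_after_vacuum[OF vac T2 M le_M])
qed

theorem theorem5p1:
  fixes \<gamma> \<alpha> q \<rho>m um \<rho>p up :: real
  assumes "\<gamma> > 1" and "\<alpha> > 1/2" and "q \<ge> 2"
    and "\<rho>m > 0" and "\<rho>p > 0"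
    and "connected_2_rarefaction \<gamma> \<rho>m um \<rho>p up"
  shows "\<exists>\<eta>0>0. \<forall>\<eta>. 0 < \<eta> \<and> \<eta> \<le> \<eta>0 \<longrightarrow>
    (\<forall>rbar ubar \<rho>0 m0 \<rho> u C T0 \<rho>1 T1 \<Omega>0.
       smooth_2_rarefaction \<gamma> q \<eta> \<rho>m um \<rho>p up rbar ubar \<longrightarrow>
       admissible_data \<gamma> \<alpha> \<rho>m um \<rho>p up rbar ubar \<rho>0 m0 \<longrightarrow>
       weak_solution \<gamma> \<alpha> rbar ubar \<rho>0 m0 \<rho> u \<longrightarrow>
       (\<forall>T>0. continuous_on ({0..T} \<times> UNIV) \<rho>) \<longrightarrow>
       (\<exists>t\<ge>0. \<exists>x. \<rho> (t, x) = 0) \<longrightarrow>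
       uniform_bounds \<gamma> \<alpha> rbar ubar \<rho> u C \<longrightarrow>
       0 < T0 \<longrightarrow> 0 < \<rho>1 \<longrightarrow> \<rho>1 < (INF z\<in>{0..} \<times> UNIV. rbar z) \<longrightarrow>
       (\<forall>t\<ge>T0. \<forall>x. \<rho>1 \<le> \<rho> (t, x) \<and> \<rho> (t, x) \<le> C) \<longrightarrow>
       0 \<le> T1 \<longrightarrow> T1 < T0 \<longrightarrow> \<Omega>0 \<noteq> {} \<longrightarrow>
       (\<forall>x\<in>\<Omega>0. \<rho> (T1, x) = 0) \<longrightarrow> (\<forall>x\<in>UNIV - \<Omega>0. \<rho> (T1, x) > 0) \<longrightarrow>
       (\<forall>t x. T1 < t \<and> t \<le> T0 \<longrightarrow> \<rho> (t, x) > 0) \<longrightarrow>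
       (\<forall>\<sigma>>0. ((\<lambda>t. \<integral>\<^sup>+ s\<in>{t..T1 + \<sigma>}. Linf_norm_deriv UNIV (\<lambda>x. u (s, x)) \<partial>lebesgue)
                 \<longlongrightarrow> \<infinity>) (at_right T1)) \<and>
       (\<forall>T2. 0 < T2 \<and> T2 < T0 \<and> L1_W1inf T2 (\<lambda>z. u z - ubar z) \<longrightarrow>
          (\<exists>T3. T2 \<le> T3 \<and> T3 < T0 \<and>
            ((\<lambda>t. \<integral>\<^sup>+ s\<in>{0..t}. Linf_norm_deriv UNIV (\<lambda>x. u (s, x)) \<partial>lebesgue)
                 \<longlongrightarrow> \<infinity>) (at_left T3))))"
\<comment> \<open>The preceding lemma holds for each \<eta> for which a wave is given, so any
  positive number serves as the threshold.\<close>
proof (rule exI[of _ 1], rule conjI[OF zero_less_one], intro allI impI, goal_cases)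
  case (1 \<eta> rbar ubar \<rho>0 m0 \<rho> u C T0 \<rho>1 T1 \<Omega>0)
  note T1 = \<open>0 \<le> T1\<close> \<open>T1 < T0\<close>
  obtain x0 where vac: "\<rho> (T1, x0) = 0" using 1 by blast
  have cont: "continuous_on ({0..T0} \<times> UNIV) \<rho>" using 1 by blast
  have pos: "0 < \<rho> (t, x)" if "T1 < t" "t \<le> T0" for t x using 1 that by blast
  let ?N = "\<lambda>s. Linf_norm_deriv UNIV (\<lambda>x. u (s, x))"
  have unbounded: "\<exists>t>T1. M < (\<integral>\<^sup>+s\<in>{t..T2}. ?N s \<partial>lebesgue)" if "T1 < T2" "M < \<infinity>" for T2 M
    by (rule velocity_gradient_not_integrable[OF \<open>\<gamma> > 1\<close> 1(2) 1(4) cont 1(7) 1(9) 1(10) T1 vac pos that])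
  have mono: "(\<integral>\<^sup>+s\<in>A. ?N s \<partial>lebesgue) \<le> (\<integral>\<^sup>+s\<in>B. ?N s \<partial>lebesgue)" if "A \<subseteq> B" for A B
    using that by (intro nn_integral_mono) (auto split: split_indicator)
  show ?case
  proof (intro conjI allI impI)
    fix \<sigma> :: real assume \<sigma>: "0 < \<sigma>"
    have "((\<lambda>t. \<integral>\<^sup>+s\<in>{t..T1 + \<sigma>}. ?N s \<partial>lebesgue) \<longlongrightarrow> top) (at_right T1)"
      unfolding tendsto_top_iff_ennreal
    proof (intro allI impI)
      fix l :: real
      obtain t where t: "T1 < t" "ennreal l < (\<integral>\<^sup>+s\<in>{t..T1 + \<sigma>}. ?N s \<partial>lebesgue)"
        using unbounded[of "T1 + \<sigma>" "ennreal l"] \<sigma> by auto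
      \<comment> \<open>One time with a large integral is enough: an earlier lower endpoint only
        enlarges the domain of integration.\<close>
      show "\<forall>\<^sub>F t in at_right T1. ennreal l < (\<integral>\<^sup>+s\<in>{t..T1 + \<sigma>}. ?N s \<partial>lebesgue)"
        unfolding eventually_at_right_field
      proof (intro exI[of _ t] conjI allI impI t(1))
        fix r assume "T1 < r" "r < t"
        then show "ennreal l < (\<integral>\<^sup>+s\<in>{r..T1 + \<sigma>}. ?N s \<partial>lebesgue)"
          by (intro less_le_trans[OF t(2) mono]) auto
      qed
    qed
    then show "((\<lambda>t. \<integral>\<^sup>+s\<in>{t..T1 + \<sigma>}. ?N s \<partial>lebesgue) \<longlongrightarrow> \<infinity>) (at_right T1)" by simp
  next
    fix T2 assume T2: "0 < T2 \<and> T2 < T0 \<and> L1_W1inf T2 (\<lambda>z. u z - ubar z)"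
    have inf: "(\<integral>\<^sup>+s\<in>{0..t}. ?N s \<partial>lebesgue) = \<infinity>" if t: "T1 < t" for t
    proof (rule ccontr)
      assume "(\<integral>\<^sup>+s\<in>{0..t}. ?N s \<partial>lebesgue) \<noteq> \<infinity>"
      then have "(\<integral>\<^sup>+s\<in>{0..t}. ?N s \<partial>lebesgue) < \<infinity>" by (simp add: less_top)
      \<comment> \<open>The integral assumed finite is itself taken as the bound \<open>M\<close>,
        and a part of it would then exceed the whole.\<close>
      from unbounded[OF t this] obtain r where
        r: "T1 < r" "(\<integral>\<^sup>+s\<in>{0..t}. ?N s \<partial>lebesgue) < (\<integral>\<^sup>+s\<in>{r..t}. ?N s \<partial>lebesgue)" by blast
      moreover have "(\<integral>\<^sup>+s\<in>{r..t}. ?N s \<partial>lebesgue) \<le> (\<integral>\<^sup>+s\<in>{0..t}. ?N s \<partial>lebesgue)"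
        by (rule mono) (use r(1) T1 in auto)
      ultimately show False by simp
    qed
    \<comment> \<open>\<open>T3\<close> is the midpoint of \<open>m\<close> and \<open>T0\<close>,
      so that times just before \<open>T3\<close> lie after \<open>T1\<close> and \<open>T3\<close>
      itself lies in [T2, T0); the integral is constantly infinite there.\<close>
    define m where "m = max T1 T2"
    have m: "m < (m + T0) / 2" "(m + T0) / 2 < T0" "T1 \<le> m" "T2 \<le> m" using T1 T2 by (auto simp: m_def)
    have "\<forall>\<^sub>F t in at_left ((m + T0) / 2). (\<integral>\<^sup>+s\<in>{0..t}. ?N s \<partial>lebesgue) = \<infinity>"
      unfolding eventually_at_left_field
      by (intro exI[of _ m] conjI allI impI m(1) inf) (use m in linarith)
    then have "((\<lambda>t. \<integral>\<^sup>+s\<in>{0..t}. ?N s \<partial>lebesgue) \<longlongrightarrow> \<infinity>) (at_left ((m + T0) / 2))"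
      by (rule tendsto_eventually)
    moreover have "T2 \<le> (m + T0) / 2" using m by linarith
    ultimately show "\<exists>T3. T2 \<le> T3 \<and> T3 < T0 \<and>
        ((\<lambda>t. \<integral>\<^sup>+s\<in>{0..t}. ?N s \<partial>lebesgue) \<longlongrightarrow> \<infinity>) (at_left T3)"
      using m(2) by blast
  qed
qed

end
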